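(* (Fueter-Sce theorem.) Let $D\subseteq\mathbb{R}^{p+2}$ be an open set invariant under $(\mathbf{x}_p,r)\mapsto(\mathbf{x}_p,-r)$, and let $f(\mathbf{x})=F_1(\mathbf{x}')+\underline{\omega}F_2(\mathbf{x}')$ be a generalized partial-slice regular function on $\Omega_D$. Then, for odd $q\in\mathbb{N}$, the function $\Delta_{\mathbf{x}}^{\frac{q-1}{2}}f$ is monogenic in $\Omega_D$ and $$\Delta_{\mathbf{x}}^{\frac{q-1}{2}}f(\mathbf{x})=(q-1)!!\,\big(A(\mathbf{x}')+\underline{\omega}B(\mathbf{x}')\big),\qquad A(\mathbf{x}')=\Big(\frac1r\partial_r\Big)^{\frac{q-1}{2}}F_1(\mathbf{x}'),\quad B(\mathbf{x}')=\Big(\partial_r\frac1r\Big)^{\frac{q-1}{2}}F_2(\mathbf{x}'),$$ where $\mathbf{x}=\mathbf{x}_p+r\underline{\omega}\in\Omega_D$ and $\mathbf{x}'=(\mathbf{x}_p,r)$, and the values of $A$, $B$ at points with $r=0$ are understood as the limits as $r\to0$ (which exist).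
   Context: Let $\mathbb{A}$ be a real alternative algebra (the associator $[a,b,c]=(ab)c-a(bc)$ is an alternating trilinear function) with unity $1$, of finite real dimension $d>1$, equipped with an anti-involution $a\mapsto a^c$ (real linear, $a^c=a$ for $a\in\mathbb{R}$, $(a^c)^c=a$, $(ab)^c=b^ca^c$). Let $t(x)=x+x^c$, $n(x)=xx^c$, $\mathbb{S}_{\mathbb{A}}=\{x\in\mathbb{A}: t(x)=0,\ n(x)=1\}$ (assumed nonempty) and $Q_{\mathbb{A}}=\mathbb{R}\cup\{x: t(x)\in\mathbb{R},\ n(x)\in\mathbb{R},\ 4n(x)>t(x)^2\}$. Let $M$ be a real subspace with $\mathbb{R}\subsetneq M\subseteq Q_{\mathbb{A}}$ having a basis $(v_0,v_1,\dots,v_m)$, $m\ge1$, $v_0=1$, $v_s\in\mathbb{S}_{\mathbb{A}}$ and $v_sv_t=-v_tv_s$ for distinct $s,t\ge1$; complete it to a real basis of $\mathbb{A}$ and use the associated Euclidean norm $|\cdot|$. Identify $x=\sum_{s=0}^m x_sv_s\in M$ with $(x_0,\dots,x_m)\in\mathbb{R}^{m+1}$; $\mathbb{A}$-valued functions are differentiated componentwise. Fix $p\in\{0,\dots,m-1\}$ and $q=m-p$; write $\mathbf{x}=\mathbf{x}_p+\underline{\mathbf{x}}_q$ with $\mathbf{x}_p=\sum_{s=0}^p x_sv_s$ (identified with $\mathbb{R}^{p+1}$) and $\underline{\mathbf{x}}_q=\sum_{s=p+1}^m x_sv_s$. Let $\mathbb{S}=\{\sum_{s=p+1}^m x_sv_s:\sum_{s=p+1}^m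 x_s^2=1\}$; write $\underline{\mathbf{x}}_q=r\underline{\omega}$ with $r=|\underline{\mathbf{x}}_q|\ge0$, $\underline{\omega}\in\mathbb{S}$, and $\mathbf{x}'=(\mathbf{x}_p,r)\in\mathbb{R}^{p+2}$. Operators (acting on the left): $D_{\mathbf{x}_p}f=\sum_{s=0}^p v_s\partial_{x_s}f$, $\overline{D}_{\mathbf{x}_p}f=\partial_{x_0}f-\sum_{s=1}^p v_s\partial_{x_s}f$, $D_{\mathbf{x}}f=\sum_{s=0}^m v_s\partial_{x_s}f$, $\Delta_{\mathbf{x}}=\sum_{s=0}^m\partial_{x_s}^2$. A $C^1$ function $f$ on an open set of $M$ is monogenic if $D_{\mathbf{x}}f=0$. For an open $D\subseteq\mathbb{R}^{p+2}$ invariant under $(\mathbf{x}_p,r)\mapsto(\mathbf{x}_p,-r)$, its p-symmetric completion is $\Omega_D=\{\mathbf{x}_p+r\underline{\omega}: (\mathbf{x}_p,r)\in D,\ r\ge0,\ \underline{\omega}\in\mathbb{S}\}$. A stem function is $F=(F_1,F_2):D\to\mathbb{A}^2$ with $F_1(\mathbf{x}_p,-r)=F_1(\mathbf{x}_p,r)$, $F_2(\mathbf{x}_p,-r)=-F_2(\mathbf{x}_p,r)$; it induces the generalized partial-slice function $f(\mathbf{x}_p+r\underline{\omega})=F_1(\mathbf{x}_p,r)+\underline{\omega}F_2(\mathbf{x}_p,r)$ on $\Omega_D$. Such $f$ with $F\in C^1$ is generalized partial-slice regular if $D_{\mathbf{x}_p}F_1-\partial_rF_2=0$ and $\overline{D}_{\mathbf{x}_p}F_2+\partial_rF_1=0$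 on $D$. Here $(\partial_r\frac1r)G$ means $\partial_r(G/r)$, and $(q-1)!!$ is the double factorial with $0!!=1$. *)

theory Defs
  imports "HOL-Analysis.Analysis"
begin

text \<open>
  The real alternative algebra is modelled by a finite-dimensional real Euclidean
  space type 'a together with an explicit multiplication mul, unity e and
  anti-involution cj.  Real numbers r are embedded as r *R e.
  Points of M are elements of 'a (x = sum of x_s v_s); the partial derivative
  with respect to the coordinate x_s is the directional derivative along v_s.
\<close>

fun dfact :: "nat \<Rightarrow> nat" where
  "dfact 0 = 1"
| "dfact (Suc 0) = 1"
| "dfact (Suc (Suc n)) = Suc (Suc n) * dfact n"

definition assoc :: "('a \<Rightarrow> 'a \<Rightarrow> 'a::real_vector) \<Rightarrow> 'a \<Rightarrow> 'a \<Rightarrow> 'a \<Rightarrow> 'a" where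
  "assoc mul a b c = mul (mul a b) c - mul a (mul b c)"

definition real_alternative_algebra ::
    "('a::euclidean_space \<Rightarrow> 'a \<Rightarrow> 'a) \<Rightarrow> 'a \<Rightarrow> bool" where
  "real_alternative_algebra mul e \<longleftrightarrow>
     bilinear mul \<and>
     (\<forall>x. mul e x = x \<and> mul x e = x) \<and>
     (\<forall>a b. assoc mul a a b = 0 \<and> assoc mul a b a = 0 \<and> assoc mul b a a = 0)"

definition anti_involution ::
    "('a::euclidean_space \<Rightarrow> 'a \<Rightarrow> 'a) \<Rightarrow> 'a \<Rightarrow> ('a \<Rightarrow> 'a) \<Rightarrow> bool" where
  "anti_involution mul e cj \<longleftrightarrow>
     linear cj \<and> (\<forall>r. cj (r *\<^sub>R e) = r *\<^sub>R e) \<and> (\<forall>a. cj (cj a) = a) \<and>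
     (\<forall>a b. cj (mul a b) = mul (cj b) (cj a))"

definition reals_in :: "'a::real_vector \<Rightarrow> 'a set" where
  "reals_in e = range (\<lambda>r. r *\<^sub>R e)"

definition trace_alg :: "('a \<Rightarrow> 'a) \<Rightarrow> 'a \<Rightarrow> 'a::real_vector" where
  "trace_alg cj x = x + cj x"

definition norm_alg :: "('a \<Rightarrow> 'a \<Rightarrow> 'a) \<Rightarrow> ('a \<Rightarrow> 'a) \<Rightarrow> 'a \<Rightarrow> 'a" where
  "norm_alg mul cj x = mul x (cj x)"

definition sphere_alg :: "('a \<Rightarrow> 'a \<Rightarrow> 'a::real_vector) \<Rightarrow> 'a \<Rightarrow> ('a \<Rightarrow> 'a) \<Rightarrow> 'a set" where
  "sphere_alg mul e cj = {x. trace_alg cj x = 0 \<and> norm_alg mul cj x = e}"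

definition quadratic_cone :: "('a \<Rightarrow> 'a \<Rightarrow> 'a::real_vector) \<Rightarrow> 'a \<Rightarrow> ('a \<Rightarrow> 'a) \<Rightarrow> 'a set" where
  "quadratic_cone mul e cj = reals_in e \<union>
     {x. \<exists>t n::real. trace_alg cj x = t *\<^sub>R e \<and> norm_alg mul cj x = n *\<^sub>R e \<and> 4 * n > t\<^sup>2}"

definition pder :: "'a \<Rightarrow> ('a::real_normed_vector \<Rightarrow> 'b::real_normed_vector) \<Rightarrow> 'a \<Rightarrow> 'b" where
  "pder w g x = vector_derivative (\<lambda>h::real. g (x + h *\<^sub>R w)) (at 0)"

definition has_pder :: "'a \<Rightarrow> ('a::real_normed_vector \<Rightarrow> 'b::real_normed_vector) \<Rightarrow> 'a \<Rightarrow> bool" where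
  "has_pder w g x \<longleftrightarrow> (\<lambda>h::real. g (x + h *\<^sub>R w)) differentiable (at 0)"

definition C1_on :: "(nat \<Rightarrow> 'a) \<Rightarrow> nat \<Rightarrow> 'a set \<Rightarrow> ('a::real_normed_vector \<Rightarrow> 'b::real_normed_vector) \<Rightarrow> bool" where
  "C1_on v m \<Omega> g \<longleftrightarrow> continuous_on \<Omega> g \<and>
     (\<forall>s\<le>m. (\<forall>x\<in>\<Omega>. has_pder (v s) g x) \<and> continuous_on \<Omega> (pder (v s) g))"

definition Dirac :: "('a \<Rightarrow> 'a \<Rightarrow> 'a) \<Rightarrow> (nat \<Rightarrow> 'a) \<Rightarrow> nat \<Rightarrow> ('a::real_normed_vector \<Rightarrow> 'a) \<Rightarrow> 'a \<Rightarrow> 'a" where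
  "Dirac mul v m g x = (\<Sum>s\<le>m. mul (v s) (pder (v s) g x))"

definition Laplace :: "(nat \<Rightarrow> 'a) \<Rightarrow> nat \<Rightarrow> ('a::real_normed_vector \<Rightarrow> 'b::real_normed_vector) \<Rightarrow> 'a \<Rightarrow> 'b" where
  "Laplace v m g x = (\<Sum>s\<le>m. pder (v s) (pder (v s) g) x)"

definition monogenic_on :: "('a \<Rightarrow> 'a \<Rightarrow> 'a) \<Rightarrow> (nat \<Rightarrow> 'a) \<Rightarrow> nat \<Rightarrow> 'a set \<Rightarrow> ('a::real_normed_vector \<Rightarrow> 'a) \<Rightarrow> bool" where
  "monogenic_on mul v m \<Omega> g \<longleftrightarrow> C1_on v m \<Omega> g \<and> (\<forall>x\<in>\<Omega>. Dirac mul v m g x = 0)"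

text \<open>Stem-side operators on functions of x' = (x_p, r), with x_p in span v 0..v p\<close>
definition pder_p :: "'a \<Rightarrow> ('a::real_normed_vector \<times> real \<Rightarrow> 'b::real_normed_vector) \<Rightarrow> 'a \<times> real \<Rightarrow> 'b" where
  "pder_p w G z = vector_derivative (\<lambda>h::real. G (fst z + h *\<^sub>R w, snd z)) (at 0)"

definition has_pder_p :: "'a \<Rightarrow> ('a::real_normed_vector \<times> real \<Rightarrow> 'b::real_normed_vector) \<Rightarrow> 'a \<times> real \<Rightarrow> bool" where
  "has_pder_p w G z \<longleftrightarrow> (\<lambda>h::real. G (fst z + h *\<^sub>R w, snd z)) differentiable (at 0)"

definition pder_r :: "('a \<times> real \<Rightarrow> 'b::real_normed_vector) \<Rightarrow> 'a \<times> real \<Rightarrow> 'b" where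
  "pder_r G z = vector_derivative (\<lambda>h::real. G (fst z, snd z + h)) (at 0)"

definition has_pder_r :: "('a \<times> real \<Rightarrow> 'b::real_normed_vector) \<Rightarrow> 'a \<times> real \<Rightarrow> bool" where
  "has_pder_r G z \<longleftrightarrow> (\<lambda>h::real. G (fst z, snd z + h)) differentiable (at 0)"

definition C1_stem_on :: "(nat \<Rightarrow> 'a) \<Rightarrow> nat \<Rightarrow> ('a \<times> real) set \<Rightarrow> ('a::real_normed_vector \<times> real \<Rightarrow> 'b::real_normed_vector) \<Rightarrow> bool" where
  "C1_stem_on v p D G \<longleftrightarrow> continuous_on D G \<and>
     (\<forall>s\<le>p. (\<forall>z\<in>D. has_pder_p (v s) G z) \<and> continuous_on D (pder_p (v s) G)) \<and>
     (\<forall>z\<in>D. has_pder_r G z) \<and> continuous_on D (pder_r G)"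

definition Dirac_p :: "('a \<Rightarrow> 'a \<Rightarrow> 'a) \<Rightarrow> (nat \<Rightarrow> 'a) \<Rightarrow> nat \<Rightarrow> ('a::real_normed_vector \<times> real \<Rightarrow> 'a) \<Rightarrow> 'a \<times> real \<Rightarrow> 'a" where
  "Dirac_p mul v p G z = (\<Sum>s\<le>p. mul (v s) (pder_p (v s) G z))"

definition Dirac_p_bar :: "('a \<Rightarrow> 'a \<Rightarrow> 'a) \<Rightarrow> (nat \<Rightarrow> 'a) \<Rightarrow> nat \<Rightarrow> ('a::real_normed_vector \<times> real \<Rightarrow> 'a) \<Rightarrow> 'a \<times> real \<Rightarrow> 'a" where
  "Dirac_p_bar mul v p G z = pder_p (v 0) G z - (\<Sum>s\<in>{1..p}. mul (v s) (pder_p (v s) G z))"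

definition inv_r_pder_r :: "('a \<times> real \<Rightarrow> 'b::real_normed_vector) \<Rightarrow> 'a \<times> real \<Rightarrow> 'b" where
  "inv_r_pder_r G z = (1 / snd z) *\<^sub>R pder_r G z"

definition pder_r_inv_r :: "('a \<times> real \<Rightarrow> 'b::real_normed_vector) \<Rightarrow> 'a \<times> real \<Rightarrow> 'b" where
  "pder_r_inv_r G = pder_r (\<lambda>z. (1 / snd z) *\<^sub>R G z)"

definition sphere_q :: "(nat \<Rightarrow> 'a::real_vector) \<Rightarrow> nat \<Rightarrow> nat \<Rightarrow> 'a set" where
  "sphere_q v p m = {(\<Sum>s\<in>{p+1..m}. c s *\<^sub>R v s) | c. (\<Sum>s\<in>{p+1..m}. (c s)\<^sup>2) = 1}"

definition psym_completion :: "(nat \<Rightarrow> 'a::real_vector) \<Rightarrow> nat \<Rightarrow> nat \<Rightarrow> ('a \<times> real) set \<Rightarrow> 'a set" where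
  "psym_completion v p m D =
     {y + r *\<^sub>R w | y r w. (y, r) \<in> D \<and> r \<ge> 0 \<and> w \<in> sphere_q v p m}"

end

theory Submission
  imports Defs
begin

text \<open>
  The components of a regular stem function solve a first-order system whose square is the
  Laplacian, so they are weakly harmonic. Integrating a weakly harmonic function against the
  radial kernels max 0 (s - |z|^2) ^ N gives moments obeying an Euler equation in s; hence the function
  is a local average of itself against such a kernel and is C^2. Its derivatives solve the
  same system, so it is smooth.

  For an even smooth function E of the radius the quotient T E of its r-derivative by r is again even and smooth. With
  A n = T^n F1 and B n = T^n (F2 / r), differentiating the system in r gives
  D (A n) = (2 n + 1) B n + r^2 B (n + 1) and conj D (B n) = - A (n + 1). Put
  g n (x) = A n (x_p, r) + x_q B n (x_p, r), where x = x_p + x_q. Then these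
  identities give Laplacian (g n) = (q - 1 - 2 n) g (n + 1), and the Dirac
  operator annihilates g n when 2 n + 1 = q.
\<close>

section \<open>Directional derivatives\<close>

text \<open>The stem functions are only C^1, while the statement differentiates f up to q times, so
  regularity has to be extracted from the first-order system itself. The two operators whose product
  is the Laplacian cannot be composed on a C^1 function; the derivatives are placed on a test kernel
  instead. Truncated powers serve as kernels because their derivatives in z and in s are explicit
  and stay in one family. The second obstacle is the axis r = 0, where 1/r and omega are both
  singular. Parity makes the singularities removable: K(y, r) / r is the integral of d_r K (y, t r)
  over t in [0, 1] when K vanishes on the axis, and omega F2 is rewritten as x_q (F2 / r), in which
  omega no longer occurs. The algebra is not associative. Every product met here is an iterated left
  multiplication by frame vectors, and alternativity makes these operators satisfy the Clifford
  relations. The constant (q - 1)!! is the product of the factors q - 1 - 2 n collected before the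
  chain reaches 2 n + 1 = q.\<close>

definition has_dir :: "'a::real_normed_vector \<Rightarrow> ('a \<Rightarrow> 'b::real_normed_vector) \<Rightarrow> 'b \<Rightarrow> 'a \<Rightarrow> bool" where
  "has_dir w g d x \<longleftrightarrow> ((\<lambda>h::real. g (x + h *\<^sub>R w)) has_vector_derivative d) (at 0)"

lemma has_dir_pder: "has_dir w g d x \<Longrightarrow> pder w g x = d"
  unfolding has_dir_def pder_def by (rule vector_derivative_at)

lemma has_dir_has_pder: "has_dir w g d x \<Longrightarrow> has_pder w g x"
  unfolding has_dir_def has_pder_def by (rule differentiableI_vector)

lemma has_pder_has_dir: "has_pder w g x \<Longrightarrow> has_dir w g (pder w g x) x"
  unfolding has_dir_def has_pder_def pder_def by (simp add: vector_derivative_works)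

lemma has_dir_unique: "has_dir w g d x \<Longrightarrow> has_dir w g d' x \<Longrightarrow> d = d'"
  using has_dir_pder by metis

lemma has_dir_eq_rhs: "has_dir w g d x \<Longrightarrow> d = d' \<Longrightarrow> has_dir w g d' x"
  by simp

text \<open>Agreement on a short piece of the line through x suffices. This allows an exchange of
  functions that agree only on a relatively open subset of a subspace.\<close>

lemma has_dir_transform:
  assumes "has_dir w g d x" "\<eta> > 0" "\<And>h. \<bar>h\<bar> < \<eta> \<Longrightarrow> k (x + h *\<^sub>R w) = g (x + h *\<^sub>R w)"
  shows "has_dir w k d x"
  using assms(1) unfolding has_dir_def
  by (rule has_vector_derivative_transform_within_open[of _ _ _ "{-\<eta><..<\<eta>}"]) (use assms in auto)

lemma has_dir_shift:
  assumes "has_dir w g d (x + a *\<^sub>R w)"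
  shows "((\<lambda>h. g (x + h *\<^sub>R w)) has_vector_derivative d) (at a)"
proof -
  have "((\<lambda>h::real. h - a) has_real_derivative 1) (at a)"
    by (auto intro!: derivative_eq_intros)
  then have "((\<lambda>h. g (x + a *\<^sub>R w + h *\<^sub>R w)) \<circ> (\<lambda>h. h - a) has_vector_derivative 1 *\<^sub>R d) (at a)"
    using assms unfolding has_dir_def
    by (intro vector_diff_chain_at) (auto simp: has_real_derivative_iff_has_vector_derivative)
  then show ?thesis
    by (simp add: o_def algebra_simps)
qed

lemma has_dir_zero: "has_dir 0 g 0 x"
  by (simp add: has_dir_def)

lemma has_dir_const: "has_dir w (\<lambda>x. c) 0 x"
  by (simp add: has_dir_def)

lemma has_dir_add:
  "has_dir w f d x \<Longrightarrow> has_dir w g d' x \<Longrightarrow> has_dir w (\<lambda>x. f x + g x) (d + d') x"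
  unfolding has_dir_def by (rule has_vector_derivative_add)

lemma has_dir_diff:
  "has_dir w f d x \<Longrightarrow> has_dir w g d' x \<Longrightarrow> has_dir w (\<lambda>x. f x - g x) (d - d') x"
  unfolding has_dir_def by (rule has_vector_derivative_diff)

lemma has_dir_sum:
  "(\<And>i. i \<in> I \<Longrightarrow> has_dir w (f i) (d i) x) \<Longrightarrow> has_dir w (\<lambda>x. \<Sum>i\<in>I. f i x) (\<Sum>i\<in>I. d i) x"
  unfolding has_dir_def by (rule has_vector_derivative_sum)

lemma has_dir_linear:
  "bounded_linear l \<Longrightarrow> has_dir w f d x \<Longrightarrow> has_dir w (\<lambda>x. l (f x)) (l d) x"
  unfolding has_dir_def by (rule bounded_linear.has_vector_derivative)

lemma has_dir_bilinear:
  assumes "bounded_bilinear B" "has_dir w f d x" "has_dir w g d' x"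
  shows "has_dir w (\<lambda>x. B (f x) (g x)) (B (f x) d' + B d (g x)) x"
  using bounded_bilinear.has_vector_derivative[OF assms(1) assms(2,3)[unfolded has_dir_def]]
  by (simp add: has_dir_def)

lemmas has_dir_scaleR = has_dir_bilinear[OF bounded_bilinear_scaleR]

lemma has_dir_inner: "has_dir w (\<lambda>x. x \<bullet> b) (w \<bullet> b) x"
  unfolding has_dir_def by (auto intro!: derivative_eq_intros simp: inner_add_left
      has_real_derivative_iff_has_vector_derivative[symmetric])

text \<open>The restriction of the composite to a line in direction b is literally the restriction
  of F to a line in direction \<open>L b\<close>. The equivalence thus covers an L with a kernel,
  where a direction may be sent to 0.\<close>

lemma has_dir_comp_linear:
  assumes "linear L"
  shows "has_dir b (\<lambda>x. F (L x)) d z \<longleftrightarrow> has_dir (L b) F d (L z)"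
  by (simp add: has_dir_def linear_add[OF assms] linear_scale[OF assms])

lemma pder_comp_linear:
  assumes "linear L"
  shows "pder b (\<lambda>x. F (L x)) z = pder (L b) F (L z)"
  by (simp add: pder_def linear_add[OF assms] linear_scale[OF assms])

section \<open>Differentiation under the integral sign and integrals of derivatives\<close>

lemma has_dir_integral:
  fixes K :: "'x::real_normed_vector \<Rightarrow> 't::euclidean_space \<Rightarrow> 'c::banach"
  assumes \<eta>: "\<eta> > 0" "\<And>h. \<bar>h\<bar> < \<eta> \<Longrightarrow> x + h *\<^sub>R w \<in> W"
    and d: "\<And>z t. z \<in> W \<Longrightarrow> t \<in> cbox a b \<Longrightarrow> has_dir w (\<lambda>x. K x t) (K' z t) z"
    and c: "continuous_on (W \<times> cbox a b) (\<lambda>(z,t). K z t)"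
    and c': "continuous_on (W \<times> cbox a b) (\<lambda>(z,t). K' z t)"
  shows "has_dir w (\<lambda>x. integral (cbox a b) (K x)) (integral (cbox a b) (K' x)) x"
proof -
  let ?U = "{-\<eta><..<\<eta>}"
  have "((\<lambda>h. integral (cbox a b) (K (x + h *\<^sub>R w))) has_vector_derivative
      integral (cbox a b) (K' (x + 0 *\<^sub>R w))) (at 0 within ?U)"
  proof (rule leibniz_rule_vector_derivative)
    fix h t assume h: "h \<in> ?U" "t \<in> cbox a b"
    then have "x + h *\<^sub>R w \<in> W" using \<eta>(2)[of h] by auto
    then show "((\<lambda>h. K (x + h *\<^sub>R w) t) has_vector_derivative K' (x + h *\<^sub>R w) t) (at h within ?U)"
      using has_dir_shift[of w "\<lambda>x. K x t" "K' (x + h *\<^sub>R w) t" x h] d[OF _ h(2)]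
      by (simp add: has_vector_derivative_at_within)
  next
    fix h assume h: "h \<in> ?U"
    then have "x + h *\<^sub>R w \<in> W" using \<eta>(2)[of h] by auto
    then have "continuous_on (cbox a b) (K (x + h *\<^sub>R w))"
      by (intro continuous_on_compose2[OF c, of _ "\<lambda>t. (x + h *\<^sub>R w, t)", simplified] continuous_intros) auto
    then show "K (x + h *\<^sub>R w) integrable_on cbox a b"
      by (rule integrable_continuous)
  next
    have "(\<lambda>z. (x + fst z *\<^sub>R w, snd z)) ` (?U \<times> cbox a b) \<subseteq> W \<times> cbox a b"
      using \<eta>(2) by auto
    then show "continuous_on (?U \<times> cbox a b) (\<lambda>(h, t). K' (x + h *\<^sub>R w) t)"
      using continuous_on_compose2[OF c', of "?U \<times> cbox a b" "\<lambda>z. (x + fst z *\<^sub>R w, snd z)"]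
      by (simp add: case_prod_beta continuous_intros)
  qed (use \<eta> in auto)
  then show ?thesis
    unfolding has_dir_def using at_within_open[of 0 ?U] \<eta> by simp
qed

text \<open>Extended by zero, the function has the same integral over the whole space before and
  after translation; the two support conditions turn both into integrals over the fixed box.\<close>

lemma integral_translate:
  fixes \<phi> :: "'b::euclidean_space \<Rightarrow> 'c::banach"
  assumes cont: "continuous_on UNIV \<phi>"
    and supp: "\<And>x. x \<notin> cbox a b \<Longrightarrow> \<phi> x = 0" "\<And>x. x \<notin> cbox a b \<Longrightarrow> \<phi> (x + t) = 0"
  shows "integral (cbox a b) (\<lambda>x. \<phi> (x + t)) = integral (cbox a b) \<phi>"
proof -
  let ?I = "integral (cbox a b) \<phi>"
  have "(\<phi> has_integral ?I) (cbox a b)"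
    using cont by (meson integrable_continuous integrable_integral continuous_on_subset subset_UNIV)
  then have "((\<lambda>x. \<phi> (x + t)) has_integral ?I) (cbox (a - t) (b - t))"
    using has_integral_affinity'[of \<phi> ?I a b 1 t] by simp
  then have "((\<lambda>x. \<phi> (x + t)) has_integral ?I) UNIV"
  proof (rule has_integral_on_superset)
    fix x assume x: "x \<notin> cbox (a - t) (b - t)"
    then have "x + t \<notin> cbox a b"
      by (simp add: mem_box inner_diff_left inner_add_left diff_le_eq le_diff_eq)
    then show "\<phi> (x + t) = 0" by (rule supp(1))
  qed simp
  then have "((\<lambda>x. if x \<in> cbox a b then \<phi> (x + t) else 0) has_integral ?I) UNIV"
    by (rule has_integral_eq[rotated]) (simp add: supp(2))
  then have "((\<lambda>x. \<phi> (x + t)) has_integral ?I) (cbox a b)"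
    by (simp only: has_integral_restrict_UNIV)
  then show ?thesis by (rule integral_unique)
qed

text \<open>The integral of the translate by y is constant for small y along w, and its derivative
  at 0 is the integral of \<open>\<phi>'\<close>. The argument treats every direction w alike,
  without slicing the box along coordinates.\<close>

lemma integral_dir_deriv_zero:
  fixes \<phi> :: "'b::euclidean_space \<Rightarrow> 'c::banach"
  assumes cont: "continuous_on UNIV \<phi>" "continuous_on UNIV \<phi>'"
    and d: "\<And>x. has_dir w \<phi> (\<phi>' x) x"
    and K: "compact K" "K \<subseteq> box a b" "\<And>x. x \<notin> K \<Longrightarrow> \<phi> x = 0"
  shows "integral (cbox a b) \<phi>' = 0"
proof -
  obtain \<epsilon> where \<epsilon>: "\<epsilon> > 0" "(\<Union>x\<in>K. ball x \<epsilon>) \<subseteq> box a b"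
    using compact_subset_open_imp_ball_epsilon_subset[OF K(1) open_box K(2)] by metis
  \<comment> \<open>The added 1 keeps the denominator positive when \<open>w = 0\<close>.\<close>
  define \<eta> where "\<eta> = \<epsilon> / (norm w + 1)"
  have \<eta>: "\<eta> > 0" using \<epsilon> by (simp add: \<eta>_def add_nonneg_pos)
  have tr: "integral (cbox a b) (\<lambda>x. \<phi> (x + h *\<^sub>R w)) = integral (cbox a b) \<phi>" if h: "\<bar>h\<bar> < \<eta>" for h
  proof (rule integral_translate)
    have "\<bar>h\<bar> * norm w \<le> \<bar>h\<bar> * (norm w + 1)" by (simp add: mult_left_mono)
    also have "\<dots> < \<epsilon>"
      using h pos_less_divide_eq[of "norm w + 1" "\<bar>h\<bar>" \<epsilon>] by (simp add: \<eta>_def add_nonneg_pos)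
    finally have small: "norm (h *\<^sub>R w) < \<epsilon>" by simp
    fix x assume x: "x \<notin> cbox a b"
    show "\<phi> x = 0" using x K(2,3) box_subset_cbox by blast
    have "x + h *\<^sub>R w \<notin> K"
    proof
      assume "x + h *\<^sub>R w \<in> K"
      moreover have "x \<in> ball (x + h *\<^sub>R w) \<epsilon>" using small by (simp add: dist_norm)
      ultimately show False using \<epsilon>(2) x box_subset_cbox by blast
    qed
    then show "\<phi> (x + h *\<^sub>R w) = 0" by (rule K(3))
  qed (rule cont)
  have "has_dir w (\<lambda>y. integral (cbox a b) (\<lambda>x. \<phi> (x + y))) (integral (cbox a b) (\<lambda>x. \<phi>' (x + 0))) 0"
  proof (rule has_dir_integral[where W = UNIV and \<eta> = 1])
    show "has_dir w (\<lambda>y. \<phi> (t + y)) (\<phi>' (t + z)) z" for z t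
      using d[of "t + z"] by (simp add: has_dir_def add_ac)
    show "continuous_on (UNIV \<times> cbox a b) (\<lambda>(z, t). \<phi> (t + z))"
      "continuous_on (UNIV \<times> cbox a b) (\<lambda>(z, t). \<phi>' (t + z))"
      unfolding case_prod_beta
      by (rule continuous_on_compose2[OF cont(1)] continuous_on_compose2[OF cont(2)];
          simp add: continuous_intros)+
  qed auto
  then have "has_dir w (\<lambda>y. integral (cbox a b) (\<lambda>x. \<phi> (x + y))) (integral (cbox a b) \<phi>') 0"
    by simp
  moreover have "has_dir w (\<lambda>y. integral (cbox a b) (\<lambda>x. \<phi> (x + y))) 0 0"
    by (rule has_dir_transform[OF has_dir_const \<eta>]) (use tr in auto)
  ultimately show ?thesis by (rule has_dir_unique)
qed

section \<open>Moments of weakly harmonic functions\<close>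

text \<open>The parameter s is the square of the radius, so that differentiating in z or in s lowers
  the exponent and stays within the family. For positive N there are N - 1 continuous derivatives in
  z.\<close>

definition bump :: "nat \<Rightarrow> real \<Rightarrow> 'b::euclidean_space \<Rightarrow> real" where
  "bump N s z = (max 0 (s - z \<bullet> z)) ^ N"

text \<open>Only t = 0 needs an argument: the difference quotient there is bounded by
  \<open>\<bar>h\<bar> ^ Suc n\<close>, which tends to 0.\<close>

lemma has_real_derivative_max0_power:
  "((\<lambda>t::real. (max 0 t) ^ Suc (Suc n)) has_real_derivative real (Suc (Suc n)) * (max 0 t) ^ Suc n) (at t)"
proof (cases t "0::real" rule: linorder_cases)
  case less
  have "((\<lambda>t::real. 0::real) has_real_derivative 0) (at t)" by simp
  then have "((\<lambda>t::real. (max 0 t) ^ Suc (Suc n)) has_real_derivative 0) (at t)"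
    by (rule has_field_derivative_transform_within_open[of _ _ _ "{..<0}"]) (use less in auto)
  then show ?thesis using less by simp
next
  case greater
  have "((\<lambda>t::real. t ^ Suc (Suc n)) has_real_derivative real (Suc (Suc n)) * t ^ Suc n) (at t)"
    using DERIV_pow[of "Suc (Suc n)" t] by simp
  then have "((\<lambda>t::real. (max 0 t) ^ Suc (Suc n)) has_real_derivative real (Suc (Suc n)) * t ^ Suc n) (at t)"
    by (rule has_field_derivative_transform_within_open[of _ _ _ "{0<..}"]) (use greater in auto)
  then show ?thesis using greater by simp
next
  case equal
  have "((\<lambda>h::real. (max 0 h) ^ Suc (Suc n) / h) \<longlongrightarrow> 0) (at 0)"
  proof (rule Lim_null_comparison)
    have "norm ((max 0 h) ^ Suc (Suc n) / h) \<le> \<bar>h\<bar> ^ Suc n" for h :: real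
    proof (cases "h > 0")
      case False
      then have "norm ((max 0 h) ^ Suc (Suc n) / h) = 0" by (simp add: max_absorb1)
      then show ?thesis by (metis abs_ge_zero zero_le_power)
    qed simp
    then show "\<forall>\<^sub>F h in at 0. norm ((max 0 h) ^ Suc (Suc n) / h) \<le> \<bar>h\<bar> ^ Suc n"
      by simp
    show "((\<lambda>h::real. \<bar>h\<bar> ^ Suc n) \<longlongrightarrow> 0) (at 0)"
      by (rule tendsto_eq_intros refl tendsto_null_power)+ auto
  qed
  then show ?thesis using equal by (simp add: has_field_derivative_iff)
qed

lemma continuous_on_bump [continuous_intros]:
  assumes "continuous_on A f" "continuous_on A g"
  shows "continuous_on A (\<lambda>x. bump N (f x) (g x))"
  unfolding bump_def by (intro continuous_intros assms)

lemma bump_nonneg: "bump N s z \<ge> 0"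
  by (simp add: bump_def)

lemma bump_0: "N > 0 \<Longrightarrow> s \<le> (norm z)\<^sup>2 \<Longrightarrow> bump N s z = 0"
  by (simp add: bump_def power2_norm_eq_inner)

text \<open>Both sides vanish where the truncation is active. The exponent on the left has to be
  positive for this, \<open>bump 0\<close> being 1 everywhere. The identity trades the squared norm
  of z for s in the Laplacian of a kernel.\<close>

lemma bump_Suc: "(s - z \<bullet> z) * bump (Suc N) s z = bump (Suc (Suc N)) s z"
  by (cases "s - z \<bullet> z \<le> 0") (auto simp: bump_def max_def)

lemma has_dir_bump:
  "has_dir w (bump (Suc (Suc n)) s) (- 2 * real (Suc (Suc n)) * (z \<bullet> w) * bump (Suc n) s z) z"
proof -
  have "((\<lambda>h. s - (z + h *\<^sub>R w) \<bullet> (z + h *\<^sub>R w)) has_real_derivative - 2 * (z \<bullet> w)) (at 0)"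
    unfolding inner_add_left inner_add_right
    by (auto intro!: derivative_eq_intros simp: inner_commute)
  from DERIV_chain2[OF has_real_derivative_max0_power[of n "s - (z + 0 *\<^sub>R w) \<bullet> (z + 0 *\<^sub>R w)"] this]
  show ?thesis
    unfolding has_dir_def bump_def has_real_derivative_iff_has_vector_derivative[symmetric]
    by (rule DERIV_cong) (simp add: algebra_simps)
qed

lemma has_dir_bump_s:
  "has_dir 1 (\<lambda>s. bump (Suc (Suc n)) s z) (real (Suc (Suc n)) * bump (Suc n) s z) s"
proof -
  have "((\<lambda>h. (s + h *\<^sub>R 1) - z \<bullet> z) has_real_derivative 1) (at 0)"
    by (auto intro!: derivative_eq_intros)
  from DERIV_chain2[OF has_real_derivative_max0_power[of n "(s + 0 *\<^sub>R 1) - z \<bullet> z"] this]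
  show ?thesis
    unfolding has_dir_def bump_def
    by (simp add: has_real_derivative_iff_has_vector_derivative[symmetric])
qed

section \<open>Convolution with a kernel over a box\<close>

definition kernel_integral :: "'b::euclidean_space \<Rightarrow> 'b \<Rightarrow> ('b \<Rightarrow> real) \<Rightarrow> ('b \<Rightarrow> 'c::euclidean_space) \<Rightarrow> 'b \<Rightarrow> 'c" where
  "kernel_integral a b K F x = integral (cbox a b) (\<lambda>z. K (x - z) *\<^sub>R F z)"

lemma continuous_on_kernel_integral_param:
  fixes F :: "'b::euclidean_space \<Rightarrow> 'c::euclidean_space"
  assumes K: "continuous_on UNIV K" and F: "continuous_on (cbox a b) F"
  shows "continuous_on (UNIV \<times> cbox a b) (\<lambda>(x, z). K (x - z) *\<^sub>R F z)"
proof -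
  have "continuous_on (UNIV \<times> cbox a b) (\<lambda>p. K (fst p - snd p))"
    by (rule continuous_on_compose2[OF K]) (auto intro!: continuous_intros)
  moreover have "continuous_on (UNIV \<times> cbox a b) (\<lambda>p. F (snd p))"
    by (rule continuous_on_compose2[OF F]) (auto intro!: continuous_intros)
  ultimately show ?thesis unfolding case_prod_beta by (rule continuous_on_scaleR)
qed

lemma kernel_integral_integrable:
  fixes F :: "'b::euclidean_space \<Rightarrow> 'c::euclidean_space"
  assumes K: "continuous_on UNIV K" and F: "continuous_on (cbox a b) F"
  shows "(\<lambda>z. K (x - z) *\<^sub>R F z) integrable_on cbox a b"
proof (rule integrable_continuous)
  have "continuous_on (cbox a b) (\<lambda>z. K (x - z))"
    by (rule continuous_on_compose2[OF K]) (auto intro!: continuous_intros)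
  then show "continuous_on (cbox a b) (\<lambda>z. K (x - z) *\<^sub>R F z)"
    using F by (rule continuous_on_scaleR)
qed

lemma continuous_on_kernel_integral:
  assumes K: "continuous_on UNIV K" and F: "continuous_on (cbox a b) F"
  shows "continuous_on UNIV (kernel_integral a b K F)"
  unfolding kernel_integral_def by (intro integral_continuous_on_param continuous_on_kernel_integral_param assms)

lemma has_dir_kernel_integral:
  assumes K: "continuous_on UNIV K" "continuous_on UNIV K'" "\<And>z. has_dir w K (K' z) z"
    and F: "continuous_on (cbox a b) F"
  shows "has_dir w (kernel_integral a b K F) (kernel_integral a b K' F x) x"
  unfolding kernel_integral_def
proof (rule has_dir_integral[where W = UNIV and \<eta> = 1])
  show "has_dir w (\<lambda>x. K (x - t) *\<^sub>R F t) (K' (z - t) *\<^sub>R F t) z" for z t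
  proof -
    have "has_dir w (\<lambda>x. K (x - t)) (K' (z - t)) z"
      using K(3)[of "z - t"] by (simp add: has_dir_def algebra_simps)
    from has_dir_scaleR[OF this has_dir_const[of w "F t"]] show ?thesis by simp
  qed
qed (use continuous_on_kernel_integral_param[OF K(1) F] continuous_on_kernel_integral_param[OF K(2) F] in auto)

text \<open>The sign is positive because the kernel is evaluated at \<open>x - z\<close>: the minus
  from the inner derivative cancels the minus of integration by parts. No boundary term arises,
  since the kernel vanishes outside a compact subset of the open box.\<close>

lemma kernel_integral_by_parts:
  fixes F :: "'b::euclidean_space \<Rightarrow> 'c::euclidean_space"
  assumes F: "continuous_on (cbox a b) F" "continuous_on (cbox a b) F'"
      "\<And>z. z \<in> box a b \<Longrightarrow> has_dir w F (F' z) z"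
    and K: "continuous_on UNIV K" "continuous_on UNIV K'" "\<And>z. has_dir w K (K' z) z"
    and C: "compact C" "C \<subseteq> box a b" "\<And>z. z \<notin> C \<Longrightarrow> K (x - z) = 0" "\<And>z. z \<notin> C \<Longrightarrow> K' (x - z) = 0"
  shows "kernel_integral a b K F' x = kernel_integral a b K' F x"
proof -
  define \<phi> where "\<phi> z = K (x - z) *\<^sub>R F z" for z
  define \<phi>' where "\<phi>' z = K (x - z) *\<^sub>R F' z - K' (x - z) *\<^sub>R F z" for z
  \<comment> \<open>F is controlled inside the box and the product is zero off C. These two open
    sets cover the space, so continuity and differentiability are checked on each.\<close>
  have UN: "box a b \<union> - C = UNIV" using C(2) by auto
  have oC: "open (- C)" using C(1) compact_imp_closed by auto
  have Fb: "continuous_on (box a b) F" "continuous_on (box a b) F'"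
    using F continuous_on_subset box_subset_cbox by blast+
  have Kx: "continuous_on A (\<lambda>z. K (x - z))" "continuous_on A (\<lambda>z. K' (x - z))" for A
    by (intro continuous_on_compose2[OF K(1)] continuous_on_compose2[OF K(2)] continuous_intros; simp)+
  have "continuous_on (box a b \<union> - C) \<phi>"
  proof (rule continuous_on_open_Un[OF open_box oC])
    show "continuous_on (box a b) \<phi>" unfolding \<phi>_def by (intro continuous_on_scaleR Kx Fb)
    have "continuous_on (- C) (\<lambda>z. 0::'c)" by simp
    then show "continuous_on (- C) \<phi>"
      by (rule continuous_on_eq) (simp add: \<phi>_def C)
  qed
  moreover have "continuous_on (box a b \<union> - C) \<phi>'"
  proof (rule continuous_on_open_Un[OF open_box oC])
    show "continuous_on (box a b) \<phi>'" unfolding \<phi>'_def by (intro continuous_on_diff continuous_on_scaleR Kx Fb)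
    have "continuous_on (- C) (\<lambda>z. 0::'c)" by simp
    then show "continuous_on (- C) \<phi>'"
      by (rule continuous_on_eq) (simp add: \<phi>'_def C)
  qed
  moreover have "has_dir w \<phi> (\<phi>' z) z" for z
  proof (cases "z \<in> box a b")
    case True
    have "has_dir (- w) K (- K' (x - z)) (x - z)"
    proof -
      have "((\<lambda>h::real. - h) has_real_derivative - 1) (at 0)" by (auto intro!: derivative_eq_intros)
      then have "((\<lambda>h. K (x - z + h *\<^sub>R w)) \<circ> (\<lambda>h. - h) has_vector_derivative (- 1) *\<^sub>R K' (x - z)) (at 0)"
        using K(3)[of "x - z"] unfolding has_dir_def
        by (intro vector_diff_chain_at) (auto simp: has_real_derivative_iff_has_vector_derivative)
      then show ?thesis by (simp add: has_dir_def o_def)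
    qed
    then have "has_dir w (\<lambda>z. K (x - z)) (- K' (x - z)) z"
      by (simp add: has_dir_def algebra_simps)
    from has_dir_scaleR[OF this F(3)[OF True]] show ?thesis
      by (simp add: \<phi>_def[abs_def] \<phi>'_def)
  next
    case False
    then have z: "z \<in> - C" using C(2) by auto
    then obtain \<epsilon> where \<epsilon>: "\<epsilon> > 0" "ball z \<epsilon> \<subseteq> - C"
      using oC open_contains_ball by blast
    have "has_dir w \<phi> 0 z"
    proof (rule has_dir_transform[OF has_dir_const])
      show "\<epsilon> / (norm w + 1) > 0" using \<epsilon> by (simp add: add_nonneg_pos)
      fix h :: real assume "\<bar>h\<bar> < \<epsilon> / (norm w + 1)"
      then have "\<bar>h\<bar> * (norm w + 1) < \<epsilon>"
        using pos_less_divide_eq[of "norm w + 1" "\<bar>h\<bar>" \<epsilon>] by (simp add: add_nonneg_pos)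
      moreover have "\<bar>h\<bar> * norm w \<le> \<bar>h\<bar> * (norm w + 1)" by (simp add: mult_left_mono)
      ultimately have "z + h *\<^sub>R w \<in> ball z \<epsilon>" by (simp add: dist_norm)
      then show "\<phi> (z + h *\<^sub>R w) = 0" using \<epsilon>(2) C(3) by (auto simp: \<phi>_def)
    qed
    then show ?thesis using z by (simp add: \<phi>'_def C)
  qed
  ultimately have "integral (cbox a b) \<phi>' = 0"
    unfolding UN by (rule integral_dir_deriv_zero[OF _ _ _ C(1,2)]) (simp add: \<phi>_def C)
  moreover have "integral (cbox a b) \<phi>' = kernel_integral a b K F' x - kernel_integral a b K' F x"
    unfolding \<phi>'_def kernel_integral_def by (intro integral_diff kernel_integral_integrable K F)
  ultimately show ?thesis by simp
qed

lemma kernel_integral_add: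
  assumes "continuous_on UNIV K" "continuous_on UNIV K'" "continuous_on (cbox a b) F"
  shows "kernel_integral a b (\<lambda>z. K z + K' z) F x = kernel_integral a b K F x + kernel_integral a b K' F x"
  unfolding kernel_integral_def scaleR_add_left by (intro integral_add kernel_integral_integrable assms)

lemma kernel_integral_scale: "kernel_integral a b (\<lambda>z. c * K z) F x = c *\<^sub>R kernel_integral a b K F x"
  unfolding kernel_integral_def by (simp flip: scaleR_scaleR)

lemma kernel_integral_sum:
  assumes "finite I" "\<And>i. i \<in> I \<Longrightarrow> continuous_on UNIV (K i)" "continuous_on (cbox a b) F"
  shows "kernel_integral a b (\<lambda>z. \<Sum>i\<in>I. K i z) F x = (\<Sum>i\<in>I. kernel_integral a b (K i) F x)"
  unfolding kernel_integral_def scaleR_sum_left by (intro integral_sum kernel_integral_integrable assms)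

text \<open>The first derivative of \<open>bump 4 s\<close> along u; \<open>bump2 u w s\<close> is
  the second one. With exponent 4 the Laplacian involves \<open>bump 2\<close> and
  \<open>bump 3\<close>, and \<open>bump 2\<close> is up to a factor the s-derivative of
  \<open>bump 3\<close>. That makes harmonicity an equation in s.\<close>

definition bump1 :: "'b::euclidean_space \<Rightarrow> real \<Rightarrow> 'b \<Rightarrow> real" where
  "bump1 u s z = - 8 * (z \<bullet> u) * bump 3 s z"

definition bump2 :: "'b::euclidean_space \<Rightarrow> 'b \<Rightarrow> real \<Rightarrow> 'b \<Rightarrow> real" where
  "bump2 u w s z = - 8 * (u \<bullet> w) * bump 3 s z + 48 * (z \<bullet> u) * (z \<bullet> w) * bump 2 s z"

lemma ker2_commute: "bump2 u w = bump2 w u"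
  by (simp add: bump2_def fun_eq_iff inner_commute mult_ac)

lemma continuous_on_bump1: "continuous_on A (bump1 u s)"
  unfolding bump1_def by (intro continuous_intros)

lemma continuous_on_bump2: "continuous_on A (bump2 u w s)"
  unfolding bump2_def by (intro continuous_intros)

lemma has_dir_bump1: "has_dir w (bump1 u s) (bump2 u w s z) z"
proof -
  have k: "has_dir w (bump 3 s) (- 6 * (z \<bullet> w) * bump 2 s z) z"
    using has_dir_bump[of w 1 s z] by (simp add: numeral_3_eq_3 numeral_2_eq_2)
  have "has_dir w (\<lambda>z. (- 8) *\<^sub>R ((z \<bullet> u) *\<^sub>R bump 3 s z))
    ((- 8) *\<^sub>R ((z \<bullet> u) *\<^sub>R (- 6 * (z \<bullet> w) * bump 2 s z) + (w \<bullet> u) *\<^sub>R bump 3 s z)) z"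
    by (intro has_dir_linear[OF bounded_linear_scaleR_right] has_dir_scaleR has_dir_inner k)
  then show ?thesis
    by (simp add: bump1_def[abs_def] bump2_def algebra_simps inner_commute)
qed

text \<open>The sum is F tested against the Laplacian of the radial kernel \<open>bump 4 s\<close>
  centred at x, so no derivative of F appears; radial kernels are enough for a mean value formula.
  The ball lies inside the box so that the integral sees the whole support.\<close>

definition weakly_harmonic :: "'b::euclidean_space set \<Rightarrow> ('b \<Rightarrow> 'c::euclidean_space) \<Rightarrow> bool" where
  "weakly_harmonic U F \<longleftrightarrow> continuous_on U F \<and>
     (\<forall>a b x s. cbox a b \<subseteq> U \<longrightarrow> s > 0 \<longrightarrow> cball x (sqrt s) \<subseteq> box a b \<longrightarrow>
        (\<Sum>i\<in>Basis. kernel_integral a b (bump2 i i s) F x) = 0)"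

lemma bump_support:
  assumes "s > 0" "z \<notin> cball x (sqrt s)" "N > 0"
  shows "bump N s (x - z) = 0"
proof (rule bump_0[OF assms(3)])
  have "sqrt s \<le> norm (x - z)" using assms by (simp add: dist_norm)
  then show "s \<le> (norm (x - z))\<^sup>2" using sqrt_le_D by simp
qed

lemma kernel_integral_by_parts_bump1:
  assumes "continuous_on (cbox a b) F" "continuous_on (cbox a b) F'"
      "\<And>z. z \<in> box a b \<Longrightarrow> has_dir w F (F' z) z"
    and s: "s > 0" "cball x (sqrt s) \<subseteq> box a b"
  shows "kernel_integral a b (bump1 u s) F' x = kernel_integral a b (bump2 u w s) F x"
  by (rule kernel_integral_by_parts[OF assms(1-3) continuous_on_bump1 continuous_on_bump2 has_dir_bump1 compact_cball s(2)])
    (use s(1) in \<open>auto simp: bump1_def bump2_def bump_support simp del: mem_cball\<close>)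

text \<open>The constant 1 supplies the moments by which those of F are normalised in the mean value
  formula. Integrating the zero derivative by parts against \<open>bump1\<close> makes every term
  vanish separately.\<close>

lemma weakly_harmonic_const:
  fixes U :: "'b::euclidean_space set" and c :: "'c::euclidean_space"
  shows "weakly_harmonic U (\<lambda>x. c)"
  unfolding weakly_harmonic_def
proof (intro conjI allI impI)
  fix a b x :: 'b and s :: real assume h: "s > 0" "cball x (sqrt s) \<subseteq> box a b"
  show "(\<Sum>i\<in>Basis. kernel_integral a b (bump2 i i s) (\<lambda>x. c) x) = 0"
  proof (rule sum.neutral, intro ballI)
    fix i :: 'b
    have "kernel_integral a b (bump1 i s) (\<lambda>x. 0) x = kernel_integral a b (bump2 i i s) (\<lambda>x. c) x"
      by (rule kernel_integral_by_parts_bump1) (use h in \<open>auto intro!: has_dir_const\<close>)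
    then show "kernel_integral a b (bump2 i i s) (\<lambda>x. c) x = 0" by (simp add: kernel_integral_def)
  qed
qed simp

text \<open>In the term with \<open>z \<bullet> z\<close> that factor is written as s minus
  \<open>s - z \<bullet> z\<close>, and the difference is absorbed into the next power. The variable
  z disappears and two consecutive powers of the kernel remain.\<close>

lemma sum_bump2:
  "(\<Sum>i\<in>Basis. bump2 i i s z) =
    48 * s * bump 2 s z - (8 * DIM('b) + 48) * bump 3 s (z::'b::euclidean_space)"
proof -
  have "(\<Sum>i\<in>Basis. bump2 i i s z) =
      - 8 * DIM('b) * bump 3 s z + 48 * bump 2 s z * (\<Sum>i\<in>Basis. (z \<bullet> i) * (z \<bullet> i))"
    by (simp add: bump2_def sum.distrib sum_distrib_left sum_subtractf mult_ac)
  also have "(\<Sum>i\<in>Basis. (z \<bullet> i) * (z \<bullet> i)) = z \<bullet> z"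
    by (rule euclidean_inner[symmetric])
  finally show ?thesis
    using bump_Suc[of s z 1] by (simp add: algebra_simps numeral_2_eq_2 numeral_3_eq_3)
qed

text \<open>The moments of a weakly harmonic function against the kernels satisfy an Euler equation
  that does not depend on the function, so their ratio to the moments of 1 is constant in s; letting s tend to 0 identifies the constant.\<close>

lemma weakly_harmonic_moment:
  assumes "weakly_harmonic U F" "cbox a b \<subseteq> U" "s > 0" "cball x (sqrt s) \<subseteq> box a b"
  shows "(6 * s) *\<^sub>R kernel_integral a b (bump 2 s) F x = (DIM('b) + 6) *\<^sub>R kernel_integral a b (bump 3 s) F (x::'b::euclidean_space)"
proof -
  have F: "continuous_on (cbox a b) F"
    using assms(1,2) continuous_on_subset unfolding weakly_harmonic_def by blast
  have k: "continuous_on UNIV (\<lambda>z. (48 * s) * bump 2 s (z::'b))"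
    "continuous_on UNIV (\<lambda>z. (- (8 * DIM('b) + 48)) * bump 3 s (z::'b))"
    by (intro continuous_intros)+
  have "0 = (\<Sum>i\<in>Basis. kernel_integral a b (bump2 i i s) F x)"
    using assms by (simp add: weakly_harmonic_def)
  also have "\<dots> = kernel_integral a b (\<lambda>z. \<Sum>i\<in>Basis. bump2 i i s z) F x"
    using F by (simp add: kernel_integral_sum continuous_on_bump2)
  also have "(\<lambda>z. \<Sum>i\<in>Basis. bump2 i i s z) =
      (\<lambda>z. (48 * s) * bump 2 s (z::'b) + (- (8 * DIM('b) + 48)) * bump 3 s z)"
    unfolding sum_bump2 by (simp add: algebra_simps)
  also have "kernel_integral a b \<dots> F x = (48 * s) *\<^sub>R kernel_integral a b (bump 2 s) F x - (8 * DIM('b) + 48) *\<^sub>R kernel_integral a b (bump 3 s) F x"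
    unfolding kernel_integral_add[OF k F] kernel_integral_scale by (simp add: algebra_simps)
  finally have e: "(48 * s) *\<^sub>R kernel_integral a b (bump 2 s) F x = (8 * DIM('b) + 48) *\<^sub>R kernel_integral a b (bump 3 s) F x"
    by simp
  have "(6 * s) *\<^sub>R kernel_integral a b (bump 2 s) F x = (1 / 8) *\<^sub>R ((48 * s) *\<^sub>R kernel_integral a b (bump 2 s) F x)"
    by simp
  also have "\<dots> = (DIM('b) + 6) *\<^sub>R kernel_integral a b (bump 3 s) F x"
    unfolding e scaleR_scaleR by (rule arg_cong2[where f = scaleR]) auto
  finally show ?thesis .
qed

lemma has_dir_moment:
  fixes F :: "'b::euclidean_space \<Rightarrow> 'c::euclidean_space"
  assumes F: "continuous_on (cbox a b) F"
  shows "has_dir 1 (\<lambda>s. kernel_integral a b (bump 3 s) F x) (3 *\<^sub>R kernel_integral a b (bump 2 s) F x) s"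
proof -
  have c: "continuous_on (UNIV \<times> cbox a b) (\<lambda>(s, z). (c * bump n s (x - z)) *\<^sub>R F z)" for n c
  proof -
    have "continuous_on (UNIV \<times> cbox a b) (\<lambda>p. F (snd p))"
      by (rule continuous_on_compose2[OF F]) (auto intro!: continuous_intros)
    moreover have "continuous_on (UNIV \<times> cbox a b) (\<lambda>p. c * bump n (fst p) (x - snd p))"
      by (intro continuous_intros)
    ultimately show ?thesis unfolding case_prod_beta by (intro continuous_on_scaleR)
  qed
  have "has_dir 1 (\<lambda>s. integral (cbox a b) (\<lambda>z. bump 3 s (x - z) *\<^sub>R F z))
      (integral (cbox a b) (\<lambda>z. (3 * bump 2 s (x - z)) *\<^sub>R F z)) s"
  proof (rule has_dir_integral[where W = UNIV and \<eta> = 1])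
    show "has_dir 1 (\<lambda>s. bump 3 s (x - t) *\<^sub>R F t) ((3 * bump 2 z (x - t)) *\<^sub>R F t) z" for z t
      using has_dir_scaleR[OF has_dir_bump_s[of 1 "x - t" z] has_dir_const[of 1 "F t"]]
      by (simp add: numeral_2_eq_2 numeral_3_eq_3)
  qed (use c[of 1 3] c[of 3 2] in auto)
  then show ?thesis by (simp add: kernel_integral_def flip: scaleR_scaleR)
qed

text \<open>A continuous nonnegative function with zero integral vanishes on the box, but at
  \<open>z = x\<close> the value is \<open>s ^ N\<close>, which is positive.\<close>

lemma bump_integral_pos:
  assumes "s > 0" "x \<in> box a b"
  shows "integral (cbox a b) (\<lambda>z. bump N s (x - z)) > 0"
proof -
  let ?i = "integral (cbox a b) (\<lambda>z. bump N s (x - z))"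
  have c: "continuous_on (cbox a b) (\<lambda>z. bump N s (x - z))"
    by (intro continuous_intros)
  have i: "((\<lambda>z. bump N s (x - z)) has_integral ?i) (cbox a b)"
    using c by (simp add: integrable_integral integrable_continuous)
  have "?i \<ge> 0" by (rule has_integral_nonneg[OF i]) (rule bump_nonneg)
  moreover have "?i \<noteq> 0"
  proof
    assume "?i = 0"
    then have "bump N s (x - x) = 0"
      using i assms box_subset_cbox by (intro has_integral_0_cbox_imp_0[OF c]) (auto simp: bump_nonneg)
    then show False using assms by (simp add: bump_def)
  qed
  ultimately show ?thesis by simp
qed

lemma weakly_harmonic_mean_value:
  fixes F :: "'b::euclidean_space \<Rightarrow> 'c::euclidean_space"
  assumes wh: "weakly_harmonic U F" and ab: "cbox a b \<subseteq> U" and R: "R > 0" "cball x (sqrt R) \<subseteq> box a b"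
  shows "kernel_integral a b (bump 3 R) F x = integral (cbox a b) (\<lambda>z. bump 3 R (x - z)) *\<^sub>R F x"
proof -
  define M where "M s = kernel_integral a b (bump 3 s) F x" for s
  define \<kappa> where "\<kappa> s = kernel_integral a b (bump 3 s) (\<lambda>z. 1::real) x" for s
  have \<kappa>: "\<kappa> s = integral (cbox a b) (\<lambda>z. bump 3 s (x - z))" for s
    by (simp add: \<kappa>_def kernel_integral_def)
  have F: "continuous_on (cbox a b) F"
    using wh ab continuous_on_subset unfolding weakly_harmonic_def by blast
  have x: "x \<in> box a b" using R by auto
  have pos: "\<kappa> s > 0" if "s > 0" for s
    unfolding \<kappa> by (rule bump_integral_pos[OF that x])
  have sub: "cball x (sqrt s) \<subseteq> box a b" if "s \<le> R" for s
    using R(2) that subset_cball[of "sqrt s" "sqrt R" x] by auto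
  define \<phi> where "\<phi> s = (1 / \<kappa> s) *\<^sub>R M s" for s
  have d0: "has_dir 1 \<phi> 0 s" if s: "0 < s" "s \<le> R" for s
  proof -
    have eM: "(6 * s) *\<^sub>R kernel_integral a b (bump 2 s) F x = (DIM('b) + 6) *\<^sub>R M s"
      unfolding M_def using weakly_harmonic_moment[OF wh ab s(1) sub[OF s(2)]] .
    have e\<kappa>: "(6 * s) * kernel_integral a b (bump 2 s) (\<lambda>z. 1::real) x = (DIM('b) + 6) * \<kappa> s"
      unfolding \<kappa>_def using weakly_harmonic_moment[OF weakly_harmonic_const ab s(1) sub[OF s(2)], of "1::real"] by simp
    \<comment> \<open>Both moments solve the linear equation y' = c y: the s-derivative of the
      \<open>bump 3\<close> moment is 3 times the \<open>bump 2\<close> moment, which the Euler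
      equation expresses through the \<open>bump 3\<close> moment again.\<close>
    define c where "c = (DIM('b) + 6) / (2 * s)"
    have dM: "has_dir 1 M (c *\<^sub>R M s) s"
    proof (rule has_dir_eq_rhs)
      show "has_dir 1 M (3 *\<^sub>R kernel_integral a b (bump 2 s) F x) s"
        unfolding M_def[abs_def] by (rule has_dir_moment[OF F])
      have "c *\<^sub>R M s = (1 / (2 * s)) *\<^sub>R (real (DIM('b) + 6) *\<^sub>R M s)" by (simp add: c_def)
      also have "\<dots> = 3 *\<^sub>R kernel_integral a b (bump 2 s) F x" unfolding eM[symmetric] using s by simp
      finally show "3 *\<^sub>R kernel_integral a b (bump 2 s) F x = c *\<^sub>R M s" ..
    qed
    have d\<kappa>: "has_dir 1 \<kappa> (c * \<kappa> s) s"
    proof (rule has_dir_eq_rhs)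
      show "has_dir 1 \<kappa> (3 *\<^sub>R kernel_integral a b (bump 2 s) (\<lambda>z. 1::real) x) s"
        unfolding \<kappa>_def[abs_def] by (rule has_dir_moment) simp
      show "3 *\<^sub>R kernel_integral a b (bump 2 s) (\<lambda>z. 1::real) x = c * \<kappa> s"
        using e\<kappa> s by (simp add: c_def field_simps)
    qed
    have "((\<lambda>h. 1 / \<kappa> (s + h)) has_real_derivative - (c * \<kappa> s) / (\<kappa> (s + 0) * \<kappa> (s + 0))) (at 0)"
      using d\<kappa> pos[OF s(1)] unfolding has_dir_def
      by (auto intro!: derivative_eq_intros simp: has_real_derivative_iff_has_vector_derivative[symmetric])
    then have "has_dir 1 (\<lambda>s. 1 / \<kappa> s) (- c / \<kappa> s) s"
      using pos[OF s(1)] by (simp add: has_dir_def has_real_derivative_iff_has_vector_derivative[symmetric] field_simps)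
    from has_dir_scaleR[OF this dM] show ?thesis
      by (simp add: \<phi>_def[abs_def])
  qed
  have d\<phi>: "(\<phi> has_vector_derivative 0) (at s within {0<..R})" if "s \<in> {0<..R}" for s
    using that has_dir_shift[of 1 \<phi> 0 0 s] d0[of s] by (simp add: has_vector_derivative_at_within)
  have const: "\<phi> s = \<phi> R" if s: "s \<in> {0<..R}" for s
  proof -
    obtain c where "\<And>y. y \<in> {0<..R} \<Longrightarrow> \<phi> y = c"
      using has_vector_derivative_zero_constant[OF convex_real_interval(6) d\<phi>] by auto
    then show ?thesis using s R by simp
  qed
  have "norm (\<phi> R - F x) \<le> \<epsilon>" if \<epsilon>: "\<epsilon> > 0" for \<epsilon>
  proof -
    have xc: "x \<in> cbox a b" using x box_subset_cbox by blast
    obtain \<delta> where \<delta>: "\<delta> > 0" "\<And>z. z \<in> cbox a b \<Longrightarrow> dist z x < \<delta> \<Longrightarrow> dist (F z) (F x) < \<epsilon>"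
      using F xc \<epsilon> unfolding continuous_on_iff by metis
    \<comment> \<open>The bound by the square of \<open>\<delta>\<close> confines the kernel to
      points where F is within \<open>\<epsilon>\<close> of \<open>F x\<close>; the bound by R keeps
      s in the range where the ratio is constant.\<close>
    define s where "s = min R (\<delta>\<^sup>2)"
    have s: "s > 0" "s \<le> R" "s \<le> \<delta>\<^sup>2" using \<delta> R by (auto simp: s_def)
    have bd: "norm (bump 3 s (x - z) *\<^sub>R (F z - F x)) \<le> bump 3 s (x - z) * \<epsilon>" if z: "z \<in> cbox a b" for z
    proof (cases "bump 3 s (x - z) = 0")
      case False
      then have "(norm (x - z))\<^sup>2 < s" using bump_0[of 3 s "x - z"] by force
      then have "norm (x - z) < \<delta>" using s(3) \<delta>(1) by (smt (verit) power_mono norm_ge_zero)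
      then have "norm (F z - F x) \<le> \<epsilon>"
        using \<delta>(2)[OF z] by (simp add: dist_norm norm_minus_commute less_imp_le)
      then show ?thesis by (simp add: bump_nonneg mult_left_mono)
    qed simp
    have k: "continuous_on UNIV (bump 3 s :: 'b \<Rightarrow> real)" by (intro continuous_intros)
    have kx: "continuous_on (cbox a b) (\<lambda>z. bump 3 s (x - z))" by (intro continuous_intros)
    have "M s - \<kappa> s *\<^sub>R F x = integral (cbox a b) (\<lambda>z. bump 3 s (x - z) *\<^sub>R (F z - F x))"
    proof -
      have "\<kappa> s *\<^sub>R F x = integral (cbox a b) (\<lambda>z. bump 3 s (x - z) *\<^sub>R F x)"
        unfolding \<kappa>
        using integral_linear[OF integrable_continuous[OF kx] bounded_linear_scaleR_left, of "F x"]
        by (simp add: o_def)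
      then show ?thesis
        unfolding M_def kernel_integral_def scaleR_diff_right
        using kernel_integral_integrable[OF k F, of x] kernel_integral_integrable[OF k, of a b "\<lambda>z. F x" x]
        by (simp add: integral_diff)
    qed
    then have "norm (M s - \<kappa> s *\<^sub>R F x) \<le> integral (cbox a b) (\<lambda>z. bump 3 s (x - z) * \<epsilon>)"
      using integral_norm_bound_integral[OF kernel_integral_integrable[OF k continuous_on_diff[OF F continuous_on_const], of x] _ bd]
        kx by (simp add: integrable_continuous continuous_intros)
    also have "\<dots> = \<kappa> s * \<epsilon>" unfolding \<kappa> by simp
    finally have n: "norm (M s - \<kappa> s *\<^sub>R F x) \<le> \<kappa> s * \<epsilon>" .
    have "\<phi> R - F x = (1 / \<kappa> s) *\<^sub>R (M s - \<kappa> s *\<^sub>R F x)"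
      using const[of s] s pos[OF s(1)] by (simp add: \<phi>_def scaleR_diff_right)
    also have "norm \<dots> \<le> (1 / \<kappa> s) * (\<kappa> s * \<epsilon>)"
      unfolding norm_scaleR using n pos[OF s(1)] by (intro mult_mono) auto
    finally show ?thesis using pos[OF s(1)] by simp
  qed
  then have "norm (\<phi> R - F x) \<le> 0 + \<epsilon>" if "\<epsilon> > 0" for \<epsilon>
    using that by simp
  then have "norm (\<phi> R - F x) \<le> 0"
    by (rule field_le_epsilon)
  then have "\<phi> R = F x" by simp
  moreover have "M R = \<kappa> R *\<^sub>R \<phi> R"
    using pos[OF R(1)] by (simp add: \<phi>_def)
  ultimately have "M R = \<kappa> R *\<^sub>R F x" by simp
  then show ?thesis by (simp add: M_def \<kappa>)
qed

section \<open>Regularity of weakly harmonic functions\<close>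

text \<open>The mean value formula is used with one radius for all x near x0, and the mass of the
  translated kernel does not depend on x. Hence F is locally a fixed multiple of its own convolution
  with a fixed kernel, and regularity passes from the kernel to F.\<close>

lemma weakly_harmonic_representation:
  fixes F :: "'b::euclidean_space \<Rightarrow> 'c::euclidean_space"
  assumes U: "open U" "x0 \<in> U" and wh: "weakly_harmonic U F"
  obtains W a b s c where "open W" "x0 \<in> W" "W \<subseteq> U" "cbox a b \<subseteq> U"
    "\<And>x. x \<in> W \<Longrightarrow> F x = c *\<^sub>R kernel_integral a b (bump 3 s) F x"
proof -
  obtain a b where ab: "cbox a b \<subseteq> U" "x0 \<in> box a b"
    using open_contains_cbox[OF U] by metis
  obtain \<epsilon> where \<epsilon>: "\<epsilon> > 0" "ball x0 \<epsilon> \<subseteq> box a b"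
    using open_box ab(2) open_contains_ball by blast
  \<comment> \<open>Half the radius, so that for every x within \<open>\<rho>\<close> of x0 the
    closed ball of radius \<open>\<rho>\<close> about x stays in the box.\<close>
  define \<rho> where "\<rho> = \<epsilon> / 2"
  have \<rho>: "\<rho> > 0" "sqrt (\<rho>\<^sup>2) = \<rho>" "\<rho>\<^sup>2 > 0" using \<epsilon> by (auto simp: \<rho>_def)
  have sub: "cball x \<rho> \<subseteq> box a b" if "x \<in> ball x0 \<rho>" for x
  proof
    fix z assume "z \<in> cball x \<rho>"
    then have "dist x0 z < \<epsilon>" using that dist_triangle[of x0 z x] by (simp add: \<rho>_def)
    then show "z \<in> box a b" using \<epsilon>(2) by auto
  qed
  define \<kappa> where "\<kappa> = integral (cbox a b) (\<lambda>z. bump 3 (\<rho>\<^sup>2) (x0 - z))"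
  have \<kappa>: "integral (cbox a b) (\<lambda>z. bump 3 (\<rho>\<^sup>2) (x - z)) = \<kappa>" if x: "x \<in> ball x0 \<rho>" for x
  proof -
    have 0: "bump 3 (\<rho>\<^sup>2) (y - z) = 0" if "z \<notin> cbox a b" "y \<in> ball x0 \<rho>" for y z
      using that sub[of y] bump_support[of "\<rho>\<^sup>2" z y 3] \<rho> box_subset_cbox by fastforce
    have "integral (cbox a b) (\<lambda>z. bump 3 (\<rho>\<^sup>2) (x0 - (z + (x0 - x)))) = \<kappa>"
      unfolding \<kappa>_def
    proof (rule integral_translate[where \<phi> = "\<lambda>z. bump 3 (\<rho>\<^sup>2) (x0 - z)"])
      show "bump 3 (\<rho>\<^sup>2) (x0 - (z + (x0 - x))) = 0" if "z \<notin> cbox a b" for z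
        using 0[OF that x] by simp
    qed (use 0 \<rho> in \<open>auto intro!: continuous_intros\<close>)
    then show ?thesis by simp
  qed
  have pos: "\<kappa> > 0"
    unfolding \<kappa>_def by (rule bump_integral_pos[OF \<rho>(3) ab(2)])
  show ?thesis
  proof
    show "ball x0 \<rho> \<subseteq> U"
      using \<epsilon> ab box_subset_cbox[of a b] by (force simp: \<rho>_def)
    fix x assume x: "x \<in> ball x0 \<rho>"
    have "kernel_integral a b (bump 3 (\<rho>\<^sup>2)) F x = \<kappa> *\<^sub>R F x"
      using weakly_harmonic_mean_value[OF wh ab(1) \<rho>(3), of x] sub[OF x] \<kappa>[OF x] \<rho>(2) by simp
    then show "F x = (1 / \<kappa>) *\<^sub>R kernel_integral a b (bump 3 (\<rho>\<^sup>2)) F x"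
      using pos by simp
  qed (use \<rho> ab in auto)
qed

lemma has_dir_transform_open:
  assumes "open W" "x \<in> W" "has_dir w f d x" "\<And>y. y \<in> W \<Longrightarrow> g y = f y"
  shows "has_dir w g d x"
proof -
  obtain \<epsilon> where \<epsilon>: "\<epsilon> > 0" "ball x \<epsilon> \<subseteq> W"
    using assms(1,2) open_contains_ball by blast
  show ?thesis
  proof (rule has_dir_transform[OF assms(3)])
    show "\<epsilon> / (norm w + 1) > 0" using \<epsilon> by (simp add: add_nonneg_pos)
    fix h :: real assume "\<bar>h\<bar> < \<epsilon> / (norm w + 1)"
    then have "\<bar>h\<bar> * (norm w + 1) < \<epsilon>"
      using pos_less_divide_eq[of "norm w + 1" "\<bar>h\<bar>" \<epsilon>] by (simp add: add_nonneg_pos)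
    moreover have "\<bar>h\<bar> * norm w \<le> \<bar>h\<bar> * (norm w + 1)" by (simp add: mult_left_mono)
    ultimately have "x + h *\<^sub>R w \<in> ball x \<epsilon>" by (simp add: dist_norm)
    then show "g (x + h *\<^sub>R w) = f (x + h *\<^sub>R w)" using \<epsilon>(2) assms(4) by auto
  qed
qed

text \<open>All derivatives fall on the kernel \<open>bump 3 s\<close>. The functions g1 and g2 are
  convolutions defined on the whole space and tied to F only on W; the symmetry of g2 is that of the
  second derivative of the kernel.\<close>

lemma weakly_harmonic_C2_local:
  fixes F :: "'b::euclidean_space \<Rightarrow> 'c::euclidean_space"
  assumes U: "open U" "x0 \<in> U" and wh: "weakly_harmonic U F"
  obtains W g1 g2 where "open W" "x0 \<in> W" "W \<subseteq> U"
    "\<And>x w. x \<in> W \<Longrightarrow> has_dir w F (g1 w x) x"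
    "\<And>x w u. has_dir u (g1 w) (g2 u w x) x"
    "\<And>w. continuous_on UNIV (g1 w)" "\<And>u w. continuous_on UNIV (g2 u w)"
    "\<And>u w. g2 u w = g2 w u"
proof -
  obtain W a b s c where W: "open W" "x0 \<in> W" "W \<subseteq> U" "cbox a b \<subseteq> U"
    and rep: "\<And>x. x \<in> W \<Longrightarrow> F x = c *\<^sub>R kernel_integral a b (bump 3 s) F x"
    using weakly_harmonic_representation[OF U wh] by metis
  have F: "continuous_on (cbox a b) F"
    using wh W(4) continuous_on_subset unfolding weakly_harmonic_def by blast
  define k1 :: "'b \<Rightarrow> 'b \<Rightarrow> real" where "k1 w z = (- 6 * (z \<bullet> w)) * bump 2 s z" for w z
  \<comment> \<open>Two derivatives take the exponent from 3 down to 1, where the truncated power is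
    still continuous.\<close>
  define k2 :: "'b \<Rightarrow> 'b \<Rightarrow> 'b \<Rightarrow> real" where
    "k2 u w z = - 6 * (u \<bullet> w) * bump 2 s z + 24 * ((z \<bullet> u) * (z \<bullet> w)) * bump 1 s z" for u w z
  have k: "continuous_on UNIV (bump 3 s :: 'b \<Rightarrow> real)" by (intro continuous_intros)
  have c1: "continuous_on UNIV (k1 w)" for w
    unfolding k1_def by (intro continuous_intros)
  have c2: "continuous_on UNIV (k2 u w)" for u w
    unfolding k2_def by (intro continuous_intros)
  have d1: "has_dir w (bump 3 s) (k1 w z) z" for w z
    using has_dir_bump[of w 1 s z] by (simp add: numeral_3_eq_3 numeral_2_eq_2 k1_def)
  have d2: "has_dir u (k1 w) (k2 u w z) z" for u w z
  proof -
    have "has_dir u (\<lambda>z. (- 6) *\<^sub>R ((z \<bullet> w) *\<^sub>R bump 2 s z))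
      ((- 6) *\<^sub>R ((z \<bullet> w) *\<^sub>R (- 4 * (z \<bullet> u) * bump 1 s z) + (u \<bullet> w) *\<^sub>R bump 2 s z)) z"
      using has_dir_bump[of u 0 s z]
      by (intro has_dir_linear[OF bounded_linear_scaleR_right] has_dir_scaleR has_dir_inner)
        (simp add: numeral_2_eq_2)
    then show ?thesis
      by (simp add: k1_def[abs_def] k2_def algebra_simps)
  qed
  show ?thesis
  proof
    show "has_dir w F (c *\<^sub>R kernel_integral a b (k1 w) F x) x" if "x \<in> W" for w x
      by (rule has_dir_transform_open[OF W(1) that _ rep])
        (intro has_dir_linear[OF bounded_linear_scaleR_right] has_dir_kernel_integral k c1 d1 F)
    show "has_dir u (\<lambda>x. c *\<^sub>R kernel_integral a b (k1 w) F x) (c *\<^sub>R kernel_integral a b (k2 u w) F x) x" for u w x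
      by (intro has_dir_linear[OF bounded_linear_scaleR_right] has_dir_kernel_integral c1 c2 d2 F)
    show "continuous_on UNIV (\<lambda>x. c *\<^sub>R kernel_integral a b (k1 w) F x)" for w
      by (intro continuous_on_scaleR continuous_on_const continuous_on_kernel_integral c1 F)
    show "continuous_on UNIV (\<lambda>x. c *\<^sub>R kernel_integral a b (k2 u w) F x)" for u w
      by (intro continuous_on_scaleR continuous_on_const continuous_on_kernel_integral c2 F)
    have "k2 u w = k2 w u" for u w by (simp add: k2_def fun_eq_iff inner_commute mult_ac)
    then show "(\<lambda>x. c *\<^sub>R kernel_integral a b (k2 u w) F x) = (\<lambda>x. c *\<^sub>R kernel_integral a b (k2 w u) F x)" for u w
      by metis
  qed (use W in auto)
qed

lemma continuous_on_open_local:
  fixes f :: "'a::t2_space \<Rightarrow> 'b::topological_space"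
  assumes "\<And>x. x \<in> U \<Longrightarrow> \<exists>W. open W \<and> x \<in> W \<and> continuous_on W f"
  shows "continuous_on U f"
proof (rule continuous_at_imp_continuous_on, intro ballI)
  fix x assume "x \<in> U"
  then obtain W where "open W" "x \<in> W" "continuous_on W f" using assms by blast
  then show "isCont f x" using continuous_on_eq_continuous_at by blast
qed

lemma weakly_harmonic_C2:
  fixes F :: "'b::euclidean_space \<Rightarrow> 'c::euclidean_space"
  assumes U: "open U" and wh: "weakly_harmonic U F"
  shows "x \<in> U \<Longrightarrow> has_pder w F x"
    and "x \<in> U \<Longrightarrow> has_pder u (pder w F) x"
    and "x \<in> U \<Longrightarrow> pder u (pder w F) x = pder w (pder u F) x"
    and "continuous_on U (pder w F)"
    and "continuous_on U (pder u (pder w F))"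
proof -
  have "\<exists>W. open W \<and> x \<in> W \<and> (\<forall>w. has_pder w F x) \<and> (\<forall>u w. has_pder u (pder w F) x) \<and>
      (\<forall>u w. pder u (pder w F) x = pder w (pder u F) x) \<and> (\<forall>w. continuous_on W (pder w F)) \<and>
      (\<forall>u w. continuous_on W (pder u (pder w F)))" if x: "x \<in> U" for x
  proof (rule weakly_harmonic_C2_local[OF U x wh])
    fix W g1 g2 assume W: "open W" "x \<in> W" "W \<subseteq> U"
      and g: "\<And>x w. x \<in> W \<Longrightarrow> has_dir w F (g1 w x) x" "\<And>x w u. has_dir u (g1 w) (g2 u w x) x"
      "\<And>w. continuous_on UNIV (g1 w)" "\<And>u w. continuous_on UNIV (g2 u w)" "\<And>u w. g2 u w = g2 w u"
    have p1: "pder w F y = g1 w y" if "y \<in> W" for w y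
      using g(1)[OF that] by (rule has_dir_pder)
    have d2: "has_dir u (pder w F) (g2 u w y) y" if "y \<in> W" for u w y
      by (rule has_dir_transform_open[OF W(1) that g(2) p1])
    have p2: "pder u (pder w F) y = g2 u w y" if "y \<in> W" for u w y
      using d2[OF that] by (rule has_dir_pder)
    have "continuous_on W (pder w F)" for w
      using continuous_on_subset[OF g(3) subset_UNIV] by (rule continuous_on_eq) (simp add: p1)
    moreover have "continuous_on W (pder u (pder w F))" for u w
      using continuous_on_subset[OF g(4) subset_UNIV] by (rule continuous_on_eq) (simp add: p2)
    moreover have "has_pder w F x" "has_pder u (pder w F) x" for u w
      using g(1)[OF W(2)] d2[OF W(2)] has_dir_has_pder by blast+
    moreover have "pder u (pder w F) x = pder w (pder u F) x" for u w
      by (simp add: p2[OF W(2)] g(5)[of u w])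
    ultimately show ?thesis using W by blast
  qed
  note * = this
  show "has_pder w F x" if "x \<in> U"
    using *[OF that] by (elim exE conjE) simp
  show "has_pder u (pder w F) x" if "x \<in> U"
    using *[OF that] by (elim exE conjE) simp
  show "pder u (pder w F) x = pder w (pder u F) x" if "x \<in> U"
    using *[OF that] by (elim exE conjE) simp
  show "continuous_on U (pder w F)"
  proof (rule continuous_on_open_local)
    fix x assume "x \<in> U"
    from *[OF this] obtain W where "open W" "x \<in> W" "continuous_on W (pder w F)"
      by (elim exE conjE) simp
    then show "\<exists>W. open W \<and> x \<in> W \<and> continuous_on W (pder w F)" by blast
  qed
  show "continuous_on U (pder u (pder w F))"
  proof (rule continuous_on_open_local)
    fix x assume "x \<in> U"
    from *[OF this] obtain W where "open W" "x \<in> W" "continuous_on W (pder u (pder w F))"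
      by (elim exE conjE) simp
    then show "\<exists>W. open W \<and> x \<in> W \<and> continuous_on W (pder u (pder w F))" by blast
  qed
qed

section \<open>Clifford frames\<close>

lemma has_pder_iff: "has_pder w g x \<longleftrightarrow> has_dir w g (pder w g x) x"
  using has_dir_has_pder has_pder_has_dir by blast

lemma has_pder_comp_linear:
  assumes "linear L"
  shows "has_pder b (\<lambda>x. F (L x)) z \<longleftrightarrow> has_pder (L b) F (L z)"
  by (simp add: has_pder_def linear_add[OF assms] linear_scale[OF assms])

text \<open>A direction inside the subspace never leaves it, so relative openness already provides a
  short segment within W.\<close>

lemma openin_dir:
  fixes x :: "'a::real_normed_vector"
  assumes "openin (top_of_set S) W" "subspace S" "w \<in> S" "x \<in> W"
  obtains \<eta> where "\<eta> > 0" "\<And>h. \<bar>h\<bar> < \<eta> \<Longrightarrow> x + h *\<^sub>R w \<in> W"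
proof -
  obtain \<epsilon> where \<epsilon>: "\<epsilon> > 0" "ball x \<epsilon> \<inter> S \<subseteq> W"
    using assms(1,4) unfolding openin_contains_ball by blast
  have xS: "x \<in> S" using openin_imp_subset[OF assms(1)] assms(4) by blast
  show ?thesis
  proof
    show "\<epsilon> / (norm w + 1) > 0" using \<epsilon> by (simp add: add_nonneg_pos)
    fix h :: real assume "\<bar>h\<bar> < \<epsilon> / (norm w + 1)"
    then have "\<bar>h\<bar> * (norm w + 1) < \<epsilon>"
      using pos_less_divide_eq[of "norm w + 1" "\<bar>h\<bar>" \<epsilon>] by (simp add: add_nonneg_pos)
    moreover have "\<bar>h\<bar> * norm w \<le> \<bar>h\<bar> * (norm w + 1)" by (simp add: mult_left_mono)
    ultimately have "x + h *\<^sub>R w \<in> ball x \<epsilon>" by (simp add: dist_norm)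
    moreover have "x + h *\<^sub>R w \<in> S"
      using assms(2,3) xS by (simp add: subspace_add subspace_scale)
    ultimately show "x + h *\<^sub>R w \<in> W" using \<epsilon>(2) by blast
  qed
qed

lemma has_dir_transform_openin:
  fixes x :: "'a::real_normed_vector"
  assumes "openin (top_of_set S) W" "subspace S" "w \<in> S" "x \<in> W"
    and "has_dir w f d x" "\<And>y. y \<in> W \<Longrightarrow> g y = f y"
  shows "has_dir w g d x"
proof (rule openin_dir[OF assms(1-4)])
  fix \<eta> :: real assume "\<eta> > 0" "\<And>h. \<bar>h\<bar> < \<eta> \<Longrightarrow> x + h *\<^sub>R w \<in> W"
  then show ?thesis using assms(6) by (intro has_dir_transform[OF assms(5)]) auto
qed

lemma kernel_integral_linear:
  fixes F :: "'b::euclidean_space \<Rightarrow> 'c::euclidean_space" and l :: "'c \<Rightarrow> 'd::euclidean_space"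
  assumes "bounded_linear l" "continuous_on UNIV K" "continuous_on (cbox a b) F"
  shows "l (kernel_integral a b K F x) = kernel_integral a b K (\<lambda>z. l (F z)) x"
  unfolding kernel_integral_def
  using integral_linear[OF kernel_integral_integrable[OF assms(2,3)] assms(1)] linear_scale[OF bounded_linear.linear[OF assms(1)]]
  by (simp add: o_def)

lemma kernel_integral_sum_right:
  fixes F :: "'i \<Rightarrow> 'b::euclidean_space \<Rightarrow> 'c::euclidean_space"
  assumes "finite I" "continuous_on UNIV K" "\<And>i. i \<in> I \<Longrightarrow> continuous_on (cbox a b) (F i)"
  shows "kernel_integral a b K (\<lambda>z. \<Sum>i\<in>I. F i z) x = (\<Sum>i\<in>I. kernel_integral a b K (F i) x)"
  unfolding kernel_integral_def scaleR_sum_right by (intro integral_sum kernel_integral_integrable assms)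

lemma kernel_integral_cong: "(\<And>z. z \<in> cbox a b \<Longrightarrow> F z = G z) \<Longrightarrow> kernel_integral a b K F x = kernel_integral a b K G x"
  unfolding kernel_integral_def by (rule integral_cong) simp

text \<open>Signs of the conjugate operator: the unit direction is kept, each imaginary unit is
  negated.\<close>

definition conj_sign :: "nat \<Rightarrow> real" where "conj_sign s = (if s = 0 then 1 else - 1)"

text \<open>The derivative is existential and constrained only on W, so values off W never enter.
  Only directions in V are differentiated, because the stem variables fill a subspace of the ambient
  type.\<close>

primrec smooth_upto :: "'b::real_normed_vector set \<Rightarrow> nat \<Rightarrow> 'b set \<Rightarrow> ('b \<Rightarrow> 'c::real_normed_vector) \<Rightarrow> bool" where
  "smooth_upto V 0 W F \<longleftrightarrow> continuous_on W F"
| "smooth_upto V (Suc n) W F \<longleftrightarrow> continuous_on W F \<and>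
     (\<forall>u\<in>V. \<exists>F'. (\<forall>z\<in>W. has_dir u F (F' z) z) \<and> smooth_upto V n W F')"

text \<open>The Clifford relations are imposed on iterated left multiplications. In an alternative
  algebra these may differ from left multiplication by a product of frame vectors, and it is the
  iterated form that composing the Dirac operators produces.\<close>

locale clifford_frame =
  fixes mul :: "'a::euclidean_space \<Rightarrow> 'a \<Rightarrow> 'a" and v :: "nat \<Rightarrow> 'a" and m :: nat
  assumes bil: "bounded_bilinear mul"
    and v_0: "\<And>x. mul (v 0) x = x"
    and v_square: "\<And>s x. s \<in> {1..m} \<Longrightarrow> mul (v s) (mul (v s) x) = - x"
    and v_anticommute: "\<And>s t x. s \<in> {1..m} \<Longrightarrow> t \<in> {1..m} \<Longrightarrow> s \<noteq> t \<Longrightarrow>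
        mul (v s) (mul (v t) x) = - mul (v t) (mul (v s) x)"
    and v_inj: "inj_on v {..m}" and v_independent: "independent (v ` {..m})"
begin

lemma linear_mul: "linear (mul a)"
  using bounded_bilinear.bounded_linear_right[OF bil] by (rule bounded_linear.linear)

lemmas mul_sum_right = linear_sum[OF linear_mul]
  and mul_scaleR_right = linear_scale[OF linear_mul]
  and mul_add_right = linear_add[OF linear_mul]
  and mul_diff_right = linear_diff[OF linear_mul]
  and mul_minus_right = linear_neg[OF linear_mul]
  and mul_zero_right = linear_0[OF linear_mul]

lemma conj_mul_frame:
  assumes "s \<le> m" "t \<le> m"
  shows "conj_sign s *\<^sub>R mul (v s) (mul (v t) x) + conj_sign t *\<^sub>R mul (v t) (mul (v s) x) = (if s = t then 2 *\<^sub>R x else 0)"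
proof (cases "s = 0 \<or> t = 0")
  case True then show ?thesis by (auto simp: conj_sign_def v_0 scaleR_2)
next
  case False
  then show ?thesis
    using v_square[of s x] v_anticommute[of s t x] assms by (auto simp: conj_sign_def scaleR_2)
qed

text \<open>Adding the double sum to its transpose pairs (s, t) with (t, s); off-diagonal pairs
  cancel.\<close>

lemma sum_half_symmetric:
  fixes g :: "nat \<Rightarrow> nat \<Rightarrow> 'a"
  assumes I: "finite I" and g: "\<And>s t. s \<in> I \<Longrightarrow> t \<in> I \<Longrightarrow> g s t + g t s = (if s = t then 2 *\<^sub>R a s else 0)"
  shows "(\<Sum>s\<in>I. \<Sum>t\<in>I. g s t) = (\<Sum>s\<in>I. a s)"
proof -
  have "2 *\<^sub>R (\<Sum>s\<in>I. \<Sum>t\<in>I. g s t) = (\<Sum>s\<in>I. \<Sum>t\<in>I. g s t) + (\<Sum>t\<in>I. \<Sum>s\<in>I. g s t)"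
    unfolding scaleR_2 by (subst (3) sum.swap) (rule refl)
  also have "\<dots> = (\<Sum>s\<in>I. \<Sum>t\<in>I. g s t + g t s)"
    by (simp add: sum.distrib)
  also have "\<dots> = (\<Sum>s\<in>I. \<Sum>t\<in>I. if s = t then 2 *\<^sub>R a s else 0)"
    using g by (intro sum.cong refl) auto
  also have "\<dots> = 2 *\<^sub>R (\<Sum>s\<in>I. a s)"
    using I by (simp add: scaleR_sum_right)
  finally show ?thesis by simp
qed

text \<open>The factorisation of the Laplacian by D and its conjugate, stated for a symmetric array
  in place of second derivatives. The array may consist of true second derivatives, or of integrals
  of a C^1 function against second derivatives of a kernel; both uses occur.\<close>

lemma conj_dirac_dirac:
  assumes "p \<le> m" "\<And>s t. s \<le> p \<Longrightarrow> t \<le> p \<Longrightarrow> a s t = a t s"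
  shows "(\<Sum>s\<le>p. conj_sign s *\<^sub>R mul (v s) (\<Sum>t\<le>p. mul (v t) (a s t))) = (\<Sum>s\<le>p. a s s)"
proof -
  have "(\<Sum>s\<le>p. \<Sum>t\<le>p. conj_sign s *\<^sub>R mul (v s) (mul (v t) (a s t))) = (\<Sum>s\<le>p. a s s)"
    by (rule sum_half_symmetric[OF finite_atMost]) (use assms conj_mul_frame in auto)
  then show ?thesis by (simp add: mul_sum_right scaleR_sum_right)
qed

lemma dirac_conj_dirac:
  assumes "p \<le> m" "\<And>s t. s \<le> p \<Longrightarrow> t \<le> p \<Longrightarrow> a s t = a t s"
  shows "(\<Sum>s\<le>p. mul (v s) (\<Sum>t\<le>p. conj_sign t *\<^sub>R mul (v t) (a s t))) = (\<Sum>s\<le>p. a s s)"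
proof -
  have "(\<Sum>s\<le>p. \<Sum>t\<le>p. conj_sign t *\<^sub>R mul (v s) (mul (v t) (a s t))) = (\<Sum>s\<le>p. a s s)"
  proof (rule sum_half_symmetric[OF finite_atMost])
    fix s t assume "s \<in> {..p}" "t \<in> {..p}"
    then have st: "s \<le> p" "t \<le> p" by auto
    show "conj_sign t *\<^sub>R mul (v s) (mul (v t) (a s t)) + conj_sign s *\<^sub>R mul (v t) (mul (v s) (a t s))
      = (if s = t then 2 *\<^sub>R a s s else 0)"
    proof (cases "s = 0 \<or> t = 0")
      case True then show ?thesis using assms(2)[OF st] by (auto simp: conj_sign_def v_0 scaleR_2)
    next
      case False
      then show ?thesis
        using conj_mul_frame[of s t "a s t"] assms st by (auto simp: conj_sign_def)
    qed
  qed
  then show ?thesis by (simp add: mul_sum_right scaleR_sum_right mul_scaleR_right)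
qed

lemma coordinates_exist:
  obtains \<xi> :: "nat \<Rightarrow> 'a \<Rightarrow> real" where "\<And>s. linear (\<xi> s)"
    "\<And>s t. s \<le> m \<Longrightarrow> t \<le> m \<Longrightarrow> \<xi> s (v t) = (if s = t then 1 else 0)"
proof -
  have "\<exists>g. linear g \<and> (\<forall>x\<in>v ` {..m}. g x = (if x = v s then 1 else 0 :: real))" for s
    by (rule linear_independent_extend[OF v_independent])
  then obtain \<xi> :: "nat \<Rightarrow> 'a \<Rightarrow> real" where
    \<xi>: "\<And>s. linear (\<xi> s)" "\<And>s x. x \<in> v ` {..m} \<Longrightarrow> \<xi> s x = (if x = v s then 1 else 0)"
    by metis
  show ?thesis
  proof
    show "\<xi> s (v t) = (if s = t then 1 else 0)" if "s \<le> m" "t \<le> m" for s t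
      using \<xi>(2)[of "v t" s] that inj_on_eq_iff[OF v_inj, of t s] by auto
  qed (rule \<xi>(1))
qed

text \<open>Coordinates dual to the frame, extended linearly to the whole type; outside the span of
  the frame the extension is an arbitrary choice.\<close>

definition \<xi> :: "nat \<Rightarrow> 'a \<Rightarrow> real" where
  "\<xi> = (SOME \<xi>. (\<forall>s. linear (\<xi> s)) \<and> (\<forall>s\<le>m. \<forall>t\<le>m. \<xi> s (v t) = (if s = t then 1 else 0)))"

lemma linear_coord: "linear (\<xi> s)"
  and coord_frame: "s \<le> m \<Longrightarrow> t \<le> m \<Longrightarrow> \<xi> s (v t) = (if s = t then 1 else 0)"
proof -
  have "\<exists>\<xi>::nat \<Rightarrow> 'a \<Rightarrow> real. (\<forall>s. linear (\<xi> s)) \<and> (\<forall>s\<le>m. \<forall>t\<le>m. \<xi> s (v t) = (if s = t then 1 else 0))"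
    using coordinates_exist by metis
  from someI_ex[OF this, folded \<xi>_def]
  show "linear (\<xi> s)" "s \<le> m \<Longrightarrow> t \<le> m \<Longrightarrow> \<xi> s (v t) = (if s = t then 1 else 0)" by auto
qed

lemma span_coord:
  assumes "p \<le> m" "y \<in> span (v ` {..p})"
  shows "(\<Sum>s\<le>p. \<xi> s y *\<^sub>R v s) = y"
proof -
  have "linear (\<lambda>y. \<Sum>s\<le>p. \<xi> s y *\<^sub>R v s)"
    by (intro linear_compose_sum ballI linear_compose_scale_right) (auto intro!: linearI simp: linear_add[OF linear_coord] linear_scale[OF linear_coord] algebra_simps)
  moreover have "linear (\<lambda>y::'a. y)" by (rule linear_ident)
  moreover have "(\<Sum>s\<le>p. \<xi> s x *\<^sub>R v s) = x" if x: "x \<in> v ` {..p}" for x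
  proof -
    obtain t where t: "t \<le> p" "x = v t" using x by auto
    have "(\<Sum>s\<le>p. \<xi> s x *\<^sub>R v s) = (\<Sum>s\<le>p. if s = t then v s else 0)"
      using t assms(1) by (intro sum.cong) (auto simp: coord_frame)
    then show ?thesis using t by simp
  qed
  ultimately show ?thesis
    using linear_eq_on_span[of "\<lambda>y. \<Sum>s\<le>p. \<xi> s y *\<^sub>R v s" "\<lambda>y. y" "v ` {..p}" y] assms(2) by auto
qed

text \<open>Independence bounds the number of frame vectors by the dimension, so distinct standard
  basis vectors can serve as an orthonormal model of the directions \<open>v 0\<close> to
  \<open>v p\<close>.\<close>

lemma frame_basis_exists:
  assumes "p \<le> m"
  obtains \<beta> :: "nat \<Rightarrow> 'a" where "inj_on \<beta> {..p}" "\<beta> ` {..p} \<subseteq> Basis"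
proof -
  have ind: "independent (v ` {..p})"
    using assms by (intro independent_mono[OF v_independent]) auto
  have "card (v ` {..p}) \<le> DIM('a)"
    using independent_bound[OF ind] by simp
  moreover have "card (v ` {..p}) = card {..p}"
    using assms by (intro card_image inj_on_subset[OF v_inj]) auto
  ultimately have "card {..p} \<le> card (Basis :: 'a set)" by simp
  then obtain \<beta> :: "nat \<Rightarrow> 'a" where "\<beta> ` {..p} \<subseteq> Basis \<and> inj_on \<beta> {..p}"
    using card_le_inj[OF finite_atMost finite_Basis] by blast
  then show ?thesis using that by blast
qed

end

section \<open>Stem functions\<close>

locale stem_domain = clifford_frame +
  fixes p :: nat and D :: "('a \<times> real) set"
  assumes p_less: "p < m"
    and D_openin: "openin (top_of_set (span (v ` {..p}) \<times> (UNIV :: real set))) D"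
begin

abbreviation "stem_space \<equiv> span (v ` {..p}) \<times> (UNIV :: real set)"
abbreviation "er \<equiv> (0, 1) :: 'a \<times> real"
definition ev :: "nat \<Rightarrow> 'a \<times> real" where "ev s = (v s, 0)"
definition dirs :: "('a \<times> real) set" where "dirs = ev ` {..p} \<union> {er}"

definition dirac_stem :: "('a \<times> real \<Rightarrow> 'a) \<Rightarrow> 'a \<times> real \<Rightarrow> 'a" where
  "dirac_stem G z = (\<Sum>s\<le>p. mul (v s) (pder (ev s) G z))"

definition conj_dirac_stem :: "('a \<times> real \<Rightarrow> 'a) \<Rightarrow> 'a \<times> real \<Rightarrow> 'a" where
  "conj_dirac_stem G z = (\<Sum>s\<le>p. conj_sign s *\<^sub>R mul (v s) (pder (ev s) G z))"

definition C1_stem :: "('a \<times> real \<Rightarrow> 'a) \<Rightarrow> bool" where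
  "C1_stem G \<longleftrightarrow> continuous_on D G \<and> (\<forall>u\<in>dirs. (\<forall>z\<in>D. has_pder u G z) \<and> continuous_on D (pder u G))"

definition regular_stem :: "('a \<times> real \<Rightarrow> 'a) \<Rightarrow> ('a \<times> real \<Rightarrow> 'a) \<Rightarrow> bool" where
  "regular_stem F1 F2 \<longleftrightarrow> C1_stem F1 \<and> C1_stem F2 \<and>
     (\<forall>z\<in>D. dirac_stem F1 z = pder er F2 z \<and> conj_dirac_stem F2 z = - pder er F1 z)"

lemma subspace_stem_space: "subspace stem_space"
  by (intro subspace_Times subspace_span subspace_UNIV)

lemma dirs_subset: "dirs \<subseteq> stem_space"
  by (auto simp: dirs_def ev_def span_zero intro: span_base)

lemma ev_dirs: "s \<le> p \<Longrightarrow> ev s \<in> dirs" and er_dirs: "er \<in> dirs"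
  by (auto simp: dirs_def)

lemma D_subset: "D \<subseteq> stem_space"
  using D_openin openin_imp_subset by blast

definition \<beta> :: "nat \<Rightarrow> 'a" where "\<beta> = (SOME \<beta>. inj_on \<beta> {..p} \<and> \<beta> ` {..p} \<subseteq> Basis)"

lemma \<beta>: "inj_on \<beta> {..p}" "\<beta> ` {..p} \<subseteq> Basis"
proof -
  have "\<exists>\<beta>::nat \<Rightarrow> 'a. inj_on \<beta> {..p} \<and> \<beta> ` {..p} \<subseteq> Basis"
    using frame_basis_exists[of p] p_less by (metis less_imp_le)
  from someI_ex[OF this, folded \<beta>_def] show "inj_on \<beta> {..p}" "\<beta> ` {..p} \<subseteq> Basis" by auto
qed

text \<open>The frame need not be orthonormal for the ambient inner product; flat straightens it,
  turning the sum of the second derivatives along the frame into the Laplacian of the type.\<close>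

definition flat :: "'a \<times> real \<Rightarrow> 'a \<times> real" where
  "flat z = ((\<Sum>s\<le>p. (fst z \<bullet> \<beta> s) *\<^sub>R v s), snd z)"

lemma linear_flat: "linear flat"
  by (rule linearI) (auto simp: flat_def inner_add_left scaleR_add_left sum.distrib scaleR_sum_right)

lemma continuous_on_flat: "continuous_on A flat"
  using linear_continuous_on[OF linear_conv_bounded_linear[THEN iffD1, OF linear_flat]] .

lemma flat_in: "flat z \<in> stem_space"
proof -
  have "(\<Sum>s\<le>p. (fst z \<bullet> \<beta> s) *\<^sub>R v s) \<in> span (v ` {..p})"
    by (rule span_sum, rule span_scale, rule span_base) simp
  then show ?thesis by (simp add: flat_def)
qed

text \<open>A continuous right inverse of \<open>flat\<close> on the stem space; it carries
  continuity from the open set \<open>U\<close> back to D.\<close>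

definition unflat :: "'a \<times> real \<Rightarrow> 'a \<times> real" where
  "unflat z = ((\<Sum>s\<le>p. \<xi> s (fst z) *\<^sub>R \<beta> s), snd z)"

lemma continuous_on_unflat: "continuous_on A unflat"
  unfolding unflat_def
  by (intro continuous_intros linear_continuous_on_compose[OF _ linear_coord])

lemma inner_\<beta>: "s \<le> p \<Longrightarrow> t \<le> p \<Longrightarrow> \<beta> t \<bullet> \<beta> s = (if s = t then 1 else 0)"
  using \<beta> inj_on_eq_iff[OF \<beta>(1), of s t] by (subst inner_Basis) auto

lemma flat_unflat:
  assumes "z \<in> stem_space" shows "flat (unflat z) = z"
proof -
  have "(\<Sum>t\<le>p. \<xi> t (fst z) *\<^sub>R \<beta> t) \<bullet> \<beta> s = \<xi> s (fst z)" if s: "s \<le> p" for s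
  proof -
    have "(\<Sum>t\<le>p. \<xi> t (fst z) *\<^sub>R \<beta> t) \<bullet> \<beta> s = (\<Sum>t\<le>p. if t = s then \<xi> s (fst z) else 0)"
      unfolding inner_sum_left using s by (intro sum.cong) (auto simp: inner_\<beta>)
    then show ?thesis using s by simp
  qed
  then have "flat (unflat z) = ((\<Sum>s\<le>p. \<xi> s (fst z) *\<^sub>R v s), snd z)"
    by (simp add: flat_def unflat_def)
  then show ?thesis using span_coord[of p "fst z"] assms p_less by auto
qed

definition "U = flat -` D"

text \<open>Every value of \<open>flat\<close> lies in the stem space, so the preimage of D equals
  the preimage of an ambient open set. The set obtained contains boxes of full dimension, over which
  integrals can be taken; it is a cylinder along the basis vectors that \<open>flat\<close>
  kills.\<close>

lemma open_U: "open U"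
proof -
  obtain T where T: "open T" "D = stem_space \<inter> T"
    using D_openin by (auto simp: openin_open)
  have "flat z \<in> D \<longleftrightarrow> flat z \<in> T" for z using T(2) flat_in by blast
  then have "U = flat -` T" unfolding U_def vimage_def by simp
  then show ?thesis using open_vimage[OF T(1) continuous_on_flat] by simp
qed

lemma unflat_U: "z \<in> D \<Longrightarrow> unflat z \<in> U"
  using flat_unflat D_subset by (auto simp: U_def)

definition bs :: "nat \<Rightarrow> 'a \<times> real" where "bs s = (\<beta> s, 0)"

lemma flat_bs: "s \<le> p \<Longrightarrow> flat (bs s) = ev s"
proof -
  assume s: "s \<le> p"
  have "(\<Sum>t\<le>p. (\<beta> s \<bullet> \<beta> t) *\<^sub>R v t) = (\<Sum>t\<le>p. if t = s then v t else 0)"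
    using s by (intro sum.cong) (auto simp: inner_\<beta>)
  then show ?thesis using s by (simp add: flat_def bs_def ev_def)
qed

lemma flat_er: "flat er = er" by (simp add: flat_def)

lemma dirs_flat: "u \<in> dirs \<Longrightarrow> \<exists>b. flat b = u"
  unfolding dirs_def using flat_bs flat_er by blast

text \<open>A function pulled back along \<open>flat\<close> is constant in every basis vector that
  is sent to 0, so its full Laplacian reduces to the p + 2 stem directions.\<close>

lemma basis_cases:
  assumes "i \<in> (Basis :: ('a \<times> real) set)"
  shows "i \<in> bs ` {..p} \<union> {er} \<or> flat i = 0"
proof (cases "i \<in> bs ` {..p} \<union> {er}")
  case False
  then obtain b where b: "i = (b, 0)" "b \<in> Basis" "b \<notin> \<beta> ` {..p}"
    using assms by (auto simp: Basis_prod_def bs_def)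
  have "b \<bullet> \<beta> t = 0" if "t \<le> p" for t
    using b \<beta>(2) that inner_not_same_Basis[of b "\<beta> t"] by auto
  then have "flat i = 0" by (simp add: flat_def b(1) zero_prod_def)
  then show ?thesis by simp
qed simp

lemma flat_basis_dirs: "i \<in> (Basis :: ('a \<times> real) set) \<Longrightarrow> flat i \<in> dirs \<union> {0}"
  using basis_cases[of i] flat_bs flat_er by (auto simp: dirs_def)

text \<open>The two equations are multiplied by first derivatives of the kernel and integrated by
  parts. All second derivatives then sit on the kernel, where they commute, and the factorisation of
  the Laplacian applies to the resulting array of integrals although F1 and F2 have only one
  derivative.\<close>

lemma regular_stem_weakly_harmonic:
  assumes "regular_stem F1 F2"
  shows "weakly_harmonic U (\<lambda>z. F1 (flat z))" "weakly_harmonic U (\<lambda>z. F2 (flat z))"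
proof -
  have C1: "C1_stem F1" "C1_stem F2" using assms by (auto simp: regular_stem_def)
  have cU: "continuous_on A (\<lambda>z. G (flat z))" if "continuous_on D G" "A \<subseteq> U" for A and G :: "'a \<times> real \<Rightarrow> 'a"
    using that(2) by (intro continuous_on_compose2[OF that(1) continuous_on_flat]) (auto simp: U_def)
  have main: "(\<Sum>i\<in>Basis. kernel_integral a b (bump2 i i s) (\<lambda>z. F1 (flat z)) x) = 0 \<and>
      (\<Sum>i\<in>Basis. kernel_integral a b (bump2 i i s) (\<lambda>z. F2 (flat z)) x) = 0"
    if ab: "cbox a b \<subseteq> U" and s: "s > 0" "cball x (sqrt s) \<subseteq> box a b" for a b x s
  proof -
    \<comment> \<open>This array stands in for the second derivatives of F; it inherits its symmetry
      from \<open>bump2\<close>.\<close>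
    define q where "q F j i = kernel_integral a b (bump2 j i s) (\<lambda>z. F (flat z)) x" for F :: "'a \<times> real \<Rightarrow> 'a" and j i
    have q_sym: "q F j i = q F i j" for F j i by (simp add: q_def ker2_commute)
    have bs: "bs t \<in> Basis" if "t \<le> p" for t
      using \<beta>(2) that by (auto simp: bs_def Basis_prod_def)
    have er: "er \<in> Basis" by (simp add: Basis_prod_def)
    have cp: "continuous_on (cbox a b) (\<lambda>z. pder u F (flat z))" if "C1_stem F" "u \<in> dirs" for u F
      using that ab by (intro cU) (auto simp: C1_stem_def)
    have by_parts: "q F j i = kernel_integral a b (bump1 j s) (\<lambda>z. pder (flat i) F (flat z)) x"
      if F: "C1_stem F" and i: "i \<in> Basis" for F j i
      unfolding q_def
    proof (rule kernel_integral_by_parts_bump1[OF _ _ _ s, symmetric])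
      show "continuous_on (cbox a b) (\<lambda>z. F (flat z))"
        using F ab by (intro cU) (auto simp: C1_stem_def)
      show "continuous_on (cbox a b) (\<lambda>z. pder (flat i) F (flat z))"
      proof (cases "flat i = 0")
        case False
        then show ?thesis using flat_basis_dirs[OF i] by (intro cp F) auto
      qed (simp add: has_dir_pder[OF has_dir_zero])
      show "has_dir i (\<lambda>z. F (flat z)) (pder (flat i) F (flat z)) z" if "z \<in> box a b" for z
      proof (cases "flat i = 0")
        case True
        then show ?thesis by (simp add: has_dir_comp_linear[OF linear_flat] has_dir_pder[OF has_dir_zero] has_dir_zero)
      next
        case False
        then have "flat i \<in> dirs" using flat_basis_dirs[OF i] by auto
        moreover have "flat z \<in> D" using that ab box_subset_cbox by (auto simp: U_def)
        ultimately show ?thesis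
          using F by (simp add: C1_stem_def has_pder_iff has_dir_comp_linear[OF linear_flat])
      qed
    qed
    have q_ev: "q F j (bs t) = kernel_integral a b (bump1 j s) (\<lambda>z. pder (ev t) F (flat z)) x"
      if "C1_stem F" "t \<le> p" for F j t
      using by_parts[OF that(1) bs[OF that(2)]] flat_bs[OF that(2)] by simp
    have q_er: "q F j er = kernel_integral a b (bump1 j s) (\<lambda>z. pder er F (flat z)) x" if "C1_stem F" for F j
      using by_parts[OF that er] flat_er by simp
    have bm: "bounded_linear (mul c)" for c by (rule bounded_bilinear.bounded_linear_right[OF bil])
    have bms: "bounded_linear (\<lambda>y. r *\<^sub>R mul c y)" for c r
      using bounded_linear_compose[OF bounded_linear_scaleR_right bm] .
    have reg: "dirac_stem F1 (flat z) = pder er F2 (flat z)" "conj_dirac_stem F2 (flat z) = - pder er F1 (flat z)"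
      if "z \<in> cbox a b" for z
      using assms that ab by (auto simp: regular_stem_def U_def)
    \<comment> \<open>\<open>E1\<close> and \<open>E2\<close> are the equations of the system tested
      against \<open>bump1 j s\<close>. The direction j stays free, since it is later taken both
      along the frame and along the radius.\<close>
    have E1: "(\<Sum>t\<le>p. mul (v t) (q F1 j (bs t))) = q F2 j er" for j
    proof -
      have "(\<Sum>t\<le>p. mul (v t) (q F1 j (bs t))) =
          (\<Sum>t\<le>p. kernel_integral a b (bump1 j s) (\<lambda>z. mul (v t) (pder (ev t) F1 (flat z))) x)"
        using C1 ev_dirs
        by (intro sum.cong refl) (simp add: q_ev kernel_integral_linear[OF bm] continuous_on_bump1 cp)
      also have "\<dots> = kernel_integral a b (bump1 j s) (\<lambda>z. dirac_stem F1 (flat z)) x"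
        unfolding dirac_stem_def
        by (intro kernel_integral_sum_right[symmetric] continuous_on_bump1 bounded_linear.continuous_on[OF bm] cp C1 ev_dirs) auto
      also have "\<dots> = q F2 j er"
        unfolding q_er[OF C1(2)] by (rule kernel_integral_cong) (rule reg)
      finally show ?thesis .
    qed
    have E2: "(\<Sum>t\<le>p. conj_sign t *\<^sub>R mul (v t) (q F2 j (bs t))) = - q F1 j er" for j
    proof -
      have "(\<Sum>t\<le>p. conj_sign t *\<^sub>R mul (v t) (q F2 j (bs t))) =
          (\<Sum>t\<le>p. kernel_integral a b (bump1 j s) (\<lambda>z. conj_sign t *\<^sub>R mul (v t) (pder (ev t) F2 (flat z))) x)"
        using C1 ev_dirs
        by (intro sum.cong refl) (simp add: q_ev kernel_integral_linear[OF bms] continuous_on_bump1 cp)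
      also have "\<dots> = kernel_integral a b (bump1 j s) (\<lambda>z. conj_dirac_stem F2 (flat z)) x"
        unfolding conj_dirac_stem_def
        by (intro kernel_integral_sum_right[symmetric] continuous_on_bump1 bounded_linear.continuous_on[OF bms] cp C1 ev_dirs) auto
      also have "\<dots> = kernel_integral a b (bump1 j s) (\<lambda>z. - pder er F1 (flat z)) x"
        by (rule kernel_integral_cong) (rule reg)
      also have "\<dots> = - q F1 j er"
        unfolding q_er[OF C1(1)] using C1(1) er_dirs
        by (intro kernel_integral_linear[symmetric] bounded_linear_minus bounded_linear_ident continuous_on_bump1 cp)
      finally show ?thesis .
    qed
    have pm: "p \<le> m" using p_less by simp
    \<comment> \<open>\<open>E1\<close> evaluates the inner sum as \<open>q F2 (bs t) er\<close>;
      after exchanging the indices, \<open>E2\<close> with j = \<open>er\<close> evaluates the outer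
      one as \<open>- q F1 er er\<close>.\<close>
    have "(\<Sum>t\<le>p. q F1 (bs t) (bs t)) = (\<Sum>t\<le>p. conj_sign t *\<^sub>R mul (v t) (\<Sum>l\<le>p. mul (v l) (q F1 (bs t) (bs l))))"
      by (rule conj_dirac_dirac[OF pm q_sym, symmetric])
    also have "\<dots> = (\<Sum>t\<le>p. conj_sign t *\<^sub>R mul (v t) (q F2 er (bs t)))"
      unfolding E1 by (simp add: q_sym)
    finally have 1: "(\<Sum>t\<le>p. q F1 (bs t) (bs t)) + q F1 er er = 0"
      unfolding E2 by simp
    have "(\<Sum>t\<le>p. q F2 (bs t) (bs t)) = (\<Sum>t\<le>p. mul (v t) (\<Sum>l\<le>p. conj_sign l *\<^sub>R mul (v l) (q F2 (bs t) (bs l))))"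
      by (rule dirac_conj_dirac[OF pm q_sym, symmetric])
    also have "\<dots> = - (\<Sum>t\<le>p. mul (v t) (q F1 er (bs t)))"
      unfolding E2 by (simp add: q_sym mul_minus_right sum_negf)
    finally have 2: "(\<Sum>t\<le>p. q F2 (bs t) (bs t)) + q F2 er er = 0"
      unfolding E1 by simp
    have total: "(\<Sum>i\<in>Basis. q F i i) = (\<Sum>t\<le>p. q F (bs t) (bs t)) + q F er er" if F: "C1_stem F" for F
    proof -
      have "(\<Sum>i\<in>Basis. q F i i) = (\<Sum>i\<in>bs ` {..p} \<union> {er}. q F i i)"
      proof (rule sum.mono_neutral_right)
        show "\<forall>i\<in>Basis - (bs ` {..p} \<union> {er}). q F i i = 0"
        proof
          fix i assume i: "i \<in> Basis - (bs ` {..p} \<union> {er})"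
          then have "flat i = 0" using basis_cases[of i] by auto
          then show "q F i i = 0"
            using by_parts[OF F, of i i] i by (simp add: has_dir_pder[OF has_dir_zero] kernel_integral_def)
        qed
      qed (use bs er in auto)
      also have "\<dots> = (\<Sum>i\<in>bs ` {..p}. q F i i) + q F er er"
        by (subst sum.union_disjoint) (auto simp: bs_def)
      also have "(\<Sum>i\<in>bs ` {..p}. q F i i) = (\<Sum>t\<le>p. q F (bs t) (bs t))"
        using \<beta>(1) by (subst sum.reindex) (auto simp: bs_def inj_on_def)
      finally show ?thesis .
    qed
    show ?thesis
      using total[OF C1(1)] total[OF C1(2)] 1 2 by (simp add: q_def)
  qed
  show "weakly_harmonic U (\<lambda>z. F1 (flat z))" "weakly_harmonic U (\<lambda>z. F2 (flat z))"
    unfolding weakly_harmonic_def using main C1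
    by (auto intro!: cU simp: C1_stem_def)
qed

lemma regular_stem_C2:
  assumes "regular_stem F1 F2" "F \<in> {F1, F2}" "u \<in> dirs" "w \<in> dirs"
  shows "z \<in> D \<Longrightarrow> has_pder w (pder u F) z"
    and "z \<in> D \<Longrightarrow> pder w (pder u F) z = pder u (pder w F) z"
    and "continuous_on D (pder w (pder u F))"
proof -
  have wh: "weakly_harmonic U (\<lambda>z. F (flat z))"
    using regular_stem_weakly_harmonic[OF assms(1)] assms(2) by auto
  obtain a b where a: "flat a = u" and b: "flat b = w"
    using dirs_flat assms(3,4) by metis
  have p1: "pder a (\<lambda>z. F (flat z)) = (\<lambda>z. pder u F (flat z))"
    "pder b (\<lambda>z. F (flat z)) = (\<lambda>z. pder w F (flat z))"
    by (simp_all add: fun_eq_iff pder_comp_linear[OF linear_flat] a b)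
  have p2: "pder b (pder a (\<lambda>z. F (flat z))) = (\<lambda>z. pder w (pder u F) (flat z))"
    "pder a (pder b (\<lambda>z. F (flat z))) = (\<lambda>z. pder u (pder w F) (flat z))"
    unfolding p1 by (simp_all add: fun_eq_iff pder_comp_linear[OF linear_flat] a b)
  have zz: "flat (unflat z) = z" if "z \<in> D" for z
    using that D_subset flat_unflat by auto
  show "has_pder w (pder u F) z" if z: "z \<in> D"
    using weakly_harmonic_C2(2)[OF open_U wh unflat_U[OF z], of b a] z
    unfolding p1 has_pder_comp_linear[OF linear_flat] b by (simp add: zz)
  show "pder w (pder u F) z = pder u (pder w F) z" if z: "z \<in> D"
    using weakly_harmonic_C2(3)[OF open_U wh unflat_U[OF z], of b a] z
    unfolding p2 by (simp add: zz)
  have "continuous_on D (\<lambda>z. pder w (pder u F) (flat (unflat z)))"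
    using weakly_harmonic_C2(5)[OF open_U wh, of b a] unfolding p2
    by (rule continuous_on_compose2[OF _ continuous_on_unflat]) (auto intro: unflat_U)
  then show "continuous_on D (pder w (pder u F))"
    by (rule continuous_on_eq) (simp add: zz)
qed

text \<open>The system has constant coefficients, so commuting mixed derivatives carry it over to
  the derivatives. The equations hold on a relatively open set, which is what permits
  differentiating both sides.\<close>

lemma regular_stem_pder:
  assumes reg: "regular_stem F1 F2" and u: "u \<in> dirs"
  shows "regular_stem (pder u F1) (pder u F2)"
  unfolding regular_stem_def
proof (intro conjI ballI)
  have C1: "C1_stem F1" "C1_stem F2" using reg by (auto simp: regular_stem_def)
  have uS: "u \<in> stem_space" using u dirs_subset by auto
  note C2_1 = regular_stem_C2[OF reg, of F1, simplified]
  note C2_2 = regular_stem_C2[OF reg, of F2, simplified]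
  show "C1_stem (pder u F1)" "C1_stem (pder u F2)"
    using C1 u C2_1 C2_2 unfolding C1_stem_def by blast+
  fix z assume z: "z \<in> D"
  have bm: "bounded_linear (\<lambda>y. r *\<^sub>R mul c y)" for c r
    by (intro bounded_linear_compose[OF bounded_linear_scaleR_right] bounded_bilinear.bounded_linear_right[OF bil])
  have d1: "has_dir u (dirac_stem F1) (dirac_stem (pder u F1) z) z"
  proof -
    have "has_dir u (pder (ev s) F1) (pder (ev s) (pder u F1) z) z" if "s \<le> p" for s
      using C2_1(1)[OF ev_dirs[OF that] u z] C2_1(2)[OF ev_dirs[OF that] u z] by (simp add: has_pder_iff)
    then show ?thesis
      unfolding dirac_stem_def[abs_def]
      by (intro has_dir_sum has_dir_linear[OF bounded_bilinear.bounded_linear_right[OF bil]]) auto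
  qed
  have d2: "has_dir u (conj_dirac_stem F2) (conj_dirac_stem (pder u F2) z) z"
  proof -
    have "has_dir u (pder (ev s) F2) (pder (ev s) (pder u F2) z) z" if "s \<le> p" for s
      using C2_2(1)[OF ev_dirs[OF that] u z] C2_2(2)[OF ev_dirs[OF that] u z] by (simp add: has_pder_iff)
    then show ?thesis
      unfolding conj_dirac_stem_def[abs_def]
      by (intro has_dir_sum has_dir_linear[OF bm]) auto
  qed
  have r1: "has_dir u (pder er F2) (pder er (pder u F2) z) z"
    using C2_2(1)[OF er_dirs u z] C2_2(2)[OF er_dirs u z] by (simp add: has_pder_iff)
  have r2: "has_dir u (\<lambda>z. - pder er F1 z) (- pder er (pder u F1) z) z"
    using C2_1(1)[OF er_dirs u z] C2_1(2)[OF er_dirs u z]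
    by (intro has_dir_linear[OF bounded_linear_minus[OF bounded_linear_ident]]) (simp add: has_pder_iff)
  have "has_dir u (dirac_stem F1) (pder er (pder u F2) z) z"
    using reg by (intro has_dir_transform_openin[OF D_openin subspace_stem_space uS z r1]) (auto simp: regular_stem_def)
  with d1 show "dirac_stem (pder u F1) z = pder er (pder u F2) z"
    by (rule has_dir_unique)
  have "has_dir u (conj_dirac_stem F2) (- pder er (pder u F1) z) z"
    using reg by (intro has_dir_transform_openin[OF D_openin subspace_stem_space uS z r2]) (auto simp: regular_stem_def)
  with d2 show "conj_dirac_stem (pder u F2) z = - pder er (pder u F1) z"
    by (rule has_dir_unique)
qed

lemma regular_stem_smooth:
  "regular_stem F1 F2 \<Longrightarrow> smooth_upto dirs n D F1 \<and> smooth_upto dirs n D F2"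
proof (induction n arbitrary: F1 F2)
  case 0
  then show ?case by (simp add: regular_stem_def C1_stem_def)
next
  case (Suc n)
  have "smooth_upto dirs n D (pder u F1)" "smooth_upto dirs n D (pder u F2)" if "u \<in> dirs" for u
    using Suc.IH[OF regular_stem_pder[OF Suc.prems that]] by auto
  then show ?case
    using Suc.prems unfolding regular_stem_def C1_stem_def has_pder_iff smooth_upto.simps by blast
qed

end

section \<open>Functions with continuous partial derivatives of every order\<close>

lemma smooth_upto_continuous: "smooth_upto V n W F \<Longrightarrow> continuous_on W F"
  by (cases n) auto

lemma smooth_upto_Suc_imp: "smooth_upto V (Suc n) W F \<Longrightarrow> smooth_upto V n W F"
  by (induction n arbitrary: F) (simp, metis smooth_upto.simps(2))

lemma smooth_upto_subset: "smooth_upto V n W F \<Longrightarrow> W' \<subseteq> W \<Longrightarrow> smooth_upto V n W' F"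
proof (induction n arbitrary: F)
  case 0 then show ?case by (auto intro: continuous_on_subset)
next
  case (Suc n)
  then have "continuous_on W' F" by (auto intro: continuous_on_subset)
  moreover have "\<exists>F'. (\<forall>z\<in>W'. has_dir u F (F' z) z) \<and> smooth_upto V n W' F'" if u: "u \<in> V" for u
  proof -
    obtain F' where "\<forall>z\<in>W. has_dir u F (F' z) z" "smooth_upto V n W F'"
      using Suc.prems(1) u by auto
    then show ?thesis using Suc.IH[of F'] Suc.prems(2) by blast
  qed
  ultimately show ?case by simp
qed

lemma smooth_upto_cong:
  assumes W: "openin (top_of_set S) W" "subspace S" "V \<subseteq> S"
    and F: "smooth_upto V n W F" and eq: "\<And>z. z \<in> W \<Longrightarrow> G z = F z"
  shows "smooth_upto V n W G"
proof -
  have "continuous_on W G"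
    using smooth_upto_continuous[OF F] by (rule continuous_on_eq) (simp add: eq)
  moreover have "has_dir u G d z" if "has_dir u F d z" "u \<in> V" "z \<in> W" for u d z
    using has_dir_transform_openin[OF W(1,2) _ that(3,1) eq] that(2) W(3) by auto
  ultimately show ?thesis using F by (cases n) (simp_all, blast)
qed

lemma smooth_upto_add:
  "smooth_upto V n W F \<Longrightarrow> smooth_upto V n W G \<Longrightarrow> smooth_upto V n W (\<lambda>z. F z + G z)"
proof (induction n arbitrary: F G)
  case 0 then show ?case by (auto intro: continuous_on_add)
next
  case (Suc n)
  then have "continuous_on W (\<lambda>z. F z + G z)" by (auto intro: continuous_on_add)
  moreover have "\<exists>F'. (\<forall>z\<in>W. has_dir u (\<lambda>z. F z + G z) (F' z) z) \<and> smooth_upto V n W F'" if u: "u \<in> V" for u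
  proof -
    obtain F' where "\<forall>z\<in>W. has_dir u F (F' z) z" "smooth_upto V n W F'"
      using Suc.prems(1) u by auto
    moreover obtain G' where "\<forall>z\<in>W. has_dir u G (G' z) z" "smooth_upto V n W G'"
      using Suc.prems(2) u by auto
    ultimately show ?thesis
      using Suc.IH[of F' G'] has_dir_add[of u F _ _ G] by (intro exI[of _ "\<lambda>z. F' z + G' z"]) auto
  qed
  ultimately show ?case by simp
qed

lemma smooth_upto_linear:
  assumes l: "bounded_linear l"
  shows "smooth_upto V n W F \<Longrightarrow> smooth_upto V n W (\<lambda>z. l (F z))"
proof (induction n arbitrary: F)
  case 0 then show ?case by (auto intro: bounded_linear.continuous_on[OF l])
next
  case (Suc n)
  then have "continuous_on W (\<lambda>z. l (F z))" by (auto intro: bounded_linear.continuous_on[OF l])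
  moreover have "\<exists>F'. (\<forall>z\<in>W. has_dir u (\<lambda>z. l (F z)) (F' z) z) \<and> smooth_upto V n W F'" if u: "u \<in> V" for u
  proof -
    obtain F' where "\<forall>z\<in>W. has_dir u F (F' z) z" "smooth_upto V n W F'"
      using Suc.prems(1) u by auto
    then show ?thesis
      using Suc.IH[of F'] by (intro exI[of _ "\<lambda>z. l (F' z)"]) (auto intro: has_dir_linear[OF l])
  qed
  ultimately show ?case by simp
qed

lemma smooth_upto_has_dir:
  "smooth_upto V (Suc n) W F \<Longrightarrow> u \<in> V \<Longrightarrow> z \<in> W \<Longrightarrow> has_dir u F (pder u F z) z"
  using has_dir_pder by fastforce

lemma smooth_upto_pder:
  assumes W: "openin (top_of_set S) W" "subspace S" "V \<subseteq> S"
    and F: "smooth_upto V (Suc n) W F" "u \<in> V"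
  shows "smooth_upto V n W (pder u F)"
proof -
  obtain F' where F': "\<forall>z\<in>W. has_dir u F (F' z) z" "smooth_upto V n W F'"
    using F by auto
  show ?thesis
    by (rule smooth_upto_cong[OF W F'(2)]) (use F'(1) has_dir_pder in blast)
qed

lemma continuous_on_openin_local:
  fixes F :: "'b::real_normed_vector \<Rightarrow> 'c::real_normed_vector"
  assumes "\<And>z. z \<in> W \<Longrightarrow> \<exists>W'. openin (top_of_set S) W' \<and> z \<in> W' \<and> W' \<subseteq> W \<and> continuous_on W' F"
    and W: "openin (top_of_set S) W"
  shows "continuous_on W F"
  unfolding continuous_on_eq_continuous_within
proof
  fix z assume z: "z \<in> W"
  then obtain W' where W': "openin (top_of_set S) W'" "z \<in> W'" "W' \<subseteq> W" "continuous_on W' F"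
    using assms(1) by blast
  obtain T where T: "open T" "W' = S \<inter> T" using W'(1) by (auto simp: openin_open)
  have "W \<subseteq> S" using W openin_imp_subset by blast
  then have "at z within W = at z within W'"
    using T W'(2,3) by (intro at_within_nhd[of z T]) auto
  then show "continuous (at z within W) F"
    using W'(2,4) by (simp add: continuous_on_eq_continuous_within)
qed

text \<open>Local witnesses for the derivative along u vary with the neighbourhood. Each equals
  \<open>pder u F\<close> on its own neighbourhood, and this single function serves as the global
  witness.\<close>

lemma smooth_upto_local:
  fixes F :: "'b::real_normed_vector \<Rightarrow> 'c::real_normed_vector"
  assumes W: "openin (top_of_set S) W" "subspace S" "V \<subseteq> S"
    and loc: "\<And>z. z \<in> W \<Longrightarrow> \<exists>W'. openin (top_of_set S) W' \<and> z \<in> W' \<and> W' \<subseteq> W \<and> smooth_upto V n W' F"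
  shows "smooth_upto V n W F"
  using loc
proof (induction n arbitrary: F)
  case 0
  then show ?case using continuous_on_openin_local[OF _ W(1), of F] by simp
next
  case (Suc n)
  have "continuous_on W F"
  proof (rule continuous_on_openin_local[OF _ W(1)])
    fix z assume "z \<in> W"
    from Suc.prems[OF this] show "\<exists>W'. openin (top_of_set S) W' \<and> z \<in> W' \<and> W' \<subseteq> W \<and> continuous_on W' F"
      using smooth_upto_continuous by blast
  qed
  moreover have "(\<forall>z\<in>W. has_dir u F (pder u F z) z) \<and> smooth_upto V n W (pder u F)" if u: "u \<in> V" for u
  proof
    show "\<forall>z\<in>W. has_dir u F (pder u F z) z"
      using Suc.prems smooth_upto_has_dir[OF _ u] by blast
    show "smooth_upto V n W (pder u F)"
    proof (rule Suc.IH)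
      fix z assume "z \<in> W"
      from Suc.prems[OF this] obtain W' where W': "openin (top_of_set S) W'" "z \<in> W'" "W' \<subseteq> W"
        "smooth_upto V (Suc n) W' F" by blast
      then show "\<exists>W'. openin (top_of_set S) W' \<and> z \<in> W' \<and> W' \<subseteq> W \<and> smooth_upto V n W' (pder u F)"
        using smooth_upto_pder[OF W'(1) W(2,3) W'(4) u] by blast
    qed
  qed
  ultimately show ?case by auto
qed

lemma has_dir_scale_dir:
  assumes "has_dir w g d x" shows "has_dir (c *\<^sub>R w) g (c *\<^sub>R d) x"
proof -
  have "((\<lambda>h::real. h * c) has_real_derivative c) (at 0)" by (auto intro!: derivative_eq_intros)
  then have "((\<lambda>h. g (x + h *\<^sub>R w)) \<circ> (\<lambda>h. h * c) has_vector_derivative c *\<^sub>R d) (at 0)"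
    using assms unfolding has_dir_def
    by (intro vector_diff_chain_at) (auto simp: has_real_derivative_iff_has_vector_derivative)
  then show ?thesis by (simp add: has_dir_def o_def)
qed

text \<open>The fundamental theorem of calculus with the segment rescaled to the unit interval, so
  that c may be negative or zero.\<close>

lemma has_integral_segment:
  fixes g :: "'b::real_normed_vector \<Rightarrow> 'c::banach"
  assumes "\<And>t. t \<in> {0..1} \<Longrightarrow> has_dir w g (g' (x + (t * c) *\<^sub>R w)) (x + (t * c) *\<^sub>R w)"
  shows "((\<lambda>t. c *\<^sub>R g' (x + (t * c) *\<^sub>R w)) has_integral (g (x + c *\<^sub>R w) - g x)) {0..1}"
proof -
  have "((\<lambda>t. g (x + (t * c) *\<^sub>R w)) has_vector_derivative c *\<^sub>R g' (x + (t * c) *\<^sub>R w)) (at t within {0..1})"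
    if "t \<in> {0..1}" for t
  proof -
    have "has_dir (c *\<^sub>R w) g (c *\<^sub>R g' (x + (t * c) *\<^sub>R w)) (x + t *\<^sub>R (c *\<^sub>R w))"
      using has_dir_scale_dir[OF assms[OF that], of c] by simp
    from has_dir_shift[OF this] show ?thesis
      by (simp add: has_vector_derivative_at_within)
  qed
  then have "((\<lambda>t. c *\<^sub>R g' (x + (t * c) *\<^sub>R w)) has_integral
      (g (x + (1 * c) *\<^sub>R w) - g (x + (0 * c) *\<^sub>R w))) {0..1}"
    by (intro fundamental_theorem_of_calculus) auto
  then show ?thesis by simp
qed

text \<open>The quotients by r do not solve the stem system, so their mixed derivatives need an
  argument of their own. The increment of F along u is an integral of \<open>pder u F\<close>.
  Differentiating it along w under the integral shows that the increment of \<open>pder w F\<close>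
  is a times an average \<open>G a\<close>, and \<open>G\<close> tends to the mixed
  derivative.\<close>

lemma mixed_pder_commute:
  fixes F :: "'b::real_normed_vector \<Rightarrow> 'c::euclidean_space"
  assumes W: "openin (top_of_set S) W" "subspace S" "V \<subseteq> S"
    and F: "smooth_upto V (Suc (Suc 0)) W F" and uw: "u \<in> V" "w \<in> V" and z: "z \<in> W"
  shows "pder u (pder w F) z = pder w (pder u F) z"
proof -
  have uS: "u \<in> S" and wS: "w \<in> S" using uw W(3) by auto
  obtain \<epsilon> where \<epsilon>: "\<epsilon> > 0" "ball z \<epsilon> \<inter> S \<subseteq> W"
    using W(1) z unfolding openin_contains_ball by blast
  define \<eta> where "\<eta> = \<epsilon> / (norm u + norm w + 1)"
  have \<eta>: "\<eta> > 0" using \<epsilon> by (simp add: \<eta>_def add_nonneg_pos)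
  have zS: "z \<in> S" using z openin_imp_subset[OF W(1)] by blast
  have inW: "z + a *\<^sub>R u + b *\<^sub>R w \<in> W" if a: "\<bar>a\<bar> < \<eta>" and b: "\<bar>b\<bar> < \<eta>" for a b
  proof -
    have "norm (a *\<^sub>R u + b *\<^sub>R w) \<le> \<bar>a\<bar> * norm u + \<bar>b\<bar> * norm w"
      using norm_triangle_ineq[of "a *\<^sub>R u" "b *\<^sub>R w"] by simp
    also have "\<dots> \<le> \<eta> * norm u + \<eta> * norm w"
      using a b by (intro add_mono mult_right_mono) auto
    also have "\<dots> < \<eta> * (norm u + norm w + 1)" using \<eta> by (simp add: algebra_simps)
    also have "\<dots> = \<epsilon>" by (simp add: \<eta>_def add_nonneg_pos add_nonneg_eq_0_iff)
    finally have "norm (a *\<^sub>R u + b *\<^sub>R w) < \<epsilon>" .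
    moreover have "z - (z + a *\<^sub>R u + b *\<^sub>R w) = - (a *\<^sub>R u + b *\<^sub>R w)" by simp
    ultimately have "z + a *\<^sub>R u + b *\<^sub>R w \<in> ball z \<epsilon>"
      unfolding mem_ball dist_norm by (metis norm_minus_cancel)
    moreover have "z + a *\<^sub>R u + b *\<^sub>R w \<in> S"
      using W(2) zS uS wS by (intro subspace_add subspace_scale)
    ultimately show ?thesis using \<epsilon>(2) by blast
  qed
  have F1: "smooth_upto V (Suc 0) W (pder u F)" "smooth_upto V (Suc 0) W (pder w F)"
    using smooth_upto_pder[OF W F] uw by auto
  define G where "G a = integral (cbox 0 1) (\<lambda>t. pder w (pder u F) (z + (t * a) *\<^sub>R u))" for a
  have cG: "continuous_on W (pder w (pder u F))" "continuous_on W (pder u F)"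
    using smooth_upto_continuous smooth_upto_pder[OF W F1(1) uw(2)] F1(1) by blast+
  have key: "pder w F (z + a *\<^sub>R u) - pder w F z = a *\<^sub>R G a" if a: "\<bar>a\<bar> < \<eta>" for a
  proof -
    have ta: "\<bar>t * a\<bar> < \<eta>" if "t \<in> {0..1}" for t
    proof -
      have "\<bar>t * a\<bar> \<le> 1 * \<bar>a\<bar>" unfolding abs_mult using that by (intro mult_right_mono) auto
      then show ?thesis using a by simp
    qed
    \<comment> \<open>A segment rather than an open set: the rule for differentiating under the
      integral asks only for a piece of the line in direction w.\<close>
    define L where "L = (\<lambda>b. z + b *\<^sub>R w) ` {- \<eta><..<\<eta>}"
    have LW: "x + (t * a) *\<^sub>R u \<in> W" if x: "x \<in> L" and t: "t \<in> {0..1}" for x t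
    proof -
      obtain b where b: "x = z + b *\<^sub>R w" "\<bar>b\<bar> < \<eta>" using x unfolding L_def by force
      show ?thesis using inW[OF ta[OF t] b(2)] by (simp add: b(1) algebra_simps)
    qed
    have hi: "integral (cbox 0 1) (\<lambda>t. a *\<^sub>R pder u F (x + (t * a) *\<^sub>R u)) = F (x + a *\<^sub>R u) - F x" if x: "x \<in> L" for x
      unfolding cbox_interval
      by (intro integral_unique has_integral_segment smooth_upto_has_dir[OF F uw(1)] LW[OF x])
    have cc: "continuous_on (L \<times> cbox 0 1) (\<lambda>(x, t). a *\<^sub>R g (x + (t * a) *\<^sub>R u))" if g: "continuous_on W g" for g :: "'b \<Rightarrow> 'c"
    proof -
      have "continuous_on (L \<times> cbox 0 1) (\<lambda>p. g (fst p + (snd p * a) *\<^sub>R u))"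
        by (rule continuous_on_compose2[OF g]) (auto intro!: continuous_intros LW)
      then show ?thesis unfolding case_prod_beta by (intro continuous_on_scaleR continuous_on_const)
    qed
    have "has_dir w (\<lambda>x. integral (cbox 0 1) (\<lambda>t. a *\<^sub>R pder u F (x + (t * a) *\<^sub>R u)))
        (integral (cbox 0 1) (\<lambda>t. a *\<^sub>R pder w (pder u F) (z + (t * a) *\<^sub>R u))) z"
    proof (rule has_dir_integral[where W = L and \<eta> = \<eta>])
      show "has_dir w (\<lambda>x. a *\<^sub>R pder u F (x + (t * a) *\<^sub>R u)) (a *\<^sub>R pder w (pder u F) (x + (t * a) *\<^sub>R u)) x"
        if x: "x \<in> L" and t: "t \<in> cbox 0 1" for x t
      proof -
        have "has_dir w (pder u F) (pder w (pder u F) (x + (t * a) *\<^sub>R u)) (x + (t * a) *\<^sub>R u)"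
          using smooth_upto_has_dir[OF F1(1) uw(2) LW[OF x]] t by simp
        then have "has_dir w (\<lambda>x. pder u F (x + (t * a) *\<^sub>R u)) (pder w (pder u F) (x + (t * a) *\<^sub>R u)) x"
          by (simp add: has_dir_def algebra_simps)
        then show ?thesis by (rule has_dir_linear[OF bounded_linear_scaleR_right])
      qed
      show "z + h *\<^sub>R w \<in> L" if "\<bar>h\<bar> < \<eta>" for h
        unfolding L_def by (rule imageI) (use that in auto)
    qed (use \<eta> cc cG in auto)
    then have 1: "has_dir w (\<lambda>x. F (x + a *\<^sub>R u) - F x) (a *\<^sub>R G a) z"
      unfolding G_def integral_cmul[symmetric]
    proof (rule has_dir_transform[OF _ \<eta>])
      fix h :: real assume "\<bar>h\<bar> < \<eta>"
      then have "z + h *\<^sub>R w \<in> L" unfolding L_def by (intro imageI) auto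
      then show "F (z + h *\<^sub>R w + a *\<^sub>R u) - F (z + h *\<^sub>R w) =
          integral (cbox 0 1) (\<lambda>t. a *\<^sub>R pder u F (z + h *\<^sub>R w + (t * a) *\<^sub>R u))"
        by (rule hi[symmetric])
    qed
    have "z + a *\<^sub>R u \<in> W" using inW[OF a, of 0] \<eta> by simp
    from smooth_upto_has_dir[OF F uw(2) this]
    have "has_dir w (\<lambda>x. F (x + a *\<^sub>R u)) (pder w F (z + a *\<^sub>R u)) z"
      by (simp add: has_dir_def algebra_simps)
    from has_dir_diff[OF this smooth_upto_has_dir[OF F uw(2) z]] 1
    show ?thesis by (rule has_dir_unique)
  qed
  have "continuous_on {- \<eta><..<\<eta>} G"
    unfolding G_def
  proof (rule integral_continuous_on_param)
    have "continuous_on ({- \<eta><..<\<eta>} \<times> cbox 0 1) (\<lambda>p. pder w (pder u F) (z + (snd p * fst p) *\<^sub>R u))"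
    proof (rule continuous_on_compose2[OF cG(1)])
      have "z + (t * a) *\<^sub>R u \<in> W" if "a \<in> {- \<eta><..<\<eta>}" "t \<in> cbox 0 1" for a t
      proof -
        have "\<bar>t * a\<bar> \<le> 1 * \<bar>a\<bar>" unfolding abs_mult using that by (intro mult_right_mono) auto
        then show ?thesis using inW[of "t * a" 0] that \<eta> by auto
      qed
      then show "(\<lambda>p. z + (snd p * fst p) *\<^sub>R u) ` ({- \<eta><..<\<eta>} \<times> cbox 0 1) \<subseteq> W" by auto
    qed (intro continuous_intros)
    then show "continuous_on ({- \<eta><..<\<eta>} \<times> cbox 0 1) (\<lambda>(a, t). pder w (pder u F) (z + (t * a) *\<^sub>R u))"
      by (simp add: case_prod_beta)
  qed
  then have G0: "(G \<longlongrightarrow> G 0) (at 0)"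
    using \<eta> by (auto simp: continuous_on_eq_continuous_at isCont_def)
  have "G 0 = pder w (pder u F) z" by (simp add: G_def)
  \<comment> \<open>By \<open>key\<close> the difference quotient of \<open>pder w F\<close> along u
    is exactly \<open>G h\<close>, so continuity of \<open>G\<close> at 0 gives the
    derivative.\<close>
  moreover have "has_dir u (pder w F) (G 0) z"
    unfolding has_dir_def has_vector_derivative_def has_derivative_at
  proof (intro conjI bounded_linear_scaleR_left)
    have "((\<lambda>h. norm (G h - G 0)) \<longlongrightarrow> 0) (at 0)"
      using G0 by (simp add: LIM_zero_iff tendsto_norm_zero)
    moreover have "\<forall>\<^sub>F h in at 0. norm (G h - G 0) =
        norm (pder w F (z + (0 + h) *\<^sub>R u) - pder w F (z + 0 *\<^sub>R u) - h *\<^sub>R G 0) / norm h"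
      unfolding eventually_at
    proof (intro exI conjI ballI impI)
      fix h :: real assume h: "h \<noteq> 0 \<and> dist h 0 < \<eta>"
      have "pder w F (z + (0 + h) *\<^sub>R u) - pder w F (z + 0 *\<^sub>R u) - h *\<^sub>R G 0 = h *\<^sub>R (G h - G 0)"
        using key[of h] h by (simp add: scaleR_diff_right)
      then show "norm (G h - G 0) =
        norm (pder w F (z + (0 + h) *\<^sub>R u) - pder w F (z + 0 *\<^sub>R u) - h *\<^sub>R G 0) / norm h"
        using h by simp
    qed (rule \<eta>)
    ultimately show "(\<lambda>h. norm (pder w F (z + (0 + h) *\<^sub>R u) - pder w F (z + 0 *\<^sub>R u) - h *\<^sub>R G 0) / norm h) \<midarrow>0\<rightarrow> 0"
      by (rule Lim_transform_eventually)
  qed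
  ultimately show ?thesis using has_dir_pder by metis
qed

section \<open>Division by the radius\<close>

context stem_domain
begin

text \<open>On the axis the quotient is given its limit value, which is the radial derivative for
  functions that vanish there.\<close>

definition quot :: "('a \<times> real \<Rightarrow> 'a) \<Rightarrow> 'a \<times> real \<Rightarrow> 'a" where
  "quot K z = (if snd z = 0 then pder er K z else (1 / snd z) *\<^sub>R K z)"

definition shrink :: "real \<Rightarrow> 'a \<times> real \<Rightarrow> 'a \<times> real" where
  "shrink t z = (fst z, t * snd z)"

lemma linear_shrink: "linear (shrink t)"
  by (rule linearI) (auto simp: shrink_def algebra_simps)

text \<open>The weight \<open>t ^ k\<close> absorbs the factors t that the chain rule produces under
  repeated radial differentiation.\<close>

definition shrink_integral :: "nat \<Rightarrow> ('a \<times> real \<Rightarrow> 'a) \<Rightarrow> 'a \<times> real \<Rightarrow> 'a" where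
  "shrink_integral k H z = integral (cbox 0 1) (\<lambda>t. t ^ k *\<^sub>R H (shrink t z))"

lemma continuous_on_shrink:
  fixes H :: "'a \<times> real \<Rightarrow> 'a"
  assumes B: "\<And>z t. z \<in> B \<Longrightarrow> t \<in> {0..1} \<Longrightarrow> shrink t z \<in> B" and H: "continuous_on B H"
  shows "continuous_on (B \<times> cbox 0 1) (\<lambda>(z, t). t ^ k *\<^sub>R H (shrink t z))"
proof -
  have "continuous_on (B \<times> cbox 0 1) (\<lambda>p. H (shrink (snd p) (fst p)))"
  proof (rule continuous_on_compose2[OF H])
    show "continuous_on (B \<times> cbox 0 1) (\<lambda>p. shrink (snd p) (fst p))"
      unfolding shrink_def by (intro continuous_intros)
    show "(\<lambda>p. shrink (snd p) (fst p)) ` (B \<times> cbox 0 1) \<subseteq> B" using B by auto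
  qed
  then show ?thesis unfolding case_prod_beta by (intro continuous_on_scaleR continuous_intros)
qed

lemma smooth_upto_shrink_integral:
  assumes B: "openin (top_of_set stem_space) B" "\<And>z t. z \<in> B \<Longrightarrow> t \<in> {0..1} \<Longrightarrow> shrink t z \<in> B"
  shows "smooth_upto dirs n B H \<Longrightarrow> smooth_upto dirs n B (shrink_integral k H)"
proof (induction n arbitrary: H k)
  case 0
  then show ?case
    unfolding shrink_integral_def smooth_upto.simps
    by (intro integral_continuous_on_param continuous_on_shrink B)
next
  case (Suc n)
  have H: "continuous_on B H" using Suc.prems by simp
  have "continuous_on B (shrink_integral k H)"
    unfolding shrink_integral_def by (intro integral_continuous_on_param continuous_on_shrink B H)
  moreover have "\<exists>F'. (\<forall>z\<in>B. has_dir u (shrink_integral k H) (F' z) z) \<and> smooth_upto dirs n B F'" if u: "u \<in> dirs" for u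
  proof -
    obtain H' where H': "\<forall>z\<in>B. has_dir u H (H' z) z" "smooth_upto dirs n B H'"
      using Suc.prems u by auto
    \<comment> \<open>Under \<open>shrink t\<close> the radial direction is multiplied by t and the
      frame directions are fixed; j records the difference, and the weight rises from k to
      \<open>k + j\<close>.\<close>
    define j :: nat where "j = (if u = er then 1 else 0)"
    have su: "shrink t u = t ^ j *\<^sub>R u" for t
      using u by (auto simp: dirs_def shrink_def ev_def j_def)
    have "has_dir u (shrink_integral k H) (shrink_integral (k + j) H' z) z" if z: "z \<in> B" for z
    proof -
      have uS: "u \<in> stem_space" using u dirs_subset by auto
      show ?thesis
      proof (rule openin_dir[OF B(1) subspace_stem_space uS z])
        fix \<eta> :: real assume \<eta>: "\<eta> > 0" "\<And>h. \<bar>h\<bar> < \<eta> \<Longrightarrow> z + h *\<^sub>R u \<in> B"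
        show ?thesis
          unfolding shrink_integral_def
        proof (rule has_dir_integral[OF \<eta>])
          show "has_dir u (\<lambda>z. t ^ k *\<^sub>R H (shrink t z)) (t ^ (k + j) *\<^sub>R H' (shrink t x)) x"
            if x: "x \<in> B" and t: "t \<in> cbox 0 1" for x t
          proof -
            have "has_dir u H (H' (shrink t x)) (shrink t x)" using H'(1) B(2)[OF x] t by auto
            then have "has_dir (shrink t u) H (t ^ j *\<^sub>R H' (shrink t x)) (shrink t x)"
              unfolding su by (rule has_dir_scale_dir)
            then have "has_dir u (\<lambda>z. H (shrink t z)) (t ^ j *\<^sub>R H' (shrink t x)) x"
              by (simp add: has_dir_comp_linear[OF linear_shrink])
            from has_dir_linear[OF bounded_linear_scaleR_right this, of "t ^ k"]
            show ?thesis by (simp add: power_add)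
          qed
          show "continuous_on (B \<times> cbox 0 1) (\<lambda>(z, t). t ^ k *\<^sub>R H (shrink t z))"
            by (rule continuous_on_shrink[OF B(2) H])
          show "continuous_on (B \<times> cbox 0 1) (\<lambda>(z, t). t ^ (k + j) *\<^sub>R H' (shrink t z))"
            by (rule continuous_on_shrink[OF B(2) smooth_upto_continuous[OF H'(2)]])
        qed
      qed
    qed
    then show ?thesis using Suc.IH[OF H'(2)] by blast
  qed
  ultimately show ?case by simp
qed

text \<open>This is Hadamard's lemma. The radial derivative integrated from the axis to z gives
  \<open>K z\<close>, and rescaling to the unit interval produces the factor r. On the axis the
  integrand is constant.\<close>

lemma quot_eq_shrink_integral:
  assumes B: "\<And>z t. z \<in> B \<Longrightarrow> t \<in> {0..1} \<Longrightarrow> shrink t z \<in> B"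
    and K: "\<And>z. z \<in> B \<Longrightarrow> has_dir er K (pder er K z) z" "\<And>z. z \<in> B \<Longrightarrow> K (fst z, 0) = 0"
    and z: "z \<in> B"
  shows "quot K z = shrink_integral 0 (pder er K) z"
proof (cases "snd z = 0")
  case True
  then have "shrink t z = z" for t by (simp add: shrink_def prod_eq_iff)
  then show ?thesis using True by (simp add: quot_def shrink_integral_def)
next
  case False
  have pt: "(fst z, 0) + (t * snd z) *\<^sub>R er = shrink t z" for t by (simp add: shrink_def)
  have "((\<lambda>t. snd z *\<^sub>R pder er K ((fst z, 0) + (t * snd z) *\<^sub>R er)) has_integral
      (K ((fst z, 0) + snd z *\<^sub>R er) - K (fst z, 0))) {0..1}"
    by (rule has_integral_segment) (unfold pt, intro K(1) B z)
  then have "((\<lambda>t. snd z *\<^sub>R pder er K (shrink t z)) has_integral K z) {0..1}"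
    unfolding pt using K(2)[OF z] by simp
  then have "((\<lambda>t. (1 / snd z) *\<^sub>R (snd z *\<^sub>R pder er K (shrink t z))) has_integral (1 / snd z) *\<^sub>R K z) {0..1}"
    by (rule has_integral_cmul)
  then have "integral {0..1} (\<lambda>t. pder er K (shrink t z)) = (1 / snd z) *\<^sub>R K z"
    using False by (intro integral_unique) simp
  then show ?thesis using False by (simp add: quot_def shrink_integral_def)
qed

text \<open>Differentiating a power of 1/r raises its exponent, so the induction runs over all j at
  once.\<close>

lemma smooth_upto_divide_power:
  assumes W: "openin (top_of_set stem_space) W" "\<And>z. z \<in> W \<Longrightarrow> snd z \<noteq> 0"
  shows "smooth_upto dirs n W K \<Longrightarrow> smooth_upto dirs n W (\<lambda>z. (1 / snd z) ^ j *\<^sub>R K z)"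
proof (induction n arbitrary: K j)
  case 0
  then show ?case using W(2) by (auto intro!: continuous_intros)
next
  case (Suc n)
  have "continuous_on W (\<lambda>z. (1 / snd z) ^ j *\<^sub>R K z)"
    using Suc.prems W(2) by (auto intro!: continuous_intros)
  moreover have "\<exists>F'. (\<forall>z\<in>W. has_dir u (\<lambda>z. (1 / snd z) ^ j *\<^sub>R K z) (F' z) z) \<and> smooth_upto dirs n W F'"
    if u: "u \<in> dirs" for u
  proof -
    obtain K' where K': "\<forall>z\<in>W. has_dir u K (K' z) z" "smooth_upto dirs n W K'"
      using Suc.prems u by auto
    \<comment> \<open>\<open>snd u\<close> is 1 for the radial direction and 0 for the frame
      directions, so one formula covers both.\<close>
    define F' where "F' z = (1 / snd z) ^ j *\<^sub>R K' z + (- real j * snd u) *\<^sub>R ((1 / snd z) ^ Suc j *\<^sub>R K z)" for z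
    have "has_dir u (\<lambda>z. (1 / snd z) ^ j) ((- real j * snd u) * (1 / snd z) ^ Suc j) z" if "z \<in> W" for z
    proof -
      have "((\<lambda>h. (1 / (snd z + h * snd u)) ^ j) has_real_derivative
        real j * (1 / (snd z + 0 * snd u)) ^ (j - 1) * (- snd u / ((snd z + 0 * snd u) * (snd z + 0 * snd u)))) (at 0)"
        using W(2)[OF that] by (auto intro!: derivative_eq_intros)
      moreover have "real j * (1 / (snd z + 0 * snd u)) ^ (j - 1) * (- snd u / ((snd z + 0 * snd u) * (snd z + 0 * snd u)))
         = (- real j * snd u) * (1 / snd z) ^ Suc j"
        using W(2)[OF that] by (cases j) (auto simp: field_simps)
      ultimately show ?thesis
        by (simp add: has_dir_def has_real_derivative_iff_has_vector_derivative)
    qed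
    then have "has_dir u (\<lambda>z. (1 / snd z) ^ j *\<^sub>R K z) (F' z) z" if "z \<in> W" for z
      using has_dir_scaleR K'(1) that by (fastforce simp: F'_def)
    moreover have "smooth_upto dirs n W F'"
      unfolding F'_def
      by (intro smooth_upto_add smooth_upto_linear[OF bounded_linear_scaleR_right] Suc.IH K'(2)
          smooth_upto_Suc_imp[OF Suc.prems])
    ultimately show ?thesis by blast
  qed
  ultimately show ?case by simp
qed

text \<open>Hadamard's lemma requires the segments from the points to the axis, which D may fail to
  contain; a product of balls about an axis point contains them. Radii \<open>\<epsilon> / 2\<close>
  keep the product inside the ball of radius \<open>\<epsilon>\<close>.\<close>

lemma axis_box:
  assumes "(y, 0) \<in> D"
  obtains B where "openin (top_of_set stem_space) B" "(y, 0) \<in> B" "B \<subseteq> D"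
    "\<And>z t. z \<in> B \<Longrightarrow> t \<in> {0..1} \<Longrightarrow> shrink t z \<in> B"
proof -
  obtain \<epsilon> where \<epsilon>: "\<epsilon> > 0" "ball (y, 0) \<epsilon> \<inter> stem_space \<subseteq> D"
    using D_openin assms unfolding openin_contains_ball by blast
  define B where "B = (ball y (\<epsilon> / 2) \<times> ball 0 (\<epsilon> / 2)) \<inter> stem_space"
  show ?thesis
  proof
    show "openin (top_of_set stem_space) B"
      unfolding B_def by (subst Int_commute) (intro openin_open_Int open_Times open_ball)
    show "(y, 0) \<in> B" using \<epsilon>(1) D_subset assms by (auto simp: B_def)
    show "B \<subseteq> D"
    proof
      fix z assume z: "z \<in> B"
      have "dist (y, 0) z \<le> dist y (fst z) + dist 0 (snd z)"
        using sqrt_sum_squares_le_sum[of "dist y (fst z)" "dist 0 (snd z)"] by (simp add: dist_prod_def)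
      also have "\<dots> < \<epsilon>" using z by (auto simp: B_def)
      finally show "z \<in> D" using z \<epsilon>(2) by (auto simp: B_def)
    qed
    show "shrink t z \<in> B" if "z \<in> B" "t \<in> {0..1}" for z t
    proof -
      have "\<bar>t * snd z\<bar> \<le> 1 * \<bar>snd z\<bar>" unfolding abs_mult using that(2) by (intro mult_right_mono) auto
      then show ?thesis using that by (auto simp: B_def shrink_def)
    qed
  qed
qed

lemma openin_off_axis: "openin (top_of_set stem_space) {z \<in> D. snd z \<noteq> 0}"
proof -
  have "open {z :: 'a \<times> real. snd z \<noteq> 0}"
    by (intro open_Collect_neq continuous_intros)
  then have "openin (top_of_set stem_space) (D \<inter> {z. snd z \<noteq> 0})"
    using D_openin by (rule openin_Int_open[rotated])
  then show ?thesis by (simp add: Int_def)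
qed

definition smooth :: "('a \<times> real \<Rightarrow> 'a) \<Rightarrow> bool" where
  "smooth K \<longleftrightarrow> (\<forall>n. smooth_upto dirs n D K)"

text \<open>Near the axis the quotient is an integral of the radial derivative, away from it a true
  division. Smoothness is local, so the two descriptions combine.\<close>

lemma smooth_quot:
  assumes K: "smooth K" and K0: "\<And>y. (y, 0) \<in> D \<Longrightarrow> K (y, 0) = 0"
  shows "smooth (quot K)"
  unfolding smooth_def
proof
  fix n
  show "smooth_upto dirs n D (quot K)"
  proof (rule smooth_upto_local[OF D_openin subspace_stem_space dirs_subset])
    fix z assume z: "z \<in> D"
    show "\<exists>W'. openin (top_of_set stem_space) W' \<and> z \<in> W' \<and> W' \<subseteq> D \<and> smooth_upto dirs n W' (quot K)"
    proof (cases "snd z = 0")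
      case True
      then have "(fst z, 0) \<in> D" using z by (metis prod.collapse)
      then show ?thesis
      proof (rule axis_box)
        fix B assume B: "openin (top_of_set stem_space) B" "(fst z, 0) \<in> B" "B \<subseteq> D"
          "\<And>z t. z \<in> B \<Longrightarrow> t \<in> {0..1} \<Longrightarrow> shrink t z \<in> B"
        have KB: "smooth_upto dirs n B K" for n
          using K smooth_upto_subset[OF _ B(3)] by (auto simp: smooth_def)
        have "smooth_upto dirs n B (quot K)"
        proof (rule smooth_upto_cong[OF B(1) subspace_stem_space dirs_subset])
          show "smooth_upto dirs n B (shrink_integral 0 (pder er K))"
            by (intro smooth_upto_shrink_integral[OF B(1,4)] smooth_upto_pder[OF B(1) subspace_stem_space dirs_subset KB er_dirs])
          show "quot K x = shrink_integral 0 (pder er K) x" if "x \<in> B" for x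
          proof (rule quot_eq_shrink_integral[OF B(4) _ _ that])
            show "K (fst x, 0) = 0" if "x \<in> B" for x
              using B(4)[OF that, of 0] B(3) by (intro K0) (auto simp: shrink_def)
          qed (use smooth_upto_has_dir[OF KB er_dirs] in auto)
        qed
        moreover have "z \<in> B" using B(2) True by (metis prod.collapse)
        ultimately show ?thesis using B by blast
      qed
    next
      case False
      have "smooth_upto dirs n {z \<in> D. snd z \<noteq> 0} K"
        using K by (auto simp: smooth_def intro: smooth_upto_subset)
      from smooth_upto_divide_power[OF openin_off_axis _ this, of 1]
      have "smooth_upto dirs n {z \<in> D. snd z \<noteq> 0} (\<lambda>z. (1 / snd z) *\<^sub>R K z)" by simp
      then have "smooth_upto dirs n {z \<in> D. snd z \<noteq> 0} (quot K)"
        by (rule smooth_upto_cong[OF openin_off_axis subspace_stem_space dirs_subset]) (simp add: quot_def)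
      then show ?thesis using openin_off_axis False z by blast
    qed
  qed
qed

lemma smooth_pder: "smooth K \<Longrightarrow> u \<in> dirs \<Longrightarrow> smooth (pder u K)"
  unfolding smooth_def using smooth_upto_pder[OF D_openin subspace_stem_space dirs_subset] by blast

lemma smooth_continuous: "smooth K \<Longrightarrow> continuous_on D K"
  unfolding smooth_def using smooth_upto_continuous by blast

lemma smooth_has_dir: "smooth K \<Longrightarrow> u \<in> dirs \<Longrightarrow> z \<in> D \<Longrightarrow> has_dir u K (pder u K z) z"
  unfolding smooth_def using smooth_upto_has_dir by blast

lemma smooth_pder_commute:
  "smooth K \<Longrightarrow> u \<in> dirs \<Longrightarrow> w \<in> dirs \<Longrightarrow> z \<in> D \<Longrightarrow> pder u (pder w K) z = pder w (pder u K) z"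
  unfolding smooth_def by (rule mixed_pder_commute[OF D_openin subspace_stem_space dirs_subset]) (rule spec)

end

section \<open>Parity in the radius\<close>

locale symmetric_stem_domain = stem_domain +
  assumes D_sym: "(y, r) \<in> D \<Longrightarrow> (y, - r) \<in> D"
begin

definition even_stem :: "('a \<times> real \<Rightarrow> 'a) \<Rightarrow> bool" where
  "even_stem K \<longleftrightarrow> (\<forall>y r. (y, r) \<in> D \<longrightarrow> K (y, - r) = K (y, r))"

definition odd_stem :: "('a \<times> real \<Rightarrow> 'a) \<Rightarrow> bool" where
  "odd_stem K \<longleftrightarrow> (\<forall>y r. (y, r) \<in> D \<longrightarrow> K (y, - r) = - K (y, r))"

lemma odd_stem_axis: "odd_stem K \<Longrightarrow> (y, 0) \<in> D \<Longrightarrow> K (y, 0) = 0"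
proof -
  assume "odd_stem K" "(y, 0) \<in> D"
  then have "K (y, 0) = - K (y, 0)" unfolding odd_stem_def by fastforce
  then have "2 *\<^sub>R K (y, 0) = 0" unfolding scaleR_2 by (metis add.right_inverse)
  then show "K (y, 0) = 0" by simp
qed

text \<open>The composite of K with the reflection of r agrees with K on D, so its radial derivative
  at the reflected point can be computed in two ways.\<close>

lemma even_stem_pder:
  assumes "smooth K" "even_stem K"
  shows "odd_stem (pder er K)"
  unfolding odd_stem_def
proof (intro allI impI)
  fix y r assume z: "(y, r) \<in> D"
  have "has_dir (- er) K (- pder er K (y, r)) (y, r)"
    using has_dir_scale_dir[OF smooth_has_dir[OF assms(1) er_dirs z], of "- 1"] by simp
  then have "has_dir er (\<lambda>z. K (fst z, - snd z)) (- pder er K (y, r)) (y, - r)"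
    by (simp add: has_dir_def)
  moreover have "has_dir er (\<lambda>z. K (fst z, - snd z)) (pder er K (y, - r)) (y, - r)"
  proof (rule has_dir_transform_openin[OF D_openin subspace_stem_space _ D_sym[OF z]])
    show "er \<in> stem_space" using er_dirs dirs_subset by blast
    show "has_dir er K (pder er K (y, - r)) (y, - r)"
      by (rule smooth_has_dir[OF assms(1) er_dirs D_sym[OF z]])
    show "K (fst x, - snd x) = K x" if "x \<in> D" for x
      using assms(2) that by (cases x) (auto simp: even_stem_def)
  qed
  ultimately show "pder er K (y, - r) = - pder er K (y, r)"
    using has_dir_unique by blast
qed

lemma even_stem_quot: "odd_stem K \<Longrightarrow> even_stem (quot K)"
  unfolding even_stem_def quot_def odd_stem_def by auto

lemma quot_mult:
  "odd_stem K \<Longrightarrow> z \<in> D \<Longrightarrow> snd z *\<^sub>R quot K z = K z"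
  using odd_stem_axis[of K "fst z"] by (cases z) (auto simp: quot_def)

definition radial_deriv :: "('a \<times> real \<Rightarrow> 'a) \<Rightarrow> 'a \<times> real \<Rightarrow> 'a" where
  "radial_deriv K = quot (pder er K)"

lemma radial_deriv:
  assumes "smooth K" "even_stem K"
  shows "smooth (radial_deriv K)" "even_stem (radial_deriv K)"
    "\<And>z. z \<in> D \<Longrightarrow> has_dir er K (snd z *\<^sub>R radial_deriv K z) z"
proof -
  have o: "odd_stem (pder er K)" by (rule even_stem_pder[OF assms])
  show "smooth (radial_deriv K)"
    unfolding radial_deriv_def by (intro smooth_quot smooth_pder assms er_dirs odd_stem_axis[OF o])
  show "even_stem (radial_deriv K)" unfolding radial_deriv_def by (rule even_stem_quot[OF o])
  show "has_dir er K (snd z *\<^sub>R radial_deriv K z) z" if "z \<in> D" for z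
    using smooth_has_dir[OF assms(1) er_dirs that] quot_mult[OF o that] by (simp add: radial_deriv_def)
qed

end

section \<open>Iterated radial derivatives of the stem components\<close>

locale regular_pair = symmetric_stem_domain +
  fixes F1 F2 :: "'a \<times> real \<Rightarrow> 'a"
  assumes regular: "regular_stem F1 F2"
    and F1_even: "even_stem F1" and F2_odd: "odd_stem F2"
begin

definition A :: "nat \<Rightarrow> 'a \<times> real \<Rightarrow> 'a" where "A n = (radial_deriv ^^ n) F1"
text \<open>Starting from F2 / r makes the second sequence even as well, so both use the same
  operator; r times \<open>B n\<close> recovers the iterates of F2 in the statement.\<close>

definition B :: "nat \<Rightarrow> 'a \<times> real \<Rightarrow> 'a" where "B n = (radial_deriv ^^ n) (quot F2)"

lemma A_Suc: "A (Suc n) = radial_deriv (A n)" and B_Suc: "B (Suc n) = radial_deriv (B n)"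
  by (simp_all add: A_def B_def)

lemma smooth_F: "smooth F1" "smooth F2"
  using regular_stem_smooth[OF regular] by (auto simp: smooth_def)

lemma smooth_even_A: "smooth (A n) \<and> even_stem (A n)"
  by (induction n) (auto simp: A_Suc radial_deriv, auto simp: A_def smooth_F F1_even)

lemma smooth_even_B: "smooth (B n) \<and> even_stem (B n)"
proof (induction n)
  case 0
  show ?case
    using smooth_quot[OF smooth_F(2)] odd_stem_axis[OF F2_odd] even_stem_quot[OF F2_odd] by (simp add: B_def)
qed (auto simp: B_Suc radial_deriv)

lemmas smooth_A = smooth_even_A[THEN conjunct1] and even_A = smooth_even_A[THEN conjunct2]
  and smooth_B = smooth_even_B[THEN conjunct1] and even_B = smooth_even_B[THEN conjunct2]

lemma has_dir_A: "z \<in> D \<Longrightarrow> has_dir er (A n) (snd z *\<^sub>R A (Suc n) z) z"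
  unfolding A_Suc by (rule radial_deriv(3)[OF smooth_A even_A])

lemma has_dir_B: "z \<in> D \<Longrightarrow> has_dir er (B n) (snd z *\<^sub>R B (Suc n) z) z"
  unfolding B_Suc by (rule radial_deriv(3)[OF smooth_B even_B])

lemma F2_eq: "z \<in> D \<Longrightarrow> F2 z = snd z *\<^sub>R B 0 z"
  using quot_mult[OF F2_odd] by (simp add: B_def)

lemma dirs_stem_space: "u \<in> dirs \<Longrightarrow> u \<in> stem_space"
  using dirs_subset by blast

text \<open>Identities obtained by cancelling a factor r hold off the axis at first. Each axis point
  of D is a limit of such points along the radial line.\<close>

lemma eq_by_density:
  fixes f g :: "'a \<times> real \<Rightarrow> 'a"
  assumes f: "continuous_on D f" and g: "continuous_on D g"
    and eq: "\<And>z. z \<in> D \<Longrightarrow> snd z \<noteq> 0 \<Longrightarrow> f z = g z" and z: "z \<in> D"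
  shows "f z = g z"
proof (cases "snd z = 0")
  case True
  show ?thesis
  proof (rule openin_dir[OF D_openin subspace_stem_space dirs_stem_space[OF er_dirs] z])
    fix \<eta> :: real assume \<eta>: "\<eta> > 0" "\<And>h. \<bar>h\<bar> < \<eta> \<Longrightarrow> z + h *\<^sub>R er \<in> D"
    define \<phi> where "\<phi> h = f (z + h *\<^sub>R er) - g (z + h *\<^sub>R er)" for h
    have "continuous_on {- \<eta><..<\<eta>} \<phi>"
      unfolding \<phi>_def using \<eta>(2)
      by (intro continuous_on_diff continuous_on_compose2[OF f] continuous_on_compose2[OF g] continuous_intros) auto
    then have "(\<phi> \<longlongrightarrow> \<phi> 0) (at 0)"
      using \<eta>(1) by (auto simp: continuous_on_eq_continuous_at isCont_def)
    moreover have "\<forall>\<^sub>F h in at 0. \<phi> h = 0"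
      unfolding eventually_at
    proof (intro exI conjI ballI impI)
      fix h :: real assume h: "h \<noteq> 0 \<and> dist h 0 < \<eta>"
      then show "\<phi> h = 0" using eq[OF \<eta>(2), of h] True by (simp add: \<phi>_def)
    qed (rule \<eta>(1))
    then have "(\<phi> \<longlongrightarrow> 0) (at 0)" by (rule tendsto_eventually)
    ultimately have "\<phi> 0 = 0" using tendsto_unique trivial_limit_at by blast
    then show ?thesis by (simp add: \<phi>_def flip: zero_prod_def)
  qed
qed (rule eq[OF z])

text \<open>Carrying the signs as a parameter lets one set of rules serve D and its
  conjugate.\<close>

definition gdirac :: "(nat \<Rightarrow> real) \<Rightarrow> ('a \<times> real \<Rightarrow> 'a) \<Rightarrow> 'a \<times> real \<Rightarrow> 'a" where
  "gdirac c G z = (\<Sum>s\<le>p. c s *\<^sub>R mul (v s) (pder (ev s) G z))"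

lemma dirac_stem_gdirac: "dirac_stem = gdirac (\<lambda>s. 1)"
  and conj_dirac_stem_gdirac: "conj_dirac_stem = gdirac conj_sign"
  by (simp_all add: fun_eq_iff dirac_stem_def conj_dirac_stem_def gdirac_def)

lemma bounded_linear_coeff_mul: "bounded_linear (\<lambda>y. r *\<^sub>R mul c y)"
  by (intro bounded_linear_compose[OF bounded_linear_scaleR_right] bounded_bilinear.bounded_linear_right[OF bil])

lemma continuous_on_gdirac: "smooth G \<Longrightarrow> continuous_on D (gdirac c G)"
  unfolding gdirac_def
  by (intro continuous_on_sum bounded_linear.continuous_on[OF bounded_linear_coeff_mul] smooth_continuous
      smooth_pder ev_dirs) auto

lemma has_dir_snd_ev: "has_dir (ev s) (\<lambda>z. snd z) 0 z"
  by (simp add: has_dir_def ev_def)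

lemma has_dir_snd_er: "has_dir er (\<lambda>z. snd z) 1 z"
  unfolding has_dir_def
  by (auto intro!: derivative_eq_intros simp: has_real_derivative_iff_has_vector_derivative[symmetric])

lemma pder_ev_cong:
  assumes "s \<le> p" "z \<in> D" "has_dir (ev s) G d z" "\<And>z. z \<in> D \<Longrightarrow> K z = G z"
  shows "pder (ev s) K z = d"
  using has_dir_transform_openin[OF D_openin subspace_stem_space dirs_stem_space[OF ev_dirs[OF assms(1)]] assms(2-4)]
  by (rule has_dir_pder)

lemma pder_ev_snd_mult:
  assumes s: "s \<le> p" and z: "z \<in> D" and G: "smooth G" and K: "\<And>z. z \<in> D \<Longrightarrow> K z = snd z *\<^sub>R G z"
  shows "pder (ev s) K z = snd z *\<^sub>R pder (ev s) G z"
proof (rule pder_ev_cong[OF s z _ K])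
  show "has_dir (ev s) (\<lambda>z. snd z *\<^sub>R G z) (snd z *\<^sub>R pder (ev s) G z) z"
    using has_dir_scaleR[OF has_dir_snd_ev smooth_has_dir[OF G ev_dirs[OF s] z]] by simp
qed

lemma gdirac_snd_mult:
  assumes z: "z \<in> D" and G: "smooth G" and K: "\<And>z. z \<in> D \<Longrightarrow> K z = snd z *\<^sub>R G z"
  shows "gdirac c K z = snd z *\<^sub>R gdirac c G z"
  unfolding gdirac_def using z
  by (simp add: pder_ev_snd_mult[OF _ z G K] mul_scaleR_right scaleR_sum_right mult_ac)

text \<open>The radial derivative commutes with an operator in x_p with constant coefficients, and
  the factor r in \<open>pder er G\<close> passes through that operator.\<close>

lemma has_dir_gdirac:
  assumes z: "z \<in> D" and G: "smooth G" "even_stem G"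
  shows "has_dir er (gdirac c G) (snd z *\<^sub>R gdirac c (radial_deriv G) z) z"
proof -
  have "has_dir er (pder (ev s) G) (pder (ev s) (pder er G) z) z" if "s \<le> p" for s
    using smooth_has_dir[OF smooth_pder[OF G(1) ev_dirs[OF that]] er_dirs z]
      smooth_pder_commute[OF G(1) er_dirs ev_dirs[OF that] z] by simp
  then have "has_dir er (gdirac c G) (gdirac c (pder er G) z) z"
    unfolding gdirac_def[abs_def]
    by (intro has_dir_sum has_dir_linear[OF bounded_linear_coeff_mul]) auto
  moreover have "gdirac c (pder er G) z = snd z *\<^sub>R gdirac c (radial_deriv G) z"
    using has_dir_pder[OF radial_deriv(3)[OF G]] by (intro gdirac_snd_mult z radial_deriv(1) G)
  ultimately show ?thesis by simp
qed

lemma er_derivative_eq: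
  assumes "z \<in> D" "has_dir er f d z" "has_dir er g d' z" "\<And>z. z \<in> D \<Longrightarrow> f z = g z"
  shows "d = d'"
  using has_dir_transform_openin[OF D_openin subspace_stem_space dirs_stem_space[OF er_dirs] assms(1,3,4)]
    assms(2) has_dir_unique by blast

text \<open>The base case is the second equation of the system divided by r. Each further step
  differentiates the identity in r and divides by r again; the axis is reached by
  continuity.\<close>

lemma conj_dirac_B: "z \<in> D \<Longrightarrow> gdirac conj_sign (B n) z = - A (Suc n) z"
proof (induction n arbitrary: z)
  case 0
  have *: "gdirac conj_sign (B 0) z = - A (Suc 0) z" if z: "z \<in> D" "snd z \<noteq> 0" for z
  proof -
    have "snd z *\<^sub>R gdirac conj_sign (B 0) z = gdirac conj_sign F2 z"
      by (rule gdirac_snd_mult[OF z(1) smooth_B F2_eq, symmetric])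
    also have "\<dots> = - pder er F1 z"
      using regular z(1) by (simp add: regular_stem_def conj_dirac_stem_gdirac)
    also have "pder er F1 z = snd z *\<^sub>R A (Suc 0) z"
      using has_dir_pder[OF has_dir_A[OF z(1), of 0]] by (simp add: A_def)
    finally have "snd z *\<^sub>R gdirac conj_sign (B 0) z = snd z *\<^sub>R (- A (Suc 0) z)" by simp
    then show ?thesis using z(2) unfolding scaleR_cancel_left by simp
  qed
  show ?case
    using eq_by_density[OF continuous_on_gdirac[OF smooth_B] continuous_on_minus[OF smooth_continuous[OF smooth_A]] * 0] .
next
  case (Suc n)
  have *: "gdirac conj_sign (B (Suc n)) z = - A (Suc (Suc n)) z" if z: "z \<in> D" "snd z \<noteq> 0" for z
  proof -
    have "snd z *\<^sub>R gdirac conj_sign (B (Suc n)) z = - (snd z *\<^sub>R A (Suc (Suc n)) z)"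
    proof (rule er_derivative_eq[OF z(1) _ _ Suc.IH])
      show "has_dir er (gdirac conj_sign (B n)) (snd z *\<^sub>R gdirac conj_sign (B (Suc n)) z) z"
        unfolding B_Suc by (rule has_dir_gdirac[OF z(1) smooth_B even_B])
      show "has_dir er (\<lambda>z. - A (Suc n) z) (- (snd z *\<^sub>R A (Suc (Suc n)) z)) z"
        by (rule has_dir_linear[OF bounded_linear_minus[OF bounded_linear_ident] has_dir_A[OF z(1)]])
    qed
    then have "snd z *\<^sub>R gdirac conj_sign (B (Suc n)) z = snd z *\<^sub>R (- A (Suc (Suc n)) z)" by simp
    then show ?thesis using z(2) unfolding scaleR_cancel_left by simp
  qed
  show ?case
    using eq_by_density[OF continuous_on_gdirac[OF smooth_B] continuous_on_minus[OF smooth_continuous[OF smooth_A]] * Suc.prems] .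
qed

text \<open>The base case is the product rule d_r (r B0) = B0 + r^2 B1. Differentiating the term
  with r^2 yields an extra 2 r \<open>B (Suc n)\<close>, which raises the odd coefficient by 2 in
  every step.\<close>

lemma dirac_A: "z \<in> D \<Longrightarrow> gdirac (\<lambda>s. 1) (A n) z = (2 * n + 1) *\<^sub>R B n z + (snd z)\<^sup>2 *\<^sub>R B (Suc n) z"
proof (induction n arbitrary: z)
  case 0
  have "has_dir er (\<lambda>z. snd z *\<^sub>R B 0 z) (snd z *\<^sub>R (snd z *\<^sub>R B 1 z) + 1 *\<^sub>R B 0 z) z"
    using has_dir_scaleR[OF has_dir_snd_er has_dir_B[OF 0, of 0]] by simp
  then have "has_dir er F2 (snd z *\<^sub>R (snd z *\<^sub>R B 1 z) + 1 *\<^sub>R B 0 z) z"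
    by (rule has_dir_transform_openin[OF D_openin subspace_stem_space dirs_stem_space[OF er_dirs] 0]) (rule F2_eq)
  then have "pder er F2 z = snd z *\<^sub>R (snd z *\<^sub>R B 1 z) + 1 *\<^sub>R B 0 z"
    by (rule has_dir_pder)
  moreover have "gdirac (\<lambda>s. 1) F1 z = pder er F2 z"
    using regular 0 by (simp add: regular_stem_def dirac_stem_gdirac)
  ultimately show ?case by (simp add: A_def power2_eq_square)
next
  case (Suc n)
  let ?R = "\<lambda>z. (2 * Suc n + 1) *\<^sub>R B (Suc n) z + (snd z)\<^sup>2 *\<^sub>R B (Suc (Suc n)) z"
  have *: "gdirac (\<lambda>s. 1) (A (Suc n)) z = ?R z" if z: "z \<in> D" "snd z \<noteq> 0" for z
  proof -
    have "snd z *\<^sub>R gdirac (\<lambda>s. 1) (A (Suc n)) z = snd z *\<^sub>R ?R z"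
    proof (rule er_derivative_eq[OF z(1)])
      show "has_dir er (gdirac (\<lambda>s. 1) (A n)) (snd z *\<^sub>R gdirac (\<lambda>s. 1) (A (Suc n)) z) z"
        unfolding A_Suc by (rule has_dir_gdirac[OF z(1) smooth_A even_A])
      have "has_dir er (\<lambda>z. (2 * n + 1) *\<^sub>R B n z + snd z *\<^sub>R (snd z *\<^sub>R B (Suc n) z))
        ((2 * n + 1) *\<^sub>R (snd z *\<^sub>R B (Suc n) z)
         + (snd z *\<^sub>R (snd z *\<^sub>R (snd z *\<^sub>R B (Suc (Suc n)) z) + 1 *\<^sub>R B (Suc n) z)
          + 1 *\<^sub>R (snd z *\<^sub>R B (Suc n) z))) z"
        by (intro has_dir_add has_dir_linear[OF bounded_linear_scaleR_right] has_dir_scaleR has_dir_snd_er has_dir_B z)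
      then show "has_dir er (\<lambda>z. (2 * n + 1) *\<^sub>R B n z + snd z *\<^sub>R (snd z *\<^sub>R B (Suc n) z)) (snd z *\<^sub>R ?R z) z"
      proof (rule has_dir_eq_rhs)
        have "(2 * Suc n + 1) *\<^sub>R x = (2 * n + 1) *\<^sub>R x + x + x" for x :: 'a
          using scaleR_left_distrib[of "2 * n + 1" 2 x] by (simp add: scaleR_2 add.commute)
        then show "(2 * n + 1) *\<^sub>R (snd z *\<^sub>R B (Suc n) z)
         + (snd z *\<^sub>R (snd z *\<^sub>R (snd z *\<^sub>R B (Suc (Suc n)) z) + 1 *\<^sub>R B (Suc n) z)
          + 1 *\<^sub>R (snd z *\<^sub>R B (Suc n) z)) = snd z *\<^sub>R ?R z"
          by (simp only: power2_eq_square scaleR_add_right scaleR_scaleR mult.commute scaleR_one add_ac mult_1_right mult_1_left mult_ac)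
      qed
      show "gdirac (\<lambda>s. 1) (A n) z = (2 * n + 1) *\<^sub>R B n z + snd z *\<^sub>R (snd z *\<^sub>R B (Suc n) z)" if "z \<in> D" for z
        using Suc.IH[OF that] by (simp add: power2_eq_square)
    qed
    then show ?thesis using z(2) unfolding scaleR_cancel_left by simp
  qed
  show ?case
    by (rule eq_by_density[OF continuous_on_gdirac[OF smooth_A] _ * Suc.prems])
      (intro continuous_intros smooth_continuous smooth_B)
qed

lemma pder_ev_gdirac:
  assumes s: "s \<le> p" and z: "z \<in> D" and G: "smooth G"
  shows "pder (ev s) (gdirac c G) z = (\<Sum>t\<le>p. c t *\<^sub>R mul (v t) (pder (ev s) (pder (ev t) G) z))"
proof (rule has_dir_pder)
  show "has_dir (ev s) (gdirac c G) (\<Sum>t\<le>p. c t *\<^sub>R mul (v t) (pder (ev s) (pder (ev t) G) z)) z"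
    unfolding gdirac_def[abs_def]
    by (intro has_dir_sum has_dir_linear[OF bounded_linear_coeff_mul] smooth_has_dir smooth_pder ev_dirs s z G) auto
qed

text \<open>The conjugate operator is applied to \<open>dirac_A\<close>. It treats r^2 as a
  constant, and \<open>conj_dirac_B\<close> evaluates both resulting terms.\<close>

lemma laplace_A:
  assumes z: "z \<in> D"
  shows "(\<Sum>s\<le>p. pder (ev s) (pder (ev s) (A n)) z) = - ((2 * n + 1) *\<^sub>R A (Suc n) z) - (snd z)\<^sup>2 *\<^sub>R A (Suc (Suc n)) z"
proof -
  have d: "pder (ev s) (gdirac (\<lambda>s. 1) (A n)) z = (2 * n + 1) *\<^sub>R pder (ev s) (B n) z + (snd z)\<^sup>2 *\<^sub>R pder (ev s) (B (Suc n)) z"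
    if s: "s \<le> p" for s
  proof (rule pder_ev_cong[OF s z _])
    have "has_dir (ev s) (\<lambda>z. (2 * n + 1) *\<^sub>R B n z + snd z *\<^sub>R (snd z *\<^sub>R B (Suc n) z))
      ((2 * n + 1) *\<^sub>R pder (ev s) (B n) z +
        (snd z *\<^sub>R (snd z *\<^sub>R pder (ev s) (B (Suc n)) z + 0 *\<^sub>R B (Suc n) z) + 0 *\<^sub>R (snd z *\<^sub>R B (Suc n) z))) z"
      by (intro has_dir_add has_dir_linear[OF bounded_linear_scaleR_right] has_dir_scaleR has_dir_snd_ev
          smooth_has_dir smooth_B ev_dirs s z)
    then show "has_dir (ev s) (\<lambda>z. (2 * n + 1) *\<^sub>R B n z + snd z *\<^sub>R (snd z *\<^sub>R B (Suc n) z))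
      ((2 * n + 1) *\<^sub>R pder (ev s) (B n) z + (snd z)\<^sup>2 *\<^sub>R pder (ev s) (B (Suc n)) z) z"
      by (rule has_dir_eq_rhs) (simp add: power2_eq_square)
  qed (simp add: dirac_A power2_eq_square)
  have "(\<Sum>s\<le>p. pder (ev s) (pder (ev s) (A n)) z) =
      (\<Sum>s\<le>p. conj_sign s *\<^sub>R mul (v s) (\<Sum>t\<le>p. mul (v t) (pder (ev s) (pder (ev t) (A n)) z)))"
    using p_less by (intro conj_dirac_dirac[symmetric] smooth_pder_commute smooth_A ev_dirs z) auto
  also have "\<dots> = (\<Sum>s\<le>p. conj_sign s *\<^sub>R mul (v s) (pder (ev s) (gdirac (\<lambda>s. 1) (A n)) z))"
    by (intro sum.cong refl) (simp add: pder_ev_gdirac[OF _ z smooth_A])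
  also have "\<dots> = (\<Sum>s\<le>p. conj_sign s *\<^sub>R mul (v s) ((2 * n + 1) *\<^sub>R pder (ev s) (B n) z + (snd z)\<^sup>2 *\<^sub>R pder (ev s) (B (Suc n)) z))"
    by (intro sum.cong refl) (simp add: d)
  also have "\<dots> = (2 * n + 1) *\<^sub>R gdirac conj_sign (B n) z + (snd z)\<^sup>2 *\<^sub>R gdirac conj_sign (B (Suc n)) z"
    unfolding gdirac_def scaleR_sum_right sum.distrib[symmetric]
    by (intro sum.cong refl) (simp add: mul_add_right mul_scaleR_right scaleR_add_right mult.commute)
  finally show ?thesis by (simp add: conj_dirac_B[OF z])
qed

text \<open>Here the operators come in the other order: D applied to \<open>conj_dirac_B\<close>
  leads to \<open>dirac_A\<close> at \<open>Suc n\<close>, whence the coefficient 2 n + 3.\<close>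

lemma laplace_B:
  assumes z: "z \<in> D"
  shows "(\<Sum>s\<le>p. pder (ev s) (pder (ev s) (B n)) z) = - ((2 * n + 3) *\<^sub>R B (Suc n) z) - (snd z)\<^sup>2 *\<^sub>R B (Suc (Suc n)) z"
proof -
  have d: "pder (ev s) (gdirac conj_sign (B n)) z = - pder (ev s) (A (Suc n)) z" if s: "s \<le> p" for s
    by (rule pder_ev_cong[OF s z _ conj_dirac_B])
      (intro has_dir_linear[OF bounded_linear_minus[OF bounded_linear_ident]] smooth_has_dir smooth_A ev_dirs s z)
  have "(\<Sum>s\<le>p. pder (ev s) (pder (ev s) (B n)) z) =
      (\<Sum>s\<le>p. mul (v s) (\<Sum>t\<le>p. conj_sign t *\<^sub>R mul (v t) (pder (ev s) (pder (ev t) (B n)) z)))"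
    using p_less by (intro dirac_conj_dirac[symmetric] smooth_pder_commute smooth_B ev_dirs z) auto
  also have "\<dots> = (\<Sum>s\<le>p. mul (v s) (pder (ev s) (gdirac conj_sign (B n)) z))"
    by (intro sum.cong refl) (simp add: pder_ev_gdirac[OF _ z smooth_B])
  also have "\<dots> = - gdirac (\<lambda>s. 1) (A (Suc n)) z"
    by (simp add: gdirac_def d mul_minus_right sum_negf)
  finally show ?thesis by (simp add: dirac_A[OF z] algebra_simps)
qed

end

section \<open>The symmetric completion\<close>

context regular_pair
begin

abbreviation "Q \<equiv> {p + 1..m}"
abbreviation "\<Omega> \<equiv> psym_completion v p m D"

text \<open>The splitting uses linear coordinates in place of a polar decomposition:
  \<open>xq\<close> stays linear across the axis, where the unit vector omega is
  undetermined.\<close>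

definition xp :: "'a \<Rightarrow> 'a" where "xp x = (\<Sum>s\<le>p. \<xi> s x *\<^sub>R v s)"
definition xq :: "'a \<Rightarrow> 'a" where "xq x = (\<Sum>s\<in>Q. \<xi> s x *\<^sub>R v s)"
definition rad2 :: "'a \<Rightarrow> real" where "rad2 x = (\<Sum>s\<in>Q. (\<xi> s x)\<^sup>2)"
definition stem_pt :: "'a \<Rightarrow> 'a \<times> real" where "stem_pt x = (xp x, sqrt (rad2 x))"

lemma coord_add: "\<xi> s (x + h *\<^sub>R y) = \<xi> s x + h * \<xi> s y"
  by (simp add: linear_add[OF linear_coord] linear_scale[OF linear_coord])

lemma coord_sum: "\<xi> t (\<Sum>s\<in>I. c s *\<^sub>R v s) = (\<Sum>s\<in>I. c s * \<xi> t (v s))"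
  by (simp add: linear_sum[OF linear_coord] linear_scale[OF linear_coord])

lemma coord_frame_sum:
  assumes "I \<subseteq> {..m}" "t \<le> m"
  shows "\<xi> t (\<Sum>s\<in>I. c s *\<^sub>R v s) = (if t \<in> I then c t else 0)"
proof -
  have I: "finite I" using assms(1) finite_subset by blast
  have "\<xi> t (\<Sum>s\<in>I. c s *\<^sub>R v s) = (\<Sum>s\<in>I. if s = t then c t else 0)"
    unfolding coord_sum using assms by (intro sum.cong) (auto simp: coord_frame)
  then show ?thesis using I by simp
qed

lemma coord_stem:
  assumes "y \<in> span (v ` {..p})" "s \<in> Q"
  shows "\<xi> s y = 0"
proof -
  have "\<xi> s (\<Sum>t\<le>p. \<xi> t y *\<^sub>R v t) = 0"
    using assms(2) p_less by (subst coord_frame_sum) auto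
  then show ?thesis using span_coord[of p y] assms(1) p_less by simp
qed

lemma polar:
  assumes z: "(y, r) \<in> D" "r \<ge> 0" and w: "w \<in> sphere_q v p m"
  shows "xp (y + r *\<^sub>R w) = y" "xq (y + r *\<^sub>R w) = r *\<^sub>R w" "rad2 (y + r *\<^sub>R w) = r\<^sup>2"
    "stem_pt (y + r *\<^sub>R w) = (y, r)"
proof -
  have y: "y \<in> span (v ` {..p})" using z(1) D_subset by auto
  obtain c where c: "w = (\<Sum>s\<in>Q. c s *\<^sub>R v s)" "(\<Sum>s\<in>Q. (c s)\<^sup>2) = 1"
    using w by (auto simp: sphere_q_def)
  have w0: "\<xi> s w = (if s \<in> Q then c s else 0)" if "s \<le> m" for s
    unfolding c(1) using that by (intro coord_frame_sum) auto
  have "xp (y + r *\<^sub>R w) = (\<Sum>s\<le>p. \<xi> s y *\<^sub>R v s)"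
    unfolding xp_def using p_less by (intro sum.cong) (auto simp: coord_add w0)
  then show *: "xp (y + r *\<^sub>R w) = y" using span_coord[of p y] y p_less by simp
  have q: "\<xi> s (y + r *\<^sub>R w) = r * c s" if "s \<in> Q" for s
    using that by (simp add: coord_add coord_stem[OF y] w0)
  have "xq (y + r *\<^sub>R w) = (\<Sum>s\<in>Q. (r * c s) *\<^sub>R v s)"
    unfolding xq_def by (intro sum.cong) (auto simp: q)
  then show "xq (y + r *\<^sub>R w) = r *\<^sub>R w" by (simp add: c(1) scaleR_sum_right)
  have "rad2 (y + r *\<^sub>R w) = (\<Sum>s\<in>Q. r\<^sup>2 * (c s)\<^sup>2)"
    unfolding rad2_def by (intro sum.cong) (auto simp: q power_mult_distrib)
  then show "rad2 (y + r *\<^sub>R w) = r\<^sup>2"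
    using c(2) by (simp flip: sum_distrib_left)
  then show "stem_pt (y + r *\<^sub>R w) = (y, r)"
    using * z(2) by (simp add: stem_pt_def)
qed

lemma span_split: "x \<in> span (v ` {..m}) \<Longrightarrow> xp x + xq x = x"
proof -
  assume x: "x \<in> span (v ` {..m})"
  have "{..m} = {..p} \<union> Q" using p_less by auto
  then have "(\<Sum>s\<le>m. \<xi> s x *\<^sub>R v s) = xp x + xq x"
    by (simp add: xp_def xq_def sum.union_disjoint)
  then show ?thesis using span_coord[of m x] x by simp
qed

lemma xp_span: "xp x \<in> span (v ` {..p})"
  unfolding xp_def by (rule span_sum, rule span_scale, rule span_base) simp

lemma stem_pt_in: "stem_pt x \<in> stem_space"
  by (simp add: stem_pt_def xp_span)

lemma rad2_nonneg: "rad2 x \<ge> 0"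
  by (simp add: rad2_def sum_nonneg)

lemma mem_Omega: "x \<in> \<Omega> \<longleftrightarrow> x \<in> span (v ` {..m}) \<and> stem_pt x \<in> D"
proof
  assume "x \<in> \<Omega>"
  then obtain y r w where x: "x = y + r *\<^sub>R w" "(y, r) \<in> D" "r \<ge> 0" and w: "w \<in> sphere_q v p m"
    by (auto simp: psym_completion_def)
  have "y \<in> span (v ` {..p})" using x(2) D_subset by auto
  then have "y \<in> span (v ` {..m})" using p_less by (rule_tac set_mp[OF span_mono]) auto
  moreover have "w \<in> span (v ` {..m})"
  proof -
    obtain c where c: "w = (\<Sum>s\<in>Q. c s *\<^sub>R v s)" using w by (auto simp: sphere_q_def)
    show ?thesis unfolding c by (rule span_sum, rule span_scale, rule span_base) auto
  qed
  ultimately show "x \<in> span (v ` {..m}) \<and> stem_pt x \<in> D"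
    using polar(4)[OF x(2,3) w] x by (simp add: span_add span_scale)
next
  assume x: "x \<in> span (v ` {..m}) \<and> stem_pt x \<in> D"
  define r where "r = sqrt (rad2 x)"
  have r: "r \<ge> 0" "r\<^sup>2 = rad2 x" using rad2_nonneg by (auto simp: r_def)
  have "\<exists>w\<in>sphere_q v p m. xq x = r *\<^sub>R w"
  proof (cases "r = 0")
    case True
    then have "\<xi> s x = 0" if "s \<in> Q" for s
      using r(2) that by (simp add: rad2_def sum_nonneg_eq_0_iff)
    then have "xq x = 0" by (simp add: xq_def)
    \<comment> \<open>On the axis any unit vector will do; \<open>v (p + 1)\<close> is available
      because \<open>p < m\<close>.\<close>
    moreover have "v (p + 1) \<in> sphere_q v p m"
      unfolding sphere_q_def using p_less
      by (auto intro!: exI[of _ "\<lambda>s. if s = p + 1 then 1 else 0"] simp: if_distrib[of "\<lambda>c. c *\<^sub>R _"] if_distrib[of "\<lambda>c. c\<^sup>2"] cong: if_cong)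
    ultimately show ?thesis using True by auto
  next
    case False
    define w where "w = (\<Sum>s\<in>Q. (\<xi> s x / r) *\<^sub>R v s)"
    have "(\<Sum>s\<in>Q. (\<xi> s x / r)\<^sup>2) = rad2 x / r\<^sup>2"
      by (simp add: power_divide rad2_def sum_divide_distrib)
    then have "(\<Sum>s\<in>Q. (\<xi> s x / r)\<^sup>2) = 1"
      using False by (simp flip: r(2))
    then have "w \<in> sphere_q v p m"
      unfolding sphere_q_def w_def by (intro CollectI exI[of _ "\<lambda>s. \<xi> s x / r"]) simp
    moreover have "xq x = r *\<^sub>R w"
      using False by (simp add: xq_def w_def scaleR_sum_right)
    ultimately show ?thesis by blast
  qed
  then obtain w where w: "w \<in> sphere_q v p m" "xq x = r *\<^sub>R w" by blast
  have "x = xp x + r *\<^sub>R w" using span_split[of x] x w(2) by simp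
  moreover have "(xp x, r) \<in> D" using x by (simp add: stem_pt_def r_def)
  ultimately show "x \<in> \<Omega>" using r(1) w(1) unfolding psym_completion_def by blast
qed

lemma continuous_on_coord: "continuous_on X (\<xi> s)"
  using linear_continuous_on[OF linear_conv_bounded_linear[THEN iffD1, OF linear_coord]] .

lemma continuous_on_stem_pt: "continuous_on X stem_pt"
  unfolding stem_pt_def xp_def rad2_def by (intro continuous_intros continuous_on_coord)

lemma continuous_on_xq: "continuous_on X xq"
  unfolding xq_def by (intro continuous_intros continuous_on_coord)

lemma openin_Omega: "openin (top_of_set (span (v ` {..m}))) \<Omega>"
proof -
  obtain T where T: "open T" "D = stem_space \<inter> T"
    using D_openin by (auto simp: openin_open)
  have "stem_pt x \<in> D \<longleftrightarrow> stem_pt x \<in> T" for x using T(2) stem_pt_in by blast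
  then have "\<Omega> = span (v ` {..m}) \<inter> stem_pt -` T" using mem_Omega by auto
  moreover have "open (stem_pt -` T)" using open_vimage[OF T(1) continuous_on_stem_pt] .
  ultimately show ?thesis by (simp add: openin_open_Int)
qed

lemma Omega_stem_pt: "x \<in> \<Omega> \<Longrightarrow> stem_pt x \<in> D"
  using mem_Omega by blast

lemma Omega_transform:
  assumes "s \<le> m" "x \<in> \<Omega>" "has_dir (v s) g d x" "\<And>x. x \<in> \<Omega> \<Longrightarrow> k x = g x"
  shows "has_dir (v s) k d x"
proof -
  have "v s \<in> span (v ` {..m})" using assms(1) by (intro span_base) auto
  then show ?thesis
    using has_dir_transform_openin[OF openin_Omega subspace_span _ assms(2-4)] by blast
qed

lemma continuous_on_lift:
  assumes "continuous_on D E" shows "continuous_on \<Omega> (\<lambda>x. E (stem_pt x))"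
  by (rule continuous_on_compose2[OF assms continuous_on_stem_pt]) (auto intro: Omega_stem_pt)

lemma has_dir_coord: "s \<le> m \<Longrightarrow> t \<le> m \<Longrightarrow> has_dir (v s) (\<xi> t) (if s = t then 1 else 0) x"
  unfolding has_dir_def coord_add
  by (auto intro!: derivative_eq_intros simp: has_real_derivative_iff_has_vector_derivative[symmetric] coord_frame)

lemma xq_shift:
  assumes "s \<le> m" shows "xq (x + h *\<^sub>R v s) = xq x + h *\<^sub>R (if s \<in> Q then v s else 0)"
proof -
  have "xq (x + h *\<^sub>R v s) = xq x + (\<Sum>t\<in>Q. (h * \<xi> t (v s)) *\<^sub>R v t)"
    by (simp add: xq_def coord_add scaleR_add_left sum.distrib)
  also have "(\<Sum>t\<in>Q. (h * \<xi> t (v s)) *\<^sub>R v t) = (\<Sum>t\<in>Q. if t = s then h *\<^sub>R v s else 0)"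
    using assms by (intro sum.cong) (auto simp: coord_frame)
  finally show ?thesis by (auto simp: sum.delta)
qed

lemma has_dir_xq: "s \<le> m \<Longrightarrow> has_dir (v s) xq (if s \<in> Q then v s else 0) x"
  unfolding has_dir_def xq_shift
  by (auto intro!: derivative_eq_intros)

lemma xp_shift:
  assumes "s \<le> m" shows "xp (x + h *\<^sub>R v s) = xp x + h *\<^sub>R (if s \<le> p then v s else 0)"
proof -
  have "xp (x + h *\<^sub>R v s) = xp x + (\<Sum>t\<le>p. (h * \<xi> t (v s)) *\<^sub>R v t)"
    by (simp add: xp_def coord_add scaleR_add_left sum.distrib)
  also have "(\<Sum>t\<le>p. (h * \<xi> t (v s)) *\<^sub>R v t) = (\<Sum>t\<le>p. if t = s then h *\<^sub>R v s else 0)"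
    using assms p_less by (intro sum.cong) (auto simp: coord_frame)
  finally show ?thesis by (auto simp: sum.delta)
qed

lemma rad2_shift_p:
  assumes "s \<le> p" shows "rad2 (x + h *\<^sub>R v s) = rad2 x"
  unfolding rad2_def using assms p_less by (intro sum.cong) (auto simp: coord_add coord_frame)

lemma rad2_shift_q:
  assumes "s \<in> Q" shows "rad2 (x + h *\<^sub>R v s) = rad2 x + 2 * h * \<xi> s x + h\<^sup>2"
proof -
  have "rad2 (x + h *\<^sub>R v s) = (\<Sum>t\<in>Q. (\<xi> t x)\<^sup>2 + (if t = s then 2 * h * \<xi> s x + h\<^sup>2 else 0))"
    unfolding rad2_def using assms
    by (intro sum.cong) (auto simp: coord_add coord_frame power2_sum)
  then show ?thesis using assms by (simp add: sum.distrib rad2_def)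
qed

lemma has_dir_lift_p:
  assumes s: "s \<le> p" and E: "has_dir (ev s) E d (stem_pt x)"
  shows "has_dir (v s) (\<lambda>x. E (stem_pt x)) d x"
proof -
  have "stem_pt (x + h *\<^sub>R v s) = stem_pt x + h *\<^sub>R ev s" for h
    using s p_less by (simp add: stem_pt_def xp_shift rad2_shift_p ev_def)
  then show ?thesis using E by (simp add: has_dir_def)
qed

text \<open>The derivative of r along \<open>v s\<close> is \<open>\<xi> s x\<close> / r. With the
  radial derivative of E written as r times d the radius cancels, and the result makes sense on the
  axis too.\<close>

lemma has_dir_lift_q:
  assumes s: "s \<in> Q" and x: "x \<in> \<Omega>" and E: "even_stem E"
    and d: "has_dir er E (snd (stem_pt x) *\<^sub>R d) (stem_pt x)"
  shows "has_dir (v s) (\<lambda>x. E (stem_pt x)) (\<xi> s x *\<^sub>R d) x"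
proof (cases "rad2 x = 0")
  case True
  then have 0: "\<xi> t x = 0" if "t \<in> Q" for t
    using that by (simp add: rad2_def sum_nonneg_eq_0_iff)
  \<comment> \<open>A move from the axis along \<open>v s\<close> has radius
    \<open>\<bar>h\<bar>\<close>, which evenness of E replaces by h; the radial derivative at radius
    0 vanishes.\<close>
  have pt: "stem_pt (x + h *\<^sub>R v s) = (xp x, \<bar>h\<bar>)" for h
    using s 0[OF s] True by (simp add: stem_pt_def xp_shift rad2_shift_q)
  have st: "stem_pt x = (xp x, 0)" using True by (simp add: stem_pt_def)
  have xD: "(xp x, 0) \<in> D" using Omega_stem_pt[OF x] st by simp
  have "has_dir er E 0 (xp x, 0)" using d st by simp
  then have d0: "((\<lambda>h. E (xp x, h)) has_vector_derivative 0) (at 0)" by (simp add: has_dir_def)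
  show ?thesis
  proof (rule openin_dir[OF D_openin subspace_stem_space dirs_stem_space[OF er_dirs] xD])
    fix \<eta> :: real assume \<eta>: "\<eta> > 0" "\<And>h. \<bar>h\<bar> < \<eta> \<Longrightarrow> (xp x, 0) + h *\<^sub>R er \<in> D"
    have "E (xp x, h) = E (stem_pt (x + h *\<^sub>R v s))" if "h \<in> {- \<eta><..<\<eta>}" for h
    proof (cases "h \<ge> 0")
      case False
      then have "(xp x, - h) \<in> D" using \<eta>(2)[of "- h"] that by auto
      then show ?thesis using E False unfolding pt even_stem_def by fastforce
    qed (simp add: pt)
    then have "((\<lambda>h. E (stem_pt (x + h *\<^sub>R v s))) has_vector_derivative 0) (at 0)"
      by (intro has_vector_derivative_transform_within_open[OF d0, of "{- \<eta><..<\<eta>}"]) (use \<eta>(1) in auto)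
    then show ?thesis using 0[OF s] by (simp add: has_dir_def)
  qed
next
  case False
  then have pos: "rad2 x > 0" using rad2_nonneg[of x] by simp
  define r where "r = sqrt (rad2 x)"
  have r: "r > 0" using pos by (simp add: r_def)
  have pt: "stem_pt (x + h *\<^sub>R v s) = (xp x, sqrt (rad2 x + 2 * h * \<xi> s x + h\<^sup>2))" for h
    using s by (simp add: stem_pt_def xp_shift rad2_shift_q)
  have st: "stem_pt x = (xp x, r)" by (simp add: stem_pt_def r_def)
  have dr: "((\<lambda>h. sqrt (rad2 x + 2 * h * \<xi> s x + h\<^sup>2)) has_real_derivative \<xi> s x / r) (at 0)"
    using pos by (auto intro!: derivative_eq_intros simp: r_def field_simps)
  have "has_dir er E (r *\<^sub>R d) ((xp x, 0) + r *\<^sub>R er)" using d st by simp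
  from has_dir_shift[OF this]
  have dE: "((\<lambda>h. E (xp x, h)) has_vector_derivative r *\<^sub>R d) (at r)" by simp
  have "((\<lambda>h. E (xp x, h)) \<circ> (\<lambda>h. sqrt (rad2 x + 2 * h * \<xi> s x + h\<^sup>2)) has_vector_derivative (\<xi> s x / r) *\<^sub>R (r *\<^sub>R d)) (at 0)"
    by (rule vector_diff_chain_at)
      (use dr dE in \<open>auto simp: r_def has_real_derivative_iff_has_vector_derivative\<close>)
  then show ?thesis using r by (simp add: has_dir_def pt o_def)
qed

end

section \<open>The Laplacian of the induced functions\<close>

context regular_pair
begin

definition slice :: "nat \<Rightarrow> 'a \<Rightarrow> 'a" where
  "slice n x = A n (stem_pt x) + mul (xq x) (B n (stem_pt x))"

definition slice_pder :: "nat \<Rightarrow> nat \<Rightarrow> 'a \<Rightarrow> 'a" where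
  "slice_pder s n x = (if s \<le> p
     then pder (ev s) (A n) (stem_pt x) + mul (xq x) (pder (ev s) (B n) (stem_pt x))
     else \<xi> s x *\<^sub>R A (Suc n) (stem_pt x)
       + (\<xi> s x *\<^sub>R mul (xq x) (B (Suc n) (stem_pt x)) + mul (v s) (B n (stem_pt x))))"

text \<open>Differentiation is repeated along the same \<open>v s\<close>, as the Laplacian
  requires.\<close>

definition slice_pder2 :: "nat \<Rightarrow> nat \<Rightarrow> 'a \<Rightarrow> 'a" where
  "slice_pder2 s n x = (if s \<le> p
     then pder (ev s) (pder (ev s) (A n)) (stem_pt x) + mul (xq x) (pder (ev s) (pder (ev s) (B n)) (stem_pt x))
     else (\<xi> s x)\<^sup>2 *\<^sub>R A (Suc (Suc n)) (stem_pt x) + A (Suc n) (stem_pt x)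
       + ((\<xi> s x)\<^sup>2 *\<^sub>R mul (xq x) (B (Suc (Suc n)) (stem_pt x)) + mul (xq x) (B (Suc n) (stem_pt x))
         + (\<xi> s x *\<^sub>R mul (v s) (B (Suc n) (stem_pt x)) + \<xi> s x *\<^sub>R mul (v s) (B (Suc n) (stem_pt x)))))"

lemma mul_zero_left: "mul 0 x = 0"
  by (rule bounded_bilinear.zero_left[OF bil])

lemma has_dir_lift_A:
  "s \<in> Q \<Longrightarrow> x \<in> \<Omega> \<Longrightarrow> has_dir (v s) (\<lambda>x. A n (stem_pt x)) (\<xi> s x *\<^sub>R A (Suc n) (stem_pt x)) x"
  by (intro has_dir_lift_q even_A has_dir_A Omega_stem_pt)

lemma has_dir_lift_B:
  "s \<in> Q \<Longrightarrow> x \<in> \<Omega> \<Longrightarrow> has_dir (v s) (\<lambda>x. B n (stem_pt x)) (\<xi> s x *\<^sub>R B (Suc n) (stem_pt x)) x"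
  by (intro has_dir_lift_q even_B has_dir_B Omega_stem_pt)

lemma has_dir_lift_smooth:
  "s \<le> p \<Longrightarrow> x \<in> \<Omega> \<Longrightarrow> smooth E \<Longrightarrow> has_dir (v s) (\<lambda>x. E (stem_pt x)) (pder (ev s) E (stem_pt x)) x"
  by (intro has_dir_lift_p smooth_has_dir ev_dirs Omega_stem_pt)

lemma has_dir_xq_p: "s \<le> p \<Longrightarrow> has_dir (v s) xq 0 x"
  using has_dir_xq[of s x] p_less by simp

lemma has_dir_xq_q: "s \<in> Q \<Longrightarrow> has_dir (v s) xq (v s) x"
  using has_dir_xq[of s x] by simp

lemma has_dir_coord_q: "s \<in> Q \<Longrightarrow> has_dir (v s) (\<xi> s) 1 x"
  using has_dir_coord[of s s x] by simp

lemma has_dir_g: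
  assumes s: "s \<le> m" and x: "x \<in> \<Omega>"
  shows "has_dir (v s) (slice n) (slice_pder s n x) x"
proof (cases "s \<le> p")
  case True
  have "has_dir (v s) (slice n) (pder (ev s) (A n) (stem_pt x) +
      (mul (xq x) (pder (ev s) (B n) (stem_pt x)) + mul 0 (B n (stem_pt x)))) x"
    unfolding slice_def[abs_def]
    by (intro has_dir_add has_dir_bilinear[OF bil] has_dir_lift_smooth has_dir_xq_p smooth_A smooth_B True x)
  then show ?thesis using True by (simp add: slice_pder_def mul_zero_left)
next
  case False
  then have Q: "s \<in> Q" using s by auto
  have "has_dir (v s) (slice n) (\<xi> s x *\<^sub>R A (Suc n) (stem_pt x) +
      (mul (xq x) (\<xi> s x *\<^sub>R B (Suc n) (stem_pt x)) + mul (v s) (B n (stem_pt x)))) x"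
    unfolding slice_def[abs_def]
    by (intro has_dir_add has_dir_bilinear[OF bil] has_dir_lift_A has_dir_lift_B has_dir_xq_q Q x)
  then show ?thesis using False by (simp add: slice_pder_def mul_scaleR_right)
qed

lemma has_dir_g1:
  assumes s: "s \<le> m" and x: "x \<in> \<Omega>"
  shows "has_dir (v s) (slice_pder s n) (slice_pder2 s n x) x"
proof (cases "s \<le> p")
  case True
  have "has_dir (v s) (\<lambda>x. pder (ev s) (A n) (stem_pt x) + mul (xq x) (pder (ev s) (B n) (stem_pt x)))
      (pder (ev s) (pder (ev s) (A n)) (stem_pt x) +
      (mul (xq x) (pder (ev s) (pder (ev s) (B n)) (stem_pt x)) + mul 0 (pder (ev s) (B n) (stem_pt x)))) x"
    by (intro has_dir_add has_dir_bilinear[OF bil] has_dir_lift_smooth has_dir_xq_p smooth_pder ev_dirs smooth_A smooth_B True x)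
  then show ?thesis using True by (simp add: slice_pder_def[abs_def] slice_pder2_def mul_zero_left)
next
  case False
  then have Q: "s \<in> Q" using s by auto
  have "has_dir (v s) (\<lambda>x. \<xi> s x *\<^sub>R A (Suc n) (stem_pt x)
       + (\<xi> s x *\<^sub>R mul (xq x) (B (Suc n) (stem_pt x)) + mul (v s) (B n (stem_pt x))))
     (\<xi> s x *\<^sub>R (\<xi> s x *\<^sub>R A (Suc (Suc n)) (stem_pt x)) + 1 *\<^sub>R A (Suc n) (stem_pt x)
       + (\<xi> s x *\<^sub>R (mul (xq x) (\<xi> s x *\<^sub>R B (Suc (Suc n)) (stem_pt x)) + mul (v s) (B (Suc n) (stem_pt x)))
           + 1 *\<^sub>R mul (xq x) (B (Suc n) (stem_pt x))
         + mul (v s) (\<xi> s x *\<^sub>R B (Suc n) (stem_pt x)))) x"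
    by (intro has_dir_add has_dir_scaleR has_dir_bilinear[OF bil] has_dir_lift_A has_dir_lift_B has_dir_xq_q has_dir_coord_q
        has_dir_linear[OF bounded_bilinear.bounded_linear_right[OF bil]] Q x)
  then show ?thesis
    using False by (simp add: slice_pder_def[abs_def] slice_pder2_def mul_scaleR_right power2_eq_square scaleR_add_right scaleR_2 add_ac)
qed

lemma sum_split: "(\<Sum>s\<le>m. F s) = (\<Sum>s\<le>p. F s) + (\<Sum>s\<in>Q. F s)" for F :: "nat \<Rightarrow> 'a"
proof -
  have "{..m} = {..p} \<union> Q" using p_less by auto
  then show ?thesis by (simp add: sum.union_disjoint)
qed

lemma mul_xq: "mul (xq x) b = (\<Sum>s\<in>Q. \<xi> s x *\<^sub>R mul (v s) b)"
  unfolding xq_def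
  by (simp add: bounded_bilinear.sum_left[OF bil] bounded_bilinear.scaleR_left[OF bil])

lemma snd_stem_pt_square: "(snd (stem_pt x))\<^sup>2 = rad2 x"
  by (simp add: stem_pt_def rad2_nonneg)

text \<open>The x_p directions contribute -(2 n + 1) to the A term and -(2 n + 3) to the B term. The
  x_q directions contribute q to each, from differentiating the coordinate factor, and 2 more to the
  B term, from the cross terms with \<open>xq\<close>. The terms with r^2 cancel.\<close>

lemma laplace_g:
  assumes x: "x \<in> \<Omega>"
  shows "(\<Sum>s\<le>m. slice_pder2 s n x) = (real (m - p) - 1 - 2 * real n) *\<^sub>R slice (Suc n) x"
proof -
  let ?z = "stem_pt x"
  have z: "?z \<in> D" by (rule Omega_stem_pt[OF x])
  have "(\<Sum>s\<le>p. slice_pder2 s n x) = (\<Sum>s\<le>p. pder (ev s) (pder (ev s) (A n)) ?z) + mul (xq x) (\<Sum>s\<le>p. pder (ev s) (pder (ev s) (B n)) ?z)"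
    by (simp add: slice_pder2_def sum.distrib mul_sum_right)
  also have "\<dots> = - ((2 * n + 1) *\<^sub>R A (Suc n) ?z) - rad2 x *\<^sub>R A (Suc (Suc n)) ?z
      + mul (xq x) (- ((2 * n + 3) *\<^sub>R B (Suc n) ?z) - rad2 x *\<^sub>R B (Suc (Suc n)) ?z)"
    by (simp only: laplace_A[OF z] laplace_B[OF z] snd_stem_pt_square)
  finally have 1: "(\<Sum>s\<le>p. slice_pder2 s n x) = \<dots>" .
  have "(\<Sum>s\<in>Q. slice_pder2 s n x) = rad2 x *\<^sub>R A (Suc (Suc n)) ?z + real (m - p) *\<^sub>R A (Suc n) ?z
      + (rad2 x *\<^sub>R mul (xq x) (B (Suc (Suc n)) ?z) + real (m - p) *\<^sub>R mul (xq x) (B (Suc n) ?z)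
       + (mul (xq x) (B (Suc n) ?z) + mul (xq x) (B (Suc n) ?z)))"
  proof -
    have "(\<Sum>s\<in>Q. slice_pder2 s n x) = (\<Sum>s\<in>Q. (\<xi> s x)\<^sup>2 *\<^sub>R A (Suc (Suc n)) ?z + A (Suc n) ?z
       + ((\<xi> s x)\<^sup>2 *\<^sub>R mul (xq x) (B (Suc (Suc n)) ?z) + mul (xq x) (B (Suc n) ?z)
         + (\<xi> s x *\<^sub>R mul (v s) (B (Suc n) ?z) + \<xi> s x *\<^sub>R mul (v s) (B (Suc n) ?z))))"
      by (intro sum.cong) (auto simp: slice_pder2_def)
    moreover have "(\<Sum>s\<in>Q. c) = real (m - p) *\<^sub>R c" for c :: 'a
      by (simp add: sum_constant_scaleR)
    moreover have "(\<Sum>s\<in>Q. \<xi> s x *\<^sub>R mul (v s) (B (Suc n) ?z)) = mul (xq x) (B (Suc n) ?z)"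
      by (rule mul_xq[symmetric])
    ultimately show ?thesis
      by (simp only: sum.distrib rad2_def scaleR_sum_left)
  qed
  moreover have "slice (Suc n) x = A (Suc n) ?z + mul (xq x) (B (Suc n) ?z)" by (simp add: slice_def)
  moreover have "(2 * n + 3) *\<^sub>R y = (2 * n + 1) *\<^sub>R y + (y + y)" for y :: 'a
    using scaleR_left_distrib[of "2 * n + 1" 2 y] by (simp add: scaleR_2 add.commute)
  ultimately show ?thesis
    unfolding sum_split 1
    by (simp add: mul_add_right mul_diff_right mul_minus_right mul_scaleR_right scaleR_add_right scaleR_diff_left scaleR_add_left
        algebra_simps)
qed

text \<open>Expanded in coordinates, the mixed terms anticommute and cancel, and every diagonal term
  is a square of an imaginary unit.\<close>

lemma mul_xq_xq: "mul (xq x) (mul (xq x) b) = - (rad2 x *\<^sub>R b)"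
proof -
  have "mul (xq x) (mul (xq x) b) = (\<Sum>s\<in>Q. \<xi> s x *\<^sub>R mul (v s) (mul (xq x) b))"
    by (rule mul_xq)
  also have "\<dots> = (\<Sum>s\<in>Q. \<Sum>t\<in>Q. (\<xi> s x * \<xi> t x) *\<^sub>R mul (v s) (mul (v t) b))"
  proof (rule sum.cong[OF refl])
    fix s
    show "\<xi> s x *\<^sub>R mul (v s) (mul (xq x) b) = (\<Sum>t\<in>Q. (\<xi> s x * \<xi> t x) *\<^sub>R mul (v s) (mul (v t) b))"
      by (subst mul_xq, subst mul_sum_right, subst scaleR_sum_right, subst mul_scaleR_right, subst scaleR_scaleR) (rule refl)
  qed
  also have "\<dots> = (\<Sum>s\<in>Q. - ((\<xi> s x)\<^sup>2 *\<^sub>R b))"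
  proof (rule sum_half_symmetric[where I = Q and a = "\<lambda>s. - ((\<xi> s x)\<^sup>2 *\<^sub>R b)"
        and g = "\<lambda>s t. (\<xi> s x * \<xi> t x) *\<^sub>R mul (v s) (mul (v t) b)"])
    fix s t assume st: "s \<in> Q" "t \<in> Q"
    show "(\<xi> s x * \<xi> t x) *\<^sub>R mul (v s) (mul (v t) b) + (\<xi> t x * \<xi> s x) *\<^sub>R mul (v t) (mul (v s) b) =
        (if s = t then 2 *\<^sub>R (- ((\<xi> s x)\<^sup>2 *\<^sub>R b)) else 0)"
    proof (cases "s = t")
      case True
      have "mul (v t) (mul (v t) b) = - b" using st by (intro v_square) auto
      then show ?thesis unfolding True scaleR_2 by (simp add: power2_eq_square)
    next
      case False
      then show ?thesis using v_anticommute[of s t b] st by (simp add: mult.commute)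
    qed
  qed simp
  also have "\<dots> = - (rad2 x *\<^sub>R b)"
    by (simp add: rad2_def sum_negf scaleR_sum_left)
  finally show ?thesis .
qed

text \<open>Pulling \<open>xq\<close> out to the left costs a sign for each imaginary unit passed,
  which turns D in x_p into its conjugate.\<close>

lemma mul_frame_xq:
  assumes "s \<le> p" shows "mul (v s) (mul (xq x) b) = mul (xq x) (conj_sign s *\<^sub>R mul (v s) b)"
proof (cases "s = 0")
  case True then show ?thesis by (simp add: v_0 conj_sign_def)
next
  case False
  have "mul (v s) (mul (xq x) b) = (\<Sum>t\<in>Q. \<xi> t x *\<^sub>R mul (v s) (mul (v t) b))"
    by (simp add: mul_xq mul_sum_right mul_scaleR_right)
  also have "\<dots> = (\<Sum>t\<in>Q. - (\<xi> t x *\<^sub>R mul (v t) (mul (v s) b)))"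
    using assms False p_less by (intro sum.cong refl) (auto simp: v_anticommute[of s])
  also have "\<dots> = mul (xq x) (conj_sign s *\<^sub>R mul (v s) b)"
    using False by (simp add: mul_xq conj_sign_def sum_negf mul_minus_right)
  finally show ?thesis .
qed

text \<open>The terms with \<open>A (Suc n)\<close> cancel between the x_p and x_q directions, as do
  those with r^2; what remains is \<open>B n\<close> with coefficient 2 n + 1 - q.\<close>

lemma dirac_g:
  assumes x: "x \<in> \<Omega>" and n: "2 * n + 1 = m - p"
  shows "(\<Sum>s\<le>m. mul (v s) (slice_pder s n x)) = 0"
proof -
  let ?z = "stem_pt x"
  have z: "?z \<in> D" by (rule Omega_stem_pt[OF x])
  have "(\<Sum>s\<le>p. mul (v s) (slice_pder s n x)) = gdirac (\<lambda>s. 1) (A n) ?z + mul (xq x) (gdirac conj_sign (B n) ?z)"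
    by (simp add: slice_pder_def gdirac_def mul_add_right sum.distrib mul_frame_xq mul_sum_right)
  moreover have "(\<Sum>s\<in>Q. mul (v s) (slice_pder s n x)) =
      mul (xq x) (A (Suc n) ?z) + (mul (xq x) (mul (xq x) (B (Suc n) ?z)) - real (m - p) *\<^sub>R B n ?z)"
  proof -
    have "(\<Sum>s\<in>Q. mul (v s) (slice_pder s n x)) = (\<Sum>s\<in>Q. \<xi> s x *\<^sub>R mul (v s) (A (Suc n) ?z)
       + (\<xi> s x *\<^sub>R mul (v s) (mul (xq x) (B (Suc n) ?z)) + - B n ?z))"
      by (intro sum.cong refl) (auto simp: slice_pder_def mul_add_right mul_scaleR_right v_square)
    moreover have "(\<Sum>s\<in>Q. - B n ?z) = - (real (m - p) *\<^sub>R B n ?z)"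
      by (simp add: sum_constant_scaleR)
    ultimately show ?thesis
      by (simp only: sum.distrib mul_xq[symmetric]) simp
  qed
  moreover have "real (m - p) = 2 * real n + 1" using n by linarith
  ultimately show ?thesis
    by (simp add: sum_split dirac_A[OF z] conj_dirac_B[OF z] snd_stem_pt_square mul_xq_xq mul_minus_right)
qed

lemma continuous_on_mul: "continuous_on S a \<Longrightarrow> continuous_on S b \<Longrightarrow> continuous_on S (\<lambda>x. mul (a x) (b x))"
  by (rule bounded_bilinear.continuous_on[OF bil])

lemma continuous_on_g: "continuous_on \<Omega> (slice n)"
  unfolding slice_def
  by (intro continuous_on_add continuous_on_mul continuous_on_lift continuous_on_xq smooth_continuous smooth_A smooth_B)

lemma continuous_on_g1: "continuous_on \<Omega> (slice_pder s n)"
proof (cases "s \<le> p")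
  case True
  have "continuous_on \<Omega> (\<lambda>x. pder (ev s) (A n) (stem_pt x) + mul (xq x) (pder (ev s) (B n) (stem_pt x)))"
    by (intro continuous_on_add continuous_on_mul continuous_on_lift continuous_on_xq smooth_continuous
        smooth_pder ev_dirs smooth_A smooth_B True)
  then show ?thesis using True by (simp add: slice_pder_def[abs_def])
next
  case False
  have "continuous_on \<Omega> (\<lambda>x. \<xi> s x *\<^sub>R A (Suc n) (stem_pt x)
       + (\<xi> s x *\<^sub>R mul (xq x) (B (Suc n) (stem_pt x)) + mul (v s) (B n (stem_pt x))))"
    by (intro continuous_on_add continuous_on_scaleR continuous_on_mul continuous_on_const continuous_on_lift continuous_on_xq
        continuous_on_coord smooth_continuous smooth_A smooth_B)
  then show ?thesis using False by (simp add: slice_pder_def[abs_def])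
qed

text \<open>An iterated Laplacian of f is known on the completion only, so each derivative is
  transferred from the slice function within that relatively open set.\<close>

lemma multiple_has_dir:
  assumes h: "\<And>x. x \<in> \<Omega> \<Longrightarrow> h x = c *\<^sub>R slice n x" and s: "s \<le> m" and x: "x \<in> \<Omega>"
  shows "has_dir (v s) h (c *\<^sub>R slice_pder s n x) x" "has_dir (v s) (pder (v s) h) (c *\<^sub>R slice_pder2 s n x) x"
proof -
  have 1: "has_dir (v s) h (c *\<^sub>R slice_pder s n x) x" if x: "x \<in> \<Omega>" for x
    by (rule Omega_transform[OF s x _ h]) (intro has_dir_linear[OF bounded_linear_scaleR_right] has_dir_g s x)
  show "has_dir (v s) h (c *\<^sub>R slice_pder s n x) x" by (rule 1[OF x])
  show "has_dir (v s) (pder (v s) h) (c *\<^sub>R slice_pder2 s n x) x"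
  proof (rule Omega_transform[OF s x])
    show "has_dir (v s) (\<lambda>x. c *\<^sub>R slice_pder s n x) (c *\<^sub>R slice_pder2 s n x) x"
      by (intro has_dir_linear[OF bounded_linear_scaleR_right] has_dir_g1 s x)
    show "pder (v s) h x = c *\<^sub>R slice_pder s n x" if "x \<in> \<Omega>" for x
      using 1[OF that] by (rule has_dir_pder)
  qed
qed

lemma multiple_Laplace:
  assumes h: "\<And>x. x \<in> \<Omega> \<Longrightarrow> h x = c *\<^sub>R slice n x" and x: "x \<in> \<Omega>"
  shows "Laplace v m h x = (c * (real (m - p) - 1 - 2 * real n)) *\<^sub>R slice (Suc n) x"
proof -
  have "Laplace v m h x = (\<Sum>s\<le>m. c *\<^sub>R slice_pder2 s n x)"
    unfolding Laplace_def by (intro sum.cong refl has_dir_pder multiple_has_dir(2)[OF h _ x]) auto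
  then show ?thesis by (simp add: laplace_g[OF x] flip: scaleR_sum_right)
qed

lemma multiple_monogenic:
  assumes h: "\<And>x. x \<in> \<Omega> \<Longrightarrow> h x = c *\<^sub>R slice n x" and n: "2 * n + 1 = m - p"
  shows "monogenic_on mul v m \<Omega> h"
  unfolding monogenic_on_def C1_on_def
proof (intro conjI allI impI ballI)
  have p: "pder (v s) h x = c *\<^sub>R slice_pder s n x" if "s \<le> m" "x \<in> \<Omega>" for s x
    using multiple_has_dir(1)[OF h that] by (rule has_dir_pder)
  have "continuous_on \<Omega> (\<lambda>x. c *\<^sub>R slice n x)"
    by (intro continuous_on_scaleR continuous_on_const continuous_on_g)
  then show "continuous_on \<Omega> h" by (rule continuous_on_eq) (simp add: h)
  show "has_pder (v s) h x" if "s \<le> m" "x \<in> \<Omega>" for s x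
    using multiple_has_dir(1)[OF h that] by (rule has_dir_has_pder)
  show "continuous_on \<Omega> (pder (v s) h)" if "s \<le> m" for s
  proof -
    have "continuous_on \<Omega> (\<lambda>x. c *\<^sub>R slice_pder s n x)"
      by (intro continuous_on_scaleR continuous_on_const continuous_on_g1)
    then show ?thesis by (rule continuous_on_eq) (simp add: p that)
  qed
  show "Dirac mul v m h x = 0" if x: "x \<in> \<Omega>" for x
  proof -
    have "Dirac mul v m h x = c *\<^sub>R (\<Sum>s\<le>m. mul (v s) (slice_pder s n x))"
      unfolding Dirac_def scaleR_sum_right by (intro sum.cong refl) (simp add: p x mul_scaleR_right)
    then show ?thesis by (simp add: dirac_g[OF x n])
  qed
qed

text \<open>Step j multiplies by q - 1 - 2 j = 2 (k - j), the next factor of the double factorial.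
  The invariant pairs c with the factors still to come, so at \<open>j = k\<close> the cofactor is
  \<open>dfact 0\<close>, which is 1.\<close>

lemma iterated_Laplace:
  assumes f: "\<And>x. x \<in> \<Omega> \<Longrightarrow> f x = slice 0 x" and k: "2 * k + 1 = m - p" and j: "j \<le> k"
  shows "\<exists>c. real (dfact (2 * k)) = c * real (dfact (2 * (k - j))) \<and>
      (\<forall>x\<in>\<Omega>. (Laplace v m ^^ j) f x = c *\<^sub>R slice j x)"
  using j
proof (induction j)
  case 0
  then show ?case using f by (intro exI[of _ 1]) simp
next
  case (Suc j)
  then obtain c where c: "real (dfact (2 * k)) = c * real (dfact (2 * (k - j)))"
    "\<And>x. x \<in> \<Omega> \<Longrightarrow> (Laplace v m ^^ j) f x = c *\<^sub>R slice j x" by auto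
  let ?e = "real (m - p) - 1 - 2 * real j"
  have e: "?e = real (2 * (k - j))" using k Suc.prems by (simp add: of_nat_diff flip: k)
  have "2 * (k - j) = Suc (Suc (2 * (k - Suc j)))" using Suc.prems by simp
  then have "dfact (2 * (k - j)) = 2 * (k - j) * dfact (2 * (k - Suc j))"
    by (metis dfact.simps(3))
  then have "real (dfact (2 * k)) = (c * ?e) * real (dfact (2 * (k - Suc j)))"
    unfolding c(1) e by simp
  moreover have "\<forall>x\<in>\<Omega>. (Laplace v m ^^ Suc j) f x = (c * ?e) *\<^sub>R slice (Suc j) x"
    using multiple_Laplace[OF c(2)] by simp
  ultimately show ?case by blast
qed

text \<open>The operator \<open>pder_r_inv_r\<close> is \<open>radial_deriv\<close> conjugated by
  multiplication with r: applied to r B it gives d_r B, which is r times the radial derivative of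
  B.\<close>

lemma stem_operators:
  assumes z: "z \<in> D" "snd z \<noteq> 0"
  shows "(inv_r_pder_r ^^ n) F1 z = A n z" "(pder_r_inv_r ^^ n) F2 z = snd z *\<^sub>R B n z"
proof -
  have pr: "pder_r G z = pder er G z" for G :: "'a \<times> real \<Rightarrow> 'a" and z
    by (cases z) (simp add: pder_r_def pder_def)
  \<comment> \<open>The literal iterates divide by 0 on the axis, so the comparison takes place on
    the part of D off the axis, which is relatively open.\<close>
  have cong: "pder er K z = d" if "has_dir er G d z" "\<And>z. z \<in> D \<Longrightarrow> snd z \<noteq> 0 \<Longrightarrow> K z = G z" "z \<in> D" "snd z \<noteq> 0"
    for K G :: "'a \<times> real \<Rightarrow> 'a" and d z
    by (rule has_dir_pder, rule has_dir_transform_openin[OF openin_off_axis subspace_stem_space dirs_stem_space[OF er_dirs] _ that(1)])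
      (use that in auto)
  have "\<forall>z\<in>D. snd z \<noteq> 0 \<longrightarrow> (inv_r_pder_r ^^ n) F1 z = A n z"
  proof (induction n)
    case 0 show ?case by (simp add: A_def)
  next
    case (Suc n)
    show ?case
    proof (intro ballI impI)
      fix z assume z: "z \<in> D" "snd z \<noteq> 0"
      have "(inv_r_pder_r ^^ Suc n) F1 z = (1 / snd z) *\<^sub>R pder er ((inv_r_pder_r ^^ n) F1) z"
        by (simp only: funpow.simps o_def inv_r_pder_r_def[of "(inv_r_pder_r ^^ n) F1"] pr)
      also have "pder er ((inv_r_pder_r ^^ n) F1) z = snd z *\<^sub>R A (Suc n) z"
        by (rule cong[OF has_dir_A[OF z(1)] _ z]) (use Suc.IH in blast)
      finally show "(inv_r_pder_r ^^ Suc n) F1 z = A (Suc n) z" using z(2) by simp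
    qed
  qed
  then show "(inv_r_pder_r ^^ n) F1 z = A n z" using z by blast
  have "\<forall>z\<in>D. snd z \<noteq> 0 \<longrightarrow> (pder_r_inv_r ^^ n) F2 z = snd z *\<^sub>R B n z"
  proof (induction n)
    case 0 show ?case by (simp add: F2_eq)
  next
    case (Suc n)
    show ?case
    proof (intro ballI impI)
      fix z assume z: "z \<in> D" "snd z \<noteq> 0"
      have "(pder_r_inv_r ^^ Suc n) F2 z = pder er (\<lambda>z. (1 / snd z) *\<^sub>R (pder_r_inv_r ^^ n) F2 z) z"
        by (simp only: funpow.simps o_def pder_r_inv_r_def[of "(pder_r_inv_r ^^ n) F2"] pr)
      also have "\<dots> = snd z *\<^sub>R B (Suc n) z"
        by (rule cong[OF has_dir_B[OF z(1)] _ z]) (use Suc.IH in simp)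
      finally show "(pder_r_inv_r ^^ Suc n) F2 z = snd z *\<^sub>R B (Suc n) z" .
    qed
  qed
  then show "(pder_r_inv_r ^^ n) F2 z = snd z *\<^sub>R B n z" using z by blast
qed

text \<open>Off the axis the iterates coincide with functions continuous on all of D, whose axis
  values are therefore the limits; the second function carries a factor r.\<close>

lemma stem_operators_limit:
  assumes y: "(y, 0) \<in> D"
  shows "((inv_r_pder_r ^^ n) F1 \<longlongrightarrow> A n (y, 0)) (at (y, 0) within D \<inter> {z. snd z \<noteq> 0})"
    and "((pder_r_inv_r ^^ n) F2 \<longlongrightarrow> 0) (at (y, 0) within D \<inter> {z. snd z \<noteq> 0})"
proof -
  have lim: "(G \<longlongrightarrow> G (y, 0)) (at (y, 0) within D \<inter> {z. snd z \<noteq> 0})" if "continuous_on D G" for G :: "'a \<times> real \<Rightarrow> 'a"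
    using that y by (auto simp: continuous_on_def intro: tendsto_within_subset)
  have ev: "\<forall>\<^sub>F z in at (y, 0) within D \<inter> {z. snd z \<noteq> 0}. z \<in> D \<and> snd z \<noteq> 0"
    unfolding eventually_at_topological by auto
  show "((inv_r_pder_r ^^ n) F1 \<longlongrightarrow> A n (y, 0)) (at (y, 0) within D \<inter> {z. snd z \<noteq> 0})"
    by (rule Lim_transform_eventually[OF lim[OF smooth_continuous[OF smooth_A]]])
      (use ev in eventually_elim, simp add: stem_operators)
  have "continuous_on D (\<lambda>z. snd z *\<^sub>R B n z)"
    by (intro continuous_intros smooth_continuous smooth_B)
  from lim[OF this] have "((\<lambda>z. snd z *\<^sub>R B n z) \<longlongrightarrow> 0) (at (y, 0) within D \<inter> {z. snd z \<noteq> 0})" by simp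
  then show "((pder_r_inv_r ^^ n) F2 \<longlongrightarrow> 0) (at (y, 0) within D \<inter> {z. snd z \<noteq> 0})"
    by (rule Lim_transform_eventually) (use ev in eventually_elim, simp add: stem_operators)
qed

end

section \<open>The frame in the alternative algebra, and the assembly of the result\<close>

lemma clifford_frame_alternative:
  fixes mul :: "'a::euclidean_space \<Rightarrow> 'a \<Rightarrow> 'a"
  assumes alg: "real_alternative_algebra mul e" and v0: "v 0 = e"
    and v_indep: "inj_on v {..m}" "independent (v ` {..m})"
    and v_sphere: "\<forall>s\<in>{1..m}. v s \<in> sphere_alg mul e cj"
    and v_anti: "\<forall>s\<in>{1..m}. \<forall>t\<in>{1..m}. s \<noteq> t \<longrightarrow> mul (v s) (v t) = - mul (v t) (v s)"
  shows "clifford_frame mul v m"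
proof -
  have bl: "bilinear mul" using alg by (simp add: real_alternative_algebra_def)
  have left: "mul (mul a a) b = mul a (mul a b)" for a b
    using alg by (simp add: real_alternative_algebra_def assoc_def)
  have e: "mul e x = x" for x using alg by (simp add: real_alternative_algebra_def)
  \<comment> \<open>Left alternativity applied to a sum, with the pure squares removed; this
    transfers anticommutation of two elements to their left multiplications.\<close>
  have lin: "mul (mul a b) c + mul (mul b a) c = mul a (mul b c) + mul b (mul a c)" for a b c
    using left[of "a + b" c] by (simp add: bilinear_ladd[OF bl] bilinear_radd[OF bl] left add_ac)
  show ?thesis
  proof (rule clifford_frame.intro)
    show "bounded_bilinear mul" using bl by (simp add: bilinear_conv_bounded_bilinear)
    show "mul (v 0) x = x" for x by (simp add: v0 e)
    show "mul (v s) (mul (v s) x) = - x" if "s \<in> {1..m}" for s x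
    proof -
      have "v s + cj (v s) = 0" "mul (v s) (cj (v s)) = e"
        using v_sphere that by (auto simp: sphere_alg_def trace_alg_def norm_alg_def)
      \<comment> \<open>Trace zero makes the conjugate of \<open>v s\<close> its negative, so the
        norm condition determines the square.\<close>
      then have "mul (v s) (- v s) = e" by (metis add_eq_0_iff)
      then have "mul (v s) (v s) = - e" by (metis bilinear_rneg[OF bl] add.inverse_inverse)
      then show ?thesis using left[of "v s" x] by (simp add: bilinear_lneg[OF bl] e)
    qed
    show "mul (v s) (mul (v t) x) = - mul (v t) (mul (v s) x)"
      if "s \<in> {1..m}" "t \<in> {1..m}" "s \<noteq> t" for s t x
    proof -
      have "mul (mul (v s) (v t)) x + mul (mul (v t) (v s)) x = 0"
      proof -
        have "mul (v s) (v t) = - mul (v t) (v s)" using v_anti that by blast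
        then show ?thesis by (subst \<open>mul (v s) (v t) = _\<close>) (simp add: bilinear_lneg[OF bl])
      qed
      then show ?thesis using lin[of "v s" "v t" x] by (simp add: eq_neg_iff_add_eq_0)
    qed
  qed (rule v_indep)+
qed

text \<open>Since \<open>pder\<close> yields an arbitrary value where no derivative exists, the
  first conjunct certifies that each Laplacian taken is built from existing derivatives. On the axis
  the formula is stated through limits over points with nonzero radius, and these limits are fixed
  before w is chosen.\<close>

theorem theorem4p9:
  fixes mul :: "'a::euclidean_space \<Rightarrow> 'a \<Rightarrow> 'a"
    and e :: 'a and cj :: "'a \<Rightarrow> 'a"
    and v :: "nat \<Rightarrow> 'a" and m p :: nat
    and D :: "('a \<times> real) set"
    and F1 F2 :: "'a \<times> real \<Rightarrow> 'a" and f :: "'a \<Rightarrow> 'a"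
  assumes dim: "DIM('a) > 1"
    and alg: "real_alternative_algebra mul e"
    and inv: "anti_involution mul e cj"
    and m: "m \<ge> 1" and p: "p < m" and q_odd: "odd (m - p)"
    and v0: "v 0 = e"
    and v_indep: "inj_on v {..m}" "independent (v ` {..m})"
    and v_sphere: "\<forall>s\<in>{1..m}. v s \<in> sphere_alg mul e cj"
    and v_anti: "\<forall>s\<in>{1..m}. \<forall>t\<in>{1..m}. s \<noteq> t \<longrightarrow> mul (v s) (v t) = - mul (v t) (v s)"
    and M_cone: "span (v ` {..m}) \<subseteq> quadratic_cone mul e cj"
    and D_open: "openin (top_of_set (span (v ` {..p}) \<times> (UNIV :: real set))) D"
    and D_sym: "\<forall>y r. (y, r) \<in> D \<longrightarrow> (y, - r) \<in> D"
    and F1_even: "\<forall>y r. (y, r) \<in> D \<longrightarrow> F1 (y, - r) = F1 (y, r)"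
    and F2_odd: "\<forall>y r. (y, r) \<in> D \<longrightarrow> F2 (y, - r) = - F2 (y, r)"
    and F_C1: "C1_stem_on v p D F1" "C1_stem_on v p D F2"
    and f_slice: "\<forall>y r w. (y, r) \<in> D \<longrightarrow> r \<ge> 0 \<longrightarrow> w \<in> sphere_q v p m \<longrightarrow>
                     f (y + r *\<^sub>R w) = F1 (y, r) + mul w (F2 (y, r))"
    and regular: "\<forall>z\<in>D. Dirac_p mul v p F1 z - pder_r F2 z = 0 \<and>
                         Dirac_p_bar mul v p F2 z + pder_r F1 z = 0"
  shows "(\<forall>j < (m - p - 1) div 2. \<forall>s\<le>m. \<forall>x\<in>psym_completion v p m D.
            has_pder (v s) ((Laplace v m ^^ j) f) x \<and>
            has_pder (v s) (pder (v s) ((Laplace v m ^^ j) f)) x)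
       \<and> monogenic_on mul v m (psym_completion v p m D) ((Laplace v m ^^ ((m - p - 1) div 2)) f)
       \<and> (\<forall>y r w. (y, r) \<in> D \<longrightarrow> r > 0 \<longrightarrow> w \<in> sphere_q v p m \<longrightarrow>
            (Laplace v m ^^ ((m - p - 1) div 2)) f (y + r *\<^sub>R w) =
              real (dfact (m - p - 1)) *\<^sub>R
                ((inv_r_pder_r ^^ ((m - p - 1) div 2)) F1 (y, r)
                 + mul w ((pder_r_inv_r ^^ ((m - p - 1) div 2)) F2 (y, r))))
       \<and> (\<forall>y. (y, 0) \<in> D \<longrightarrow>
            (\<exists>a b. ((inv_r_pder_r ^^ ((m - p - 1) div 2)) F1 \<longlongrightarrow> a)
                       (at (y, 0) within D \<inter> {z. snd z \<noteq> 0})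
                 \<and> ((pder_r_inv_r ^^ ((m - p - 1) div 2)) F2 \<longlongrightarrow> b)
                       (at (y, 0) within D \<inter> {z. snd z \<noteq> 0})
                 \<and> (\<forall>w\<in>sphere_q v p m.
                      (Laplace v m ^^ ((m - p - 1) div 2)) f y =
                        real (dfact (m - p - 1)) *\<^sub>R (a + mul w b))))"
proof -
  interpret clifford_frame mul v m
    by (rule clifford_frame_alternative[OF alg v0 v_indep v_sphere v_anti])
  interpret symmetric_stem_domain mul v m p D
    by unfold_locales (use p D_open D_sym in auto)
  \<comment> \<open>The stem operators of the statement are directional derivatives on the product
    space along \<open>(w, 0)\<close> and \<open>(0, 1)\<close>.\<close>
  have pp: "pder_p w G z = pder (w, 0) G z" "has_pder_p w G z = has_pder (w, 0) G z"
    "pder_r G z = pder (0, 1) G z" "has_pder_r G z = has_pder (0, 1) G z" for w z and G :: "'a \<times> real \<Rightarrow> 'a"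
    by (cases z; simp add: pder_p_def has_pder_p_def pder_r_def has_pder_r_def pder_def has_pder_def)+
  have C1: "C1_stem G" if "C1_stem_on v p D G" for G
    using that unfolding C1_stem_on_def C1_stem_def dirs_def pp[abs_def] by (auto simp: ev_def)
  have dirac: "dirac_stem F1 z = Dirac_p mul v p F1 z" for z
    by (simp add: dirac_stem_def Dirac_p_def pp ev_def)
  have conj_dirac: "conj_dirac_stem F2 z = Dirac_p_bar mul v p F2 z" for z
  proof -
    have "{..p} = insert 0 {1..p}" by auto
    then show ?thesis
      by (simp add: conj_dirac_stem_def Dirac_p_bar_def pp ev_def conj_sign_def v_0 sum_negf cong: sum.cong_simp)
  qed
  interpret regular_pair mul v m p D F1 F2
  proof
    show "regular_stem F1 F2"
      using C1 F_C1 regular unfolding regular_stem_def dirac conj_dirac pp by (auto simp: add_eq_0_iff)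
    show "even_stem F1" "odd_stem F2"
      using F1_even F2_odd by (auto simp: even_stem_def odd_stem_def)
  qed
  define k where "k = (m - p - 1) div 2"
  have k: "2 * k + 1 = m - p" "m - p - 1 = 2 * k"
    using q_odd p by (auto simp: k_def elim!: oddE)
  have in_\<Omega>: "y + r *\<^sub>R w \<in> \<Omega>" if "(y, r) \<in> D" "r \<ge> 0" "w \<in> sphere_q v p m" for y r w
    using that unfolding psym_completion_def by blast
  have g_polar: "slice n (y + r *\<^sub>R w) = A n (y, r) + mul w (r *\<^sub>R B n (y, r))"
    if "(y, r) \<in> D" "r \<ge> 0" "w \<in> sphere_q v p m" for n y r w
    by (simp add: slice_def polar[OF that] mul_scaleR_right bounded_bilinear.scaleR_left[OF bil])
  \<comment> \<open>An axis point has many polar forms; \<open>slice 0\<close> is a function of x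
    itself and agrees with the prescribed value for each of them.\<close>
  have f: "f x = slice 0 x" if x\<Omega>: "x \<in> \<Omega>" for x
  proof -
    obtain y r w where x: "x = y + r *\<^sub>R w" "(y, r) \<in> D" "r \<ge> 0" "w \<in> sphere_q v p m"
      using x\<Omega> unfolding psym_completion_def by blast
    have "f x = F1 (y, r) + mul w (F2 (y, r))" using f_slice x by simp
    also have "\<dots> = slice 0 x" using F2_eq[OF x(2)] g_polar[OF x(2-4), of 0] by (simp add: x(1) A_def)
    finally show ?thesis .
  qed
  have deriv: "has_pder (v s) ((Laplace v m ^^ j) f) x \<and> has_pder (v s) (pder (v s) ((Laplace v m ^^ j) f)) x"
    if "j < k" "s \<le> m" "x \<in> \<Omega>" for j s x
  proof -
    have "j \<le> k" using that by simp
    from iterated_Laplace[OF f k(1) this] obtain c where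
      "\<And>x. x \<in> \<Omega> \<Longrightarrow> (Laplace v m ^^ j) f x = c *\<^sub>R slice j x" by blast
    from multiple_has_dir[OF this that(2,3)] show ?thesis using has_dir_has_pder by blast
  qed
  have final: "(Laplace v m ^^ k) f x = real (dfact (2 * k)) *\<^sub>R slice k x" if "x \<in> \<Omega>" for x
    using iterated_Laplace[OF f k(1) order_refl] that by auto
  have mono: "monogenic_on mul v m \<Omega> ((Laplace v m ^^ k) f)"
    by (rule multiple_monogenic[OF final k(1)])
  have off_axis: "(Laplace v m ^^ k) f (y + r *\<^sub>R w) = real (dfact (2 * k)) *\<^sub>R
      ((inv_r_pder_r ^^ k) F1 (y, r) + mul w ((pder_r_inv_r ^^ k) F2 (y, r)))"
    if "(y, r) \<in> D" "r > 0" "w \<in> sphere_q v p m" for y r w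
    using that final[OF in_\<Omega>] g_polar stem_operators[of "(y, r)" k] by simp
  have axis: "\<exists>a b. ((inv_r_pder_r ^^ k) F1 \<longlongrightarrow> a) (at (y, 0) within D \<inter> {z. snd z \<noteq> 0})
      \<and> ((pder_r_inv_r ^^ k) F2 \<longlongrightarrow> b) (at (y, 0) within D \<inter> {z. snd z \<noteq> 0})
      \<and> (\<forall>w\<in>sphere_q v p m. (Laplace v m ^^ k) f y = real (dfact (2 * k)) *\<^sub>R (a + mul w b))"
    if y: "(y, 0) \<in> D" for y
  \<comment> \<open>The second limit is 0, so the axis value does not depend on w.\<close>
  proof (intro exI conjI ballI)
    show "((inv_r_pder_r ^^ k) F1 \<longlongrightarrow> A k (y, 0)) (at (y, 0) within D \<inter> {z. snd z \<noteq> 0})"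
      "((pder_r_inv_r ^^ k) F2 \<longlongrightarrow> 0) (at (y, 0) within D \<inter> {z. snd z \<noteq> 0})"
      by (rule stem_operators_limit[OF y])+
    fix w assume w: "w \<in> sphere_q v p m"
    show "(Laplace v m ^^ k) f y = real (dfact (2 * k)) *\<^sub>R (A k (y, 0) + mul w 0)"
      using final[OF in_\<Omega>[OF y _ w]] g_polar[OF y _ w, of k] by (simp add: mul_zero_right)
  qed
  show ?thesis
    unfolding k(2) unfolding k_def[symmetric, unfolded k(2)]
    using deriv mono off_axis axis by simp
qed

end
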